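(* Let $(\mathcal M,\pi,N,\phi)$ be a Poisson quasi-Nijenhuis manifold, let $\Omega$ be a 2-form on $\mathcal M$, and let $E=(T\mathcal M)_N\oplus(T^*\mathcal M)_\pi$ be the associated Courant algebroid, with Dirac structure $T^*\mathcal M$ and transversal Lagrangian subbundle $$L=\mathrm{Gr}(\Omega)=\{X+\Omega^\flat X\mid X\in T\mathcal M\}\subset E .$$ Let $((T^*\mathcal M)_\pi,\mathrm d_L,\varphi)$ be the quasi-Lie bialgebroid determined by the pair $(L,T^*\mathcal M)$. If $\Omega$ is closed, then $((T^*\mathcal M)_\pi,\mathrm d_L,\varphi)$ coincides with $((T^*\mathcal M)_\pi,\mathrm d_{\widehat N},\widehat\phi)$, where $$\widehat N=N+\pi^\sharp\,\Omega^\flat,\qquad \widehat\phi=\phi+\mathrm d_N\Omega+\tfrac12[\Omega,\Omega]_\pi ;$$ that is, $\mathrm d_L=\mathrm d_{\widehat N}$ on $\Gamma(\bigwedge^\bullet T^*\mathcal M)$ and $\varphi=\widehat\phi$.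
   Context: All manifolds, bundles and sections are real and $C^\infty$. $\mathcal L$ is the Lie derivative, $\mathrm d$ the Cartan differential, $\langle\cdot,\cdot\rangle$ the pairing of 1-forms with vector fields. **Maps.** $\pi^\sharp:T^*\mathcal M\to T\mathcal M$ is defined by $\langle\beta,\pi^\sharp\alpha\rangle=\pi(\alpha,\beta)$; $\Omega^\flat(X)=i_X\Omega$. **Bracket $[\cdot,\cdot]_\pi$.** For a bivector field $\pi$ and 1-forms, $[\alpha,\beta]_\pi=\mathcal L_{\pi^\sharp\alpha}\beta-\mathcal L_{\pi^\sharp\beta}\alpha-\mathrm d\langle\beta,\pi^\sharp\alpha\rangle$. If $\pi$ is Poisson, it is extended to the degree $-1$, $\mathbb R$-bilinear bracket on $\Gamma(\bigwedge^\bullet T^*\mathcal M)$ such that, for $\eta$ of degree $q$, $\eta'$ of degree $q'$ and any form $\eta''$: $[\eta,\eta']_\pi=-(-1)^{(q-1)(q'-1)}[\eta',\eta]_\pi$; $[\alpha,f]_\pi=\langle \mathrm df,\pi^\sharp\alpha\rangle$ for functions $f$ and 1-forms $\alpha$; $[\eta,\eta'\wedge\eta'']_\pi=[\eta,\eta']_\pi\wedge\eta''+(-1)^{(q-1)q'}\eta'\wedge[\eta,\eta'']_\pi$. $(T^*\mathcal M)_\pi$ denotes $T^*\mathcal M$ with the Lie algebroid structure with bracket $[\cdot,\cdot]_\pi$ and anchor $\pi^\sharp$; $\mathrm d_\pi$ denotes its Lie algebroid differential on $\Gamma(\bigwedge^\bullet T\mathcal M)$, so e.g. $(\mathrm d_\pi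 f)(\alpha)=(\pi^\sharp\alpha)(f)$ and $(\mathrm d_\pi Y)(\alpha,\beta)=(\pi^\sharp\alpha)\langle\beta,Y\rangle-(\pi^\sharp\beta)\langle\alpha,Y\rangle-\langle[\alpha,\beta]_\pi,Y\rangle$. **The operator $\mathrm d_N$.** For a $(1,1)$ tensor field $N$ and a $p$-form $\alpha$ with $p\ge1$, $i_N\alpha(X_1,\dots,X_p)=\sum_i\alpha(X_1,\dots,NX_i,\dots,X_p)$, $i_Nf=0$ for functions, and $\mathrm d_N=i_N\circ\mathrm d-\mathrm d\circ i_N$. Also $[X,Y]_N=[NX,Y]+[X,NY]-N[X,Y]$ and $T_N(X,Y)=[NX,NY]-N[X,Y]_N$. **PqN manifold.** A quadruple $(\mathcal M,\pi,N,\phi)$ with $\pi$ a Poisson bivector, $N$ a $(1,1)$ tensor field, $\phi$ a 3-form such that: (a) $\pi$ and $N$ are compatible, i.e. $N\pi^\sharp=\pi^\sharp N^*$ and $[\alpha,\beta]_{\pi_N}=[N^*\alpha,\beta]_\pi+[\alpha,N^*\beta]_\pi-N^*[\alpha,\beta]_\pi$ for all 1-forms $\alpha,\beta$, where $N^*$ is the transpose of $N$ and $\pi_N^\sharp=N\pi^\sharp$; (b) $\phi$ and $i_N\phi$ are closed; (c) $T_N(X,Y)=\pi^\sharp(i_{X\wedge Y}\phi)$ for all $X,Y$, where $i_{X\wedge Y}\phi=\phi(X,Y,\cdot)$. **Quasi-Lie bialgebroid.** A triple $(A,\delta,\phi)$ where $A$ is a Lie algebroid, $\delta$ is a degree-1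 derivation of $\Gamma(\bigwedge^\bullet A)$ with respect to both the wedge product and the (generalized Schouten) bracket $[\cdot,\cdot]_A$, and $\phi\in\Gamma(\bigwedge^3A)$ satisfies $\delta\phi=0$ and $\delta^2=[\phi,\cdot]_A$. For a PqN manifold, $((T^*\mathcal M)_\pi,\mathrm d_N,\phi)$ is a quasi-Lie bialgebroid (known). **The Courant algebroid $E$.** $E=(T\mathcal M)_N\oplus(T^*\mathcal M)_\pi$ is the vector bundle $T\mathcal M\oplus T^*\mathcal M$ with pairing $\langle X+\alpha,Y+\beta\rangle_E=\frac12(\langle\beta,X\rangle+\langle\alpha,Y\rangle)$, anchor $\rho(X+\alpha)=NX+\pi^\sharp\alpha$, and the $\mathbb R$-bilinear skew-symmetric bracket determined by $$[\![\alpha,\beta]\!]=[\alpha,\beta]_\pi,\qquad [\![X,Y]\!]=[X,Y]_N+i_{X\wedge Y}\phi,$$ $$[\![\alpha,Y]\!]=\Big(i_\alpha(\mathrm d_\pi Y)+\tfrac12\mathrm d_\pi\langle\alpha,Y\rangle\Big)-\Big(i_Y(\mathrm d_N\alpha)+\tfrac12\mathrm d_N\langle\alpha,Y\rangle\Big).$$ A Lagrangian subbundle of $E$ is a maximal isotropic one; a Dirac structure is a Lagrangian subbundle whose sections are closed under $[\![\cdot,\cdot]\!]$. **The quasi-Lie bialgebroid of the pair $(L,T^*\mathcal M)$.** Identify $T\mathcal M=(T^*\mathcal M)^*$ with $L$ by $X\mapsto\tilde X$, where $\tilde X\in L$ satisfies $\langle\alpha,X\rangle=2\langle\tilde X,\alpha\rangle_E$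 for all $\alpha\in T^*\mathcal M$. A form $\psi\in\Gamma(\bigwedge^kT^*\mathcal M)$ corresponds to $\tilde\psi\in\Gamma(\bigwedge^kL^* )$ via $\tilde\psi(\tilde X_1,\dots,\tilde X_k)=\psi(X_1,\dots,X_k)$. Let $[\cdot,\cdot]_L$ be the $L$-component of $[\![\cdot,\cdot]\!]$ with respect to $E=L\oplus T^*\mathcal M$. Then $$(\mathrm d_L\psi)(X_1,\dots,X_{k+1})=\sum_i(-1)^{i+1}\rho(\tilde X_i)\big(\tilde\psi(\tilde X_1,\dots,\widehat{\tilde X_i},\dots,\tilde X_{k+1})\big)+\sum_{i<j}(-1)^{i+j}\tilde\psi([\tilde X_i,\tilde X_j]_L,\tilde X_1,\dots,\widehat{\tilde X_i},\dots,\widehat{\tilde X_j},\dots,\tilde X_{k+1}),$$ where in this formula a hat denotes omission of the argument, and $\varphi(X_1,X_2,X_3)=2\langle[\![\tilde X_1,\tilde X_2]\!],\tilde X_3\rangle_E$. It is known that $((T^*\mathcal M)_\pi,\mathrm d_L,\varphi)$ is a quasi-Lie bialgebroid. *)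

theory Defs
  imports "HOL-Analysis.Analysis" "HOL-Library.Function_Algebras" "HOL-Library.Product_Plus"
begin

text \<open>
  Functions, and functions into functions, are added and multiplied pointwise
  (Function_Algebras); in particular \<open>0\<close>, \<open>+\<close>, \<open>-\<close> below make sense for scalar functions,
  vector fields and differential forms.
\<close>

section \<open>Smooth manifolds\<close>

text \<open>
  \<open>Ck k V W f\<close>: \<open>f\<close> is of class \<open>C^k\<close> on \<open>W\<close>, where \<open>W\<close> is a relatively open subset of the linear
  subspace \<open>V\<close> of a Euclidean space. Derivatives are taken within \<open>W\<close>, so that \<open>f' x v\<close> is uniquely
  determined for \<open>x \<in> W\<close> and \<open>v \<in> V\<close>. For \<open>V = UNIV\<close> this is the usual notion.
\<close>

primrec Ck :: "nat \<Rightarrow> 'e::euclidean_space set \<Rightarrow> 'e set \<Rightarrow> ('e \<Rightarrow> 'b::real_normed_vector) \<Rightarrow> bool" where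
  "Ck 0 V W f = continuous_on W f"
| "Ck (Suc k) V W f =
    (\<exists>f'. (\<forall>x\<in>W. (f has_derivative f' x) (at x within W)) \<and> (\<forall>v\<in>V. Ck k V W (\<lambda>x. f' x v)))"

definition smooth_on :: "'e::euclidean_space set \<Rightarrow> 'e set \<Rightarrow> ('e \<Rightarrow> 'b::real_normed_vector) \<Rightarrow> bool" where
  "smooth_on V W f \<longleftrightarrow> (\<forall>k. Ck k V W f)"

text \<open>
  The underlying space of a manifold is the whole type \<open>'a\<close>. Charts are pairs of a domain and a
  coordinate map with values in a linear subspace \<open>model\<close> of a Euclidean space, whose dimension is
  the dimension of the manifold. (Working with a subspace, rather than with all of \<open>'e\<close>, admits
  dimension 0, since types of class \<open>euclidean_space\<close> have positive dimension.) The atlas need not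
  be maximal.
\<close>

record ('a, 'e) manifold =
  model :: "'e set"
  atlas :: "('a set \<times> ('a \<Rightarrow> 'e)) set"

definition smooth_manifold ::
    "('a::{t2_space,second_countable_topology}, 'e::euclidean_space) manifold \<Rightarrow> bool" where
  "smooth_manifold M \<longleftrightarrow>
     subspace (model M) \<and>
     (\<Union>(U, x)\<in>atlas M. U) = UNIV \<and>
     (\<forall>(U, x)\<in>atlas M. open U \<and> openin (top_of_set (model M)) (x ` U)
        \<and> (\<exists>y. homeomorphism U (x ` U) x y)) \<and>
     (\<forall>(U, x)\<in>atlas M. \<forall>(U', x')\<in>atlas M.
        smooth_on (model M) (x ` (U \<inter> U')) (x' \<circ> inv_into U x))"

type_synonym 'a scalar = "'a \<Rightarrow> real"

definition smooth_functions :: "('a, 'e::euclidean_space) manifold \<Rightarrow> 'a scalar set" where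
  "smooth_functions M = {f. \<forall>(U, x)\<in>atlas M. smooth_on (model M) (x ` U) (f \<circ> inv_into U x)}"

section \<open>Vector fields and tensor fields\<close>

text \<open>
  Vector fields are the derivations of the algebra of smooth functions. Sections of tensor bundles
  are the \<open>C\<^sup>\<infinity>\<close>-multilinear maps on vector fields and 1-forms. Sections are made
  canonical as HOL functions by the value 0 outside their domain: a \<open>k\<close>-form is
  applied to lists, and vanishes on lists that are not lists of \<open>k\<close> vector fields. Hence
  equality of forms is equality of HOL functions, and the degree of a nonzero form is determined by the form.
\<close>

type_synonym 'a vfield = "'a scalar \<Rightarrow> 'a scalar"
type_synonym 'a form = "'a vfield list \<Rightarrow> 'a scalar"

definition smul :: "'a scalar \<Rightarrow> ('u \<Rightarrow> 'a scalar) \<Rightarrow> 'u \<Rightarrow> 'a scalar" where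
  "smul f F = (\<lambda>u. f * F u)"

abbreviation rsmul :: "real \<Rightarrow> ('u \<Rightarrow> 'a scalar) \<Rightarrow> 'u \<Rightarrow> 'a scalar" where
  "rsmul c \<equiv> smul (\<lambda>_. c)"

definition vector_fields :: "('a, 'e::euclidean_space) manifold \<Rightarrow> 'a vfield set" where
  "vector_fields M = {X. let C = smooth_functions M in
     (\<forall>f\<in>C. X f \<in> C) \<and> (\<forall>f. f \<notin> C \<longrightarrow> X f = 0) \<and>
     (\<forall>f\<in>C. \<forall>g\<in>C. X (f + g) = X f + X g) \<and>
     (\<forall>f\<in>C. \<forall>c. X ((\<lambda>_. c) * f) = (\<lambda>_. c) * X f) \<and>
     (\<forall>f\<in>C. \<forall>g\<in>C. X (f * g) = f * X g + g * X f)}"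

definition lie_bracket :: "'a vfield \<Rightarrow> 'a vfield \<Rightarrow> 'a vfield" where
  "lie_bracket X Y = (\<lambda>f. X (Y f) - Y (X f))"

definition forms :: "('a, 'e::euclidean_space) manifold \<Rightarrow> nat \<Rightarrow> 'a form set" where
  "forms M k = {\<omega>. let C = smooth_functions M; V = vector_fields M in
     (\<forall>Xs. \<not> (length Xs = k \<and> set Xs \<subseteq> V) \<longrightarrow> \<omega> Xs = 0) \<and>
     (\<forall>Xs. length Xs = k \<and> set Xs \<subseteq> V \<longrightarrow>
        \<omega> Xs \<in> C \<and>
        (\<forall>i<k. \<forall>Y\<in>V. \<omega> (Xs[i := Xs ! i + Y]) = \<omega> Xs + \<omega> (Xs[i := Y])) \<and>
        (\<forall>i<k. \<forall>f\<in>C. \<omega> (Xs[i := smul f (Xs ! i)]) = f * \<omega> Xs) \<and>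
        (\<not> distinct Xs \<longrightarrow> \<omega> Xs = 0))}"

definition form0 :: "'a scalar \<Rightarrow> 'a form" where
  "form0 f = (\<lambda>Xs. if Xs = [] then f else 0)"

definition pairing :: "'a form \<Rightarrow> 'a vfield \<Rightarrow> 'a scalar" where
  "pairing \<alpha> X = \<alpha> [X]"

definition tensor11 :: "('a, 'e::euclidean_space) manifold \<Rightarrow> ('a vfield \<Rightarrow> 'a vfield) set" where
  "tensor11 M = {N. let V = vector_fields M in
     (\<forall>X\<in>V. N X \<in> V) \<and> (\<forall>X\<in>V. \<forall>Y\<in>V. N (X + Y) = N X + N Y) \<and>
     (\<forall>f\<in>smooth_functions M. \<forall>X\<in>V. N (smul f X) = smul f (N X))}"

type_synonym 'a bivector = "'a form \<Rightarrow> 'a form \<Rightarrow> 'a scalar"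

definition bivector_fields :: "('a, 'e::euclidean_space) manifold \<Rightarrow> 'a bivector set" where
  "bivector_fields M = {\<pi>. let C = smooth_functions M; F = forms M 1 in
     (\<forall>\<alpha>\<in>F. \<forall>\<beta>\<in>F. \<pi> \<alpha> \<beta> \<in> C) \<and> (\<forall>\<alpha>\<in>F. \<pi> \<alpha> \<alpha> = 0) \<and>
     (\<forall>\<alpha>\<in>F. \<forall>\<beta>\<in>F. \<forall>\<gamma>\<in>F. \<pi> (\<alpha> + \<beta>) \<gamma> = \<pi> \<alpha> \<gamma> + \<pi> \<beta> \<gamma> \<and> \<pi> \<gamma> (\<alpha> + \<beta>) = \<pi> \<gamma> \<alpha> + \<pi> \<gamma> \<beta>) \<and>
     (\<forall>f\<in>C. \<forall>\<alpha>\<in>F. \<forall>\<beta>\<in>F. \<pi> (smul f \<alpha>) \<beta> = f * \<pi> \<alpha> \<beta> \<and> \<pi> \<alpha> (smul f \<beta>) = f * \<pi> \<alpha> \<beta>)}"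

section \<open>Cartan calculus\<close>

text \<open>
  The differential of a Lie algebroid with space of sections \<open>S\<close>, anchor \<open>\<rho>\<close> and bracket \<open>br\<close>:
  \[ (d\omega)(u_0,\dots,u_k) = \sum_i (-1)^i \rho(u_i)\,\omega(\dots,\widehat{u_i},\dots)
     + \sum_{i<j} (-1)^{i+j} \omega([u_i,u_j],\dots,\widehat{u_i},\dots,\widehat{u_j},\dots). \]
  Since \<open>\<omega>\<close> vanishes on lists of the wrong length, the degree need not be mentioned.
  Positions are counted from 0, which leaves the signs as they are when counted from 1 in the form
  \<open>(-1)^(i+1)\<close> and \<open>(-1)^(i+j)\<close>.
\<close>

definition algebroid_d ::
    "'u set \<Rightarrow> ('u \<Rightarrow> 'a vfield) \<Rightarrow> ('u \<Rightarrow> 'u \<Rightarrow> 'u) \<Rightarrow> ('u list \<Rightarrow> 'a scalar) \<Rightarrow> 'u list \<Rightarrow> 'a scalar" where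
  "algebroid_d S \<rho> br \<omega> us = (if set us \<subseteq> S then
     (\<Sum>i<length us. (-1) ^ i * \<rho> (us ! i) (\<omega> (nths us (- {i})))) +
     (\<Sum>j<length us. \<Sum>i<j. (-1) ^ (i + j) * \<omega> (br (us ! i) (us ! j) # nths us (- {i, j})))
     else 0)"

text \<open>The Cartan differential is the differential of the tangent Lie algebroid.\<close>

definition ext_d :: "('a, 'e::euclidean_space) manifold \<Rightarrow> 'a form \<Rightarrow> 'a form" where
  "ext_d M = algebroid_d (vector_fields M) (\<lambda>X. X) lie_bracket"

definition lie_derivative :: "('a, 'e::euclidean_space) manifold \<Rightarrow> 'a vfield \<Rightarrow> 'a form \<Rightarrow> 'a form" where
  "lie_derivative M X \<omega> Xs = (if set Xs \<subseteq> vector_fields M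
     then X (\<omega> Xs) - (\<Sum>i<length Xs. \<omega> (Xs[i := lie_bracket X (Xs ! i)])) else 0)"

definition iprod :: "'a vfield \<Rightarrow> 'a form \<Rightarrow> 'a form" where
  "iprod X \<omega> Xs = \<omega> (X # Xs)"

text \<open>
  The sum over \<open>S\<close> is the sum over all shuffles: \<open>S\<close> is the set of positions whose entries go into
  \<open>\<omega>\<close>, and the exponent counts the inversions. Summands in which the lengths do not fit the degrees
  vanish. For 1-forms, \<open>(\<alpha> \<and> \<beta>)(X,Y) = \<alpha>(X)\<beta>(Y) - \<alpha>(Y)\<beta>(X)\<close>.
\<close>

definition wedge :: "'a form \<Rightarrow> 'a form \<Rightarrow> 'a form" where
  "wedge \<omega> \<eta> Xs = (\<Sum>S\<in>Pow {..<length Xs}.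
     (-1) ^ card {(i, j). i < j \<and> i \<in> {..<length Xs} - S \<and> j \<in> S} * \<omega> (nths Xs S) * \<eta> (nths Xs (- S)))"

section \<open>The operators of a (1,1) tensor field\<close>

definition i_tensor :: "('a, 'e::euclidean_space) manifold \<Rightarrow> ('a vfield \<Rightarrow> 'a vfield) \<Rightarrow> 'a form \<Rightarrow> 'a form" where
  "i_tensor M N \<omega> Xs = (if set Xs \<subseteq> vector_fields M
     then (\<Sum>i<length Xs. \<omega> (Xs[i := N (Xs ! i)])) else 0)"

definition d_tensor :: "('a, 'e::euclidean_space) manifold \<Rightarrow> ('a vfield \<Rightarrow> 'a vfield) \<Rightarrow> 'a form \<Rightarrow> 'a form" where
  "d_tensor M N \<omega> = i_tensor M N (ext_d M \<omega>) - ext_d M (i_tensor M N \<omega>)"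

definition transpose11 :: "('a, 'e::euclidean_space) manifold \<Rightarrow> ('a vfield \<Rightarrow> 'a vfield) \<Rightarrow> 'a form \<Rightarrow> 'a form" where
  "transpose11 M N \<alpha> Xs = (case Xs of [X] \<Rightarrow> if X \<in> vector_fields M then pairing \<alpha> (N X) else 0 | _ \<Rightarrow> 0)"

definition bracket_tensor :: "('a vfield \<Rightarrow> 'a vfield) \<Rightarrow> 'a vfield \<Rightarrow> 'a vfield \<Rightarrow> 'a vfield" where
  "bracket_tensor N X Y = lie_bracket (N X) Y + lie_bracket X (N Y) - N (lie_bracket X Y)"

definition torsion :: "('a vfield \<Rightarrow> 'a vfield) \<Rightarrow> 'a vfield \<Rightarrow> 'a vfield \<Rightarrow> 'a vfield" where
  "torsion N X Y = lie_bracket (N X) (N Y) - N (bracket_tensor N X Y)"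

section \<open>The operators of a bivector field\<close>

definition vector_field_of ::
    "('a, 'e::euclidean_space) manifold \<Rightarrow> ('a form \<Rightarrow> 'a scalar) \<Rightarrow> 'a vfield" where
  "vector_field_of M F = (THE X. X \<in> vector_fields M \<and> (\<forall>\<beta>\<in>forms M 1. pairing \<beta> X = F \<beta>))"

definition sharp :: "('a, 'e::euclidean_space) manifold \<Rightarrow> 'a bivector \<Rightarrow> 'a form \<Rightarrow> 'a vfield" where
  "sharp M \<pi> \<alpha> = vector_field_of M (\<lambda>\<beta>. \<pi> \<alpha> \<beta>)"

definition bracket1 ::
    "('a, 'e::euclidean_space) manifold \<Rightarrow> 'a bivector \<Rightarrow> 'a form \<Rightarrow> 'a form \<Rightarrow> 'a form" where
  "bracket1 M \<pi> \<alpha> \<beta> = lie_derivative M (sharp M \<pi> \<alpha>) \<beta> - lie_derivative M (sharp M \<pi> \<beta>) \<alpha>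
     - ext_d M (form0 (pairing \<beta> (sharp M \<pi> \<alpha>)))"

text \<open>A bivector field is Poisson if \<open>{f, g} = \<pi>(df, dg)\<close> satisfies the Jacobi identity.\<close>

definition poisson_bracket ::
    "('a, 'e::euclidean_space) manifold \<Rightarrow> 'a bivector \<Rightarrow> 'a scalar \<Rightarrow> 'a scalar \<Rightarrow> 'a scalar" where
  "poisson_bracket M \<pi> f g = \<pi> (ext_d M (form0 f)) (ext_d M (form0 g))"

definition poisson :: "('a, 'e::euclidean_space) manifold \<Rightarrow> 'a bivector \<Rightarrow> bool" where
  "poisson M \<pi> \<longleftrightarrow> \<pi> \<in> bivector_fields M \<and>
     (\<forall>f\<in>smooth_functions M. \<forall>g\<in>smooth_functions M. \<forall>h\<in>smooth_functions M.
        poisson_bracket M \<pi> f (poisson_bracket M \<pi> g h) + poisson_bracket M \<pi> g (poisson_bracket M \<pi> h f)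
        + poisson_bracket M \<pi> h (poisson_bracket M \<pi> f g) = 0)"

text \<open>
  \<open>B\<close> is the extension of \<open>[\<cdot>,\<cdot>]\<^sub>\<pi>\<close> to forms of all degrees. For Poisson \<open>\<pi>\<close> there is exactly one
  such bracket on forms. The exponents \<open>(q-1)(q'-1)\<close> and \<open>(q-1)q'\<close> are
  replaced by natural numbers of the same parity. The bracket of two functions has degree \<open>-1\<close>, so it is 0.
\<close>

definition extends_bracket ::
    "('a, 'e::euclidean_space) manifold \<Rightarrow> 'a bivector \<Rightarrow> ('a form \<Rightarrow> 'a form \<Rightarrow> 'a form) \<Rightarrow> bool" where
  "extends_bracket M \<pi> B \<longleftrightarrow>
     (\<forall>q q'. \<forall>\<eta>\<in>forms M q. \<forall>\<eta>'\<in>forms M q'.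
        (if q + q' = 0 then B \<eta> \<eta>' = 0 else B \<eta> \<eta>' \<in> forms M (q + q' - 1))) \<and>
     (\<forall>q q'. \<forall>\<eta>\<^sub>1\<in>forms M q. \<forall>\<eta>\<^sub>2\<in>forms M q. \<forall>\<eta>'\<in>forms M q'.
        B (\<eta>\<^sub>1 + \<eta>\<^sub>2) \<eta>' = B \<eta>\<^sub>1 \<eta>' + B \<eta>\<^sub>2 \<eta>' \<and> B \<eta>' (\<eta>\<^sub>1 + \<eta>\<^sub>2) = B \<eta>' \<eta>\<^sub>1 + B \<eta>' \<eta>\<^sub>2) \<and>
     (\<forall>q q' c. \<forall>\<eta>\<in>forms M q. \<forall>\<eta>'\<in>forms M q'.
        B (rsmul c \<eta>) \<eta>' = rsmul c (B \<eta> \<eta>') \<and> B \<eta> (rsmul c \<eta>') = rsmul c (B \<eta> \<eta>')) \<and>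
     (\<forall>q q'. \<forall>\<eta>\<in>forms M q. \<forall>\<eta>'\<in>forms M q'.
        B \<eta> \<eta>' = rsmul (- ((-1) ^ ((q + 1) * (q' + 1)))) (B \<eta>' \<eta>)) \<and>
     (\<forall>\<alpha>\<in>forms M 1. \<forall>\<beta>\<in>forms M 1. B \<alpha> \<beta> = bracket1 M \<pi> \<alpha> \<beta>) \<and>
     (\<forall>\<alpha>\<in>forms M 1. \<forall>f\<in>smooth_functions M.
        B \<alpha> (form0 f) = form0 (pairing (ext_d M (form0 f)) (sharp M \<pi> \<alpha>))) \<and>
     (\<forall>q q' q''. \<forall>\<eta>\<in>forms M q. \<forall>\<eta>'\<in>forms M q'. \<forall>\<eta>''\<in>forms M q''.
        B \<eta> (wedge \<eta>' \<eta>'') =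
          wedge (B \<eta> \<eta>') \<eta>'' + rsmul ((-1) ^ ((q + 1) * q')) (wedge \<eta>' (B \<eta> \<eta>'')))"

text \<open>
  The differential \<open>d\<^sub>\<pi>\<close> of the Lie algebroid \<open>(T\<^sup>*M)\<^sub>\<pi>\<close> on functions (a vector field), and on vector
  fields (evaluated on two 1-forms).
\<close>

definition d_pi0 :: "('a, 'e::euclidean_space) manifold \<Rightarrow> 'a bivector \<Rightarrow> 'a scalar \<Rightarrow> 'a vfield" where
  "d_pi0 M \<pi> f = vector_field_of M (\<lambda>\<alpha>. sharp M \<pi> \<alpha> f)"

definition d_pi1 :: "('a, 'e::euclidean_space) manifold \<Rightarrow> 'a bivector \<Rightarrow> 'a vfield \<Rightarrow> 'a bivector" where
  "d_pi1 M \<pi> Y \<alpha> \<beta> = sharp M \<pi> \<alpha> (pairing \<beta> Y) - sharp M \<pi> \<beta> (pairing \<alpha> Y) - pairing (bracket1 M \<pi> \<alpha> \<beta>) Y"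

section \<open>Poisson quasi-Nijenhuis manifolds\<close>

definition pqn_manifold ::
    "('a::{t2_space,second_countable_topology}, 'e::euclidean_space) manifold \<Rightarrow> 'a bivector \<Rightarrow>
     ('a vfield \<Rightarrow> 'a vfield) \<Rightarrow> 'a form \<Rightarrow> bool" where
  "pqn_manifold M \<pi> N \<phi> \<longleftrightarrow>
     smooth_manifold M \<and> poisson M \<pi> \<and> N \<in> tensor11 M \<and> \<phi> \<in> forms M 3 \<and>
     (\<forall>\<alpha>\<in>forms M 1. N (sharp M \<pi> \<alpha>) = sharp M \<pi> (transpose11 M N \<alpha>)) \<and>
     (let \<pi>\<^sub>N = (\<lambda>\<alpha> \<beta>. pairing \<beta> (N (sharp M \<pi> \<alpha>))) in
       \<forall>\<alpha>\<in>forms M 1. \<forall>\<beta>\<in>forms M 1.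
         bracket1 M \<pi>\<^sub>N \<alpha> \<beta> = bracket1 M \<pi> (transpose11 M N \<alpha>) \<beta> + bracket1 M \<pi> \<alpha> (transpose11 M N \<beta>)
           - transpose11 M N (bracket1 M \<pi> \<alpha> \<beta>)) \<and>
     ext_d M \<phi> = 0 \<and> ext_d M (i_tensor M N \<phi>) = 0 \<and>
     (\<forall>X\<in>vector_fields M. \<forall>Y\<in>vector_fields M.
        torsion N X Y = sharp M \<pi> (iprod Y (iprod X \<phi>)))"

section \<open>The Courant algebroid and its Lagrangian subbundles\<close>

text \<open>Sections \<open>X + \<alpha>\<close> of \<open>E = TM \<oplus> T\<^sup>*M\<close> are pairs \<open>(X, \<alpha>)\<close>.\<close>

type_synonym 'a esection = "'a vfield \<times> 'a form"

definition pairing_E :: "'a esection \<Rightarrow> 'a esection \<Rightarrow> 'a scalar" where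
  "pairing_E u v = (\<lambda>_. 1/2) * (pairing (snd v) (fst u) + pairing (snd u) (fst v))"

definition anchor_E ::
    "('a, 'e::euclidean_space) manifold \<Rightarrow> 'a bivector \<Rightarrow> ('a vfield \<Rightarrow> 'a vfield) \<Rightarrow> 'a esection \<Rightarrow> 'a vfield" where
  "anchor_E M \<pi> N u = N (fst u) + sharp M \<pi> (snd u)"

definition courant_mixed ::
    "('a, 'e::euclidean_space) manifold \<Rightarrow> 'a bivector \<Rightarrow> ('a vfield \<Rightarrow> 'a vfield) \<Rightarrow>
     'a form \<Rightarrow> 'a vfield \<Rightarrow> 'a esection" where
  "courant_mixed M \<pi> N \<alpha> Y =
     (vector_field_of M (d_pi1 M \<pi> Y \<alpha>) + rsmul (1/2) (d_pi0 M \<pi> (pairing \<alpha> Y)),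
      - (iprod Y (d_tensor M N \<alpha>) + rsmul (1/2) (d_tensor M N (form0 (pairing \<alpha> Y)))))"

definition courant ::
    "('a, 'e::euclidean_space) manifold \<Rightarrow> 'a bivector \<Rightarrow> ('a vfield \<Rightarrow> 'a vfield) \<Rightarrow> 'a form \<Rightarrow>
     'a esection \<Rightarrow> 'a esection \<Rightarrow> 'a esection" where
  "courant M \<pi> N \<phi> u v = (case (u, v) of ((X, \<alpha>), (Y, \<beta>)) \<Rightarrow>
     (bracket_tensor N X Y, iprod Y (iprod X \<phi>)) + (0, bracket1 M \<pi> \<alpha> \<beta>)
     + courant_mixed M \<pi> N \<alpha> Y - courant_mixed M \<pi> N \<beta> X)"

text \<open>Sections of the graph of a 2-form \<open>\<Omega>\<close>; \<open>\<Omega>\<^sup>\<flat> X\<close> is \<open>iprod X \<Omega>\<close>.\<close>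

definition graph_sections :: "('a, 'e::euclidean_space) manifold \<Rightarrow> 'a form \<Rightarrow> 'a esection set" where
  "graph_sections M \<Omega> = {(X, iprod X \<Omega>) | X. X \<in> vector_fields M}"

text \<open>
  Below, \<open>L\<close> is the set of sections of a Lagrangian subbundle of \<open>E\<close> transversal to \<open>T\<^sup>*M\<close>:
  the identification \<open>X \<mapsto> X~\<close> of \<open>TM\<close> with \<open>L\<close>, the transport of forms to \<open>L\<close>, and the
  \<open>L\<close>-component with respect to \<open>E = L \<oplus> T\<^sup>*M\<close>.
\<close>

definition lift_L :: "('a, 'e::euclidean_space) manifold \<Rightarrow> 'a esection set \<Rightarrow> 'a vfield \<Rightarrow> 'a esection" where
  "lift_L M L X = (THE u. u \<in> L \<and> (\<forall>\<alpha>\<in>forms M 1. pairing \<alpha> X = (\<lambda>_. 2) * pairing_E u (0, \<alpha>)))"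

definition form_on ::
    "('a, 'e::euclidean_space) manifold \<Rightarrow> 'a esection set \<Rightarrow> 'a form \<Rightarrow> 'a esection list \<Rightarrow> 'a scalar" where
  "form_on M L \<psi> us = \<psi> (map (inv_into (vector_fields M) (lift_L M L)) us)"

definition component_L :: "('a, 'e::euclidean_space) manifold \<Rightarrow> 'a esection set \<Rightarrow> 'a esection \<Rightarrow> 'a esection" where
  "component_L M L u = (THE v. v \<in> L \<and> (\<exists>\<alpha>\<in>forms M 1. u = v + (0, \<alpha>)))"

definition d_L ::
    "('a, 'e::euclidean_space) manifold \<Rightarrow> 'a bivector \<Rightarrow> ('a vfield \<Rightarrow> 'a vfield) \<Rightarrow> 'a form \<Rightarrow>
     'a esection set \<Rightarrow> 'a form \<Rightarrow> 'a form" where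
  "d_L M \<pi> N \<phi> L \<psi> Xs = (if set Xs \<subseteq> vector_fields M then
     algebroid_d L (anchor_E M \<pi> N) (\<lambda>u v. component_L M L (courant M \<pi> N \<phi> u v))
       (form_on M L \<psi>) (map (lift_L M L) Xs) else 0)"

definition phi_L ::
    "('a, 'e::euclidean_space) manifold \<Rightarrow> 'a bivector \<Rightarrow> ('a vfield \<Rightarrow> 'a vfield) \<Rightarrow> 'a form \<Rightarrow>
     'a esection set \<Rightarrow> 'a form" where
  "phi_L M \<pi> N \<phi> L Xs = (if length Xs = 3 \<and> set Xs \<subseteq> vector_fields M then
     (\<lambda>_. 2) * pairing_E (courant M \<pi> N \<phi> (lift_L M L (Xs ! 0)) (lift_L M L (Xs ! 1))) (lift_L M L (Xs ! 2)) else 0)"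

end

theory Submission
  imports Defs
begin

text \<open>
  Write \<open>P = \<pi>\<^sup>\<sharp> \<Omega>\<^sup>\<flat>\<close>. The operator \<open>d\<^sub>N\<close> is the Lie algebroid differential with anchor \<open>N\<close> and bracket
  \<open>[X,Y]\<^sub>N\<close>, in every degree. For closed \<open>\<Omega>\<close>, Cartan
  calculus turns the vector field part of the Courant bracket of \<open>X + \<Omega>\<^sup>\<flat>X\<close> and \<open>Y + \<Omega>\<^sup>\<flat>Y\<close> into
  \<open>[X,Y]\<^sub>N + [X,Y]\<^sub>P\<close>, hence \<open>d\<^sub>L = d\<^bsub>N+P\<^esub>\<close>. The form part gives \<open>\<phi> + d\<^sub>N \<Omega> + (1/2) d\<^sub>P \<Omega>\<close> for \<open>\<phi>\<^sub>L\<close>, so that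
  it remains to see that \<open>[\<Omega>,\<eta>]\<^sub>\<pi> = d\<^sub>P \<eta>\<close> for 2-forms \<open>\<eta>\<close>. Both sides are derivations in \<open>\<eta>\<close>, and they
  are compared on functions and exact 1-forms; this uses that the bracket with \<open>f\<close> is contraction
  with \<open>\<pi>\<^sup>\<sharp> df\<close>, and the bracket with \<open>dh\<close> is the Lie derivative along \<open>\<pi>\<^sup>\<sharp> dh\<close>.

  Since vector fields are derivations, everything local rests on the existence of local frames,
  that is, on Hadamard's lemma.
\<close>

section \<open>Functions of class \<open>C\<^sup>k\<close> on open subsets of a linear subspace\<close>

text \<open>Two obstacles shape the development. Everything is global: a vector field acts on
  globally smooth functions only, and the bracket \<open>B\<close> is known only through its axioms
  on global forms. Hence frames consist of fields cut off by bump functions, and a statement at a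
  point is reached by multiplying with a function that is 1 there with vanishing first derivatives;
  this is harmless because the operators to be compared are of first order. Moreover,
  \<open>sharp\<close> and the vector field part of \<open>courant_mixed\<close> are definite
  descriptions. They denote something because every function-linear functional on 1-forms is
  evaluation at a vector field, and this is the first use of local frames. The factor 1/2 of
  [\<Omega>,\<Omega>] has the following origin. Since \<pi> and \<Omega> are skew, so is \<Omega>(P
  X, Y). Evaluating d\<Omega> = 0 with P applied to each of the three arguments in turn shows that
  d_P \<Omega> is twice the term which the Courant bracket contributes besides \<phi> + d_N
  \<Omega>.\<close>

definition dir_deriv :: "('e::euclidean_space \<Rightarrow> 'b::real_normed_vector) \<Rightarrow> 'e \<Rightarrow> 'e \<Rightarrow> 'b" where
  "dir_deriv f v z = vector_derivative (\<lambda>t. f (z + t *\<^sub>R v)) (at 0)"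

abbreviation relopen :: "'e::euclidean_space set \<Rightarrow> 'e set \<Rightarrow> bool" where
  "relopen V W \<equiv> subspace V \<and> openin (top_of_set V) W"

lemma relopen_subset: "relopen V W \<Longrightarrow> W \<subseteq> V"
  using openin_imp_subset by blast

text \<open>\<open>W\<close> is relatively open in \<open>V\<close>, so a short segment through
  \<open>z\<close> in a direction of \<open>V\<close> stays in \<open>W\<close>, and the derivative
  within \<open>W\<close> restricts to a two-sided derivative in \<open>t\<close>.\<close>

lemma has_vector_derivative_along:
  fixes f :: "'e::euclidean_space \<Rightarrow> 'b::real_normed_vector"
  assumes W: "relopen V W" and z: "z \<in> W" and v: "v \<in> V"
    and f: "(f has_derivative D) (at z within W)"
  shows "((\<lambda>t. f (z + t *\<^sub>R v)) has_vector_derivative D v) (at 0)"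
proof -
  obtain e where e: "e > 0" "ball z e \<inter> V \<subseteq> W"
    using W z by (meson openin_contains_ball)
  have zV: "z \<in> V" using relopen_subset[OF W] z by auto
  \<comment> \<open>The summand 1 keeps the denominator positive when \<open>v = 0\<close>.\<close>
  define d where "d = e / (norm v + 1)"
  have d: "d > 0" using e by (simp add: d_def add_nonneg_pos)
  have sub: "(\<lambda>t. z + t *\<^sub>R v) ` ball 0 d \<subseteq> W"
  proof clarify
    fix t :: real assume "t \<in> ball 0 d"
    then have t: "\<bar>t\<bar> < d" by simp
    have "\<bar>t\<bar> * norm v \<le> \<bar>t\<bar> * (norm v + 1)" by (intro mult_left_mono) auto
    also have "\<dots> < d * (norm v + 1)" by (intro mult_strict_right_mono t) (auto simp: add_nonneg_pos)
    also have "\<dots> = e" unfolding d_def using norm_ge_zero[of v] by (simp add: add_nonneg_pos less_imp_neq[symmetric])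
    finally have "z + t *\<^sub>R v \<in> ball z e" by (simp add: dist_norm)
    moreover have "z + t *\<^sub>R v \<in> V" using W zV v by (auto intro: subspace_add subspace_scale)
    ultimately show "z + t *\<^sub>R v \<in> W" using e by auto
  qed
  have 1: "((\<lambda>t. z + t *\<^sub>R v) has_derivative (\<lambda>t. t *\<^sub>R v)) (at 0 within ball 0 d)"
    by (auto intro!: derivative_eq_intros)
  have 2: "(f has_derivative D) (at (z + 0 *\<^sub>R v) within ((\<lambda>t. z + t *\<^sub>R v) ` ball 0 d))"
    using has_derivative_subset[OF f sub] by simp
  have "((\<lambda>t. f (z + t *\<^sub>R v)) has_derivative (\<lambda>t. D (t *\<^sub>R v))) (at 0 within ball 0 d)"
    using has_derivative_in_compose[OF 1 2] .
  moreover have "at 0 within ball 0 d = at (0::real)" using d by (intro at_within_open) auto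
  moreover have "linear D" using f has_derivative_linear by blast
  ultimately show ?thesis
    unfolding has_vector_derivative_def by (simp add: linear_scale)
qed

lemma dir_deriv_eq:
  assumes "relopen V W" "z \<in> W" "v \<in> V" "(f has_derivative D) (at z within W)"
  shows "dir_deriv f v z = D v"
  unfolding dir_deriv_def using has_vector_derivative_along[OF assms] by (rule vector_derivative_at)

lemma Ck_cong:
  assumes "Ck k V W f" and "\<And>z. z \<in> W \<Longrightarrow> f z = g z"
  shows "Ck k V W g"
proof (cases k)
  case 0
  then show ?thesis using assms by (simp cong: continuous_on_cong)
next
  case (Suc n)
  then obtain f' where f': "\<forall>x\<in>W. (f has_derivative f' x) (at x within W)"
    "\<forall>v\<in>V. Ck n V W (\<lambda>x. f' x v)" using assms(1) by auto
  have "\<forall>x\<in>W. (g has_derivative f' x) (at x within W)"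
    using f'(1) has_derivative_transform[where f = f and g = g and s = W] assms(2) by simp
  then show ?thesis using Suc f' by auto
qed

text \<open>The derivative is unique at points of \<open>W\<close> in directions of
  \<open>V\<close>, so the existential quantifier over \<open>f'\<close> in \<open>Ck\<close> can be
  traded for the explicit function \<open>dir_deriv\<close>.\<close>

lemma Ck_Suc_iff:
  assumes W: "relopen V W"
  shows "Ck (Suc k) V W f \<longleftrightarrow>
    (\<forall>z\<in>W. f differentiable at z within W) \<and> (\<forall>v\<in>V. Ck k V W (dir_deriv f v))" (is "?l = ?r")
proof
  assume ?l
  then obtain f' where f': "\<forall>x\<in>W. (f has_derivative f' x) (at x within W)"
    "\<forall>v\<in>V. Ck k V W (\<lambda>x. f' x v)" by auto
  have "Ck k V W (dir_deriv f v)" if "v \<in> V" for v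
  proof (rule Ck_cong)
    show "Ck k V W (\<lambda>x. f' x v)" using f'(2) that by blast
    show "f' z v = dir_deriv f v z" if "z \<in> W" for z
      by (rule dir_deriv_eq[OF W that \<open>v \<in> V\<close>, symmetric]) (use f'(1) that in blast)
  qed
  with f'(1) show ?r unfolding differentiable_def by blast
next
  assume r: ?r
  then obtain f' where f': "\<forall>x\<in>W. (f has_derivative f' x) (at x within W)"
    unfolding differentiable_def by metis
  have "Ck k V W (\<lambda>x. f' x v)" if "v \<in> V" for v
  proof (rule Ck_cong)
    show "Ck k V W (dir_deriv f v)" using r that by blast
    show "dir_deriv f v z = f' z v" if "z \<in> W" for z
      by (rule dir_deriv_eq[OF W that \<open>v \<in> V\<close>]) (use f' that in blast)
  qed
  with f' show ?l unfolding Ck.simps by blast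
qed

lemma Ck_subset: "Ck k V W f \<Longrightarrow> W' \<subseteq> W \<Longrightarrow> Ck k V W' f"
proof (induction k arbitrary: f)
  case 0 then show ?case by (auto intro: continuous_on_subset)
next
  case (Suc k)
  then obtain f' where f': "\<forall>x\<in>W. (f has_derivative f' x) (at x within W)"
    "\<forall>v\<in>V. Ck k V W (\<lambda>x. f' x v)" by auto
  then have "\<forall>x\<in>W'. (f has_derivative f' x) (at x within W')"
    using Suc.prems by (meson has_derivative_subset subsetD)
  then show ?case using f' Suc by auto
qed

lemma Ck_continuous_on: "Ck k V W f \<Longrightarrow> continuous_on W f"
proof (cases k)
  case (Suc n)
  then show "Ck k V W f \<Longrightarrow> continuous_on W f"
    by (auto intro!: continuous_on_eq_continuous_within[THEN iffD2] dest: has_derivative_continuous)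
qed simp

lemma Ck_Suc_D: "Ck (Suc k) V W f \<Longrightarrow> Ck k V W f"
proof (induction k arbitrary: f)
  case 0 then show ?case using Ck_continuous_on[OF 0] by simp
next
  case (Suc k)
  then obtain f' where f': "\<forall>x\<in>W. (f has_derivative f' x) (at x within W)"
    "\<forall>v\<in>V. Ck (Suc k) V W (\<lambda>x. f' x v)" unfolding Ck.simps(2)[of "Suc k"] by blast
  then have "\<forall>v\<in>V. Ck k V W (\<lambda>x. f' x v)" using Suc.IH by blast
  with f'(1) show ?case unfolding Ck.simps(2)[of k] by blast
qed

lemma at_within_Int_open_left:
  assumes "open A" "z \<in> A" shows "at z within W \<inter> A = at z within W"
  by (rule at_within_nhd[OF assms(2,1)]) auto

text \<open>The choice-free form of the derivative matters here: derivatives taken from different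
  neighbourhoods need not be glued, as all of them are \<open>dir_deriv f v\<close>.\<close>

lemma Ck_local:
  assumes W: "relopen V W"
    and loc: "\<And>z. z \<in> W \<Longrightarrow> \<exists>A. open A \<and> z \<in> A \<and> Ck k V (W \<inter> A) f"
  shows "Ck k V W f"
  using loc
proof (induction k arbitrary: f)
  case 0
  show ?case unfolding Ck.simps
  proof (subst continuous_on_eq_continuous_within, rule ballI)
    fix z assume z: "z \<in> W"
    then obtain A where A: "open A" "z \<in> A" "continuous_on (W \<inter> A) f"
      using 0[OF z] unfolding Ck.simps by blast
    then have "continuous (at z within W \<inter> A) f" using z by (simp add: continuous_on_eq_continuous_within)
    then show "continuous (at z within W) f"
      unfolding at_within_Int_open_left[OF A(1,2)] .
  qed
next
  case (Suc k)
  have "f differentiable at z within W \<and> (\<exists>A. open A \<and> z \<in> A \<and> (\<forall>v\<in>V. Ck k V (W \<inter> A) (dir_deriv f v)))"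
    if z: "z \<in> W" for z
  proof -
    obtain A where A: "open A" "z \<in> A" "Ck (Suc k) V (W \<inter> A) f" using Suc.prems[OF z] by blast
    have WA: "relopen V (W \<inter> A)" using W A(1) by (auto simp: openin_open)
    have "f differentiable at z within W \<inter> A"
      using A(2,3) z Ck_Suc_iff[OF WA] by blast
    then have 1: "f differentiable at z within W"
      unfolding at_within_Int_open_left[OF A(1,2)] .
    have "\<forall>v\<in>V. Ck k V (W \<inter> A) (dir_deriv f v)"
      using A(3) Ck_Suc_iff[OF WA] by blast
    then show ?thesis using 1 A(1,2) by blast
  qed
  note * = this
  have "Ck k V W (dir_deriv f v)" if v: "v \<in> V" for v
  proof (rule Suc.IH)
    fix z assume "z \<in> W"
    then show "\<exists>A. open A \<and> z \<in> A \<and> Ck k V (W \<inter> A) (dir_deriv f v)"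
      using *[of z] v by blast
  qed
  then show ?case unfolding Ck_Suc_iff[OF W] using * by blast
qed

lemma Ck_const: "Ck k V W (\<lambda>z. c)"
proof (induction k arbitrary: c)
  case (Suc k)
  show ?case unfolding Ck.simps by (rule exI[of _ "\<lambda>_ _. 0"]) (use Suc in auto)
qed simp

lemma Ck_add:
  assumes W: "relopen V W" and "Ck k V W f" "Ck k V W g"
  shows "Ck k V W (\<lambda>z. f z + g z)"
  using assms(2,3)
proof (induction k arbitrary: f g)
  case 0 then show ?case unfolding Ck.simps by (intro continuous_on_add)
next
  case (Suc k)
  obtain f' where f': "\<forall>x\<in>W. (f has_derivative f' x) (at x within W)"
    "\<forall>v\<in>V. Ck k V W (\<lambda>x. f' x v)" using Suc.prems(1) unfolding Ck.simps by blast
  obtain g' where g': "\<forall>x\<in>W. (g has_derivative g' x) (at x within W)"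
    "\<forall>v\<in>V. Ck k V W (\<lambda>x. g' x v)" using Suc.prems(2) unfolding Ck.simps by blast
  show ?case unfolding Ck.simps
    by (rule exI[of _ "\<lambda>x v. f' x v + g' x v"])
       (use f' g' Suc.IH has_derivative_add in blast)
qed

lemma Ck_sum:
  assumes W: "relopen V W" and "\<And>i. i \<in> I \<Longrightarrow> Ck k V W (f i)"
  shows "Ck k V W (\<lambda>z. \<Sum>i\<in>I. f i z)"
  using assms(2)
proof (induction I rule: infinite_finite_induct)
  case (insert i I)
  then have "Ck k V W (\<lambda>z. f i z + (\<Sum>i\<in>I. f i z))" by (intro Ck_add[OF W]) auto
  then show ?case using insert by simp
qed (simp_all add: Ck_const)

lemma Ck_mult:
  fixes f g :: "'e::euclidean_space \<Rightarrow> real"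
  assumes W: "relopen V W" and "Ck k V W f" "Ck k V W g"
  shows "Ck k V W (\<lambda>z. f z * g z)"
  using assms(2,3)
proof (induction k arbitrary: f g)
  case 0 then show ?case unfolding Ck.simps by (intro continuous_on_mult)
next
  case (Suc k)
  obtain f' where f': "\<forall>x\<in>W. (f has_derivative f' x) (at x within W)"
    "\<forall>v\<in>V. Ck k V W (\<lambda>x. f' x v)" using Suc.prems(1) unfolding Ck.simps by blast
  obtain g' where g': "\<forall>x\<in>W. (g has_derivative g' x) (at x within W)"
    "\<forall>v\<in>V. Ck k V W (\<lambda>x. g' x v)" using Suc.prems(2) unfolding Ck.simps by blast
  have fg: "Ck k V W f" "Ck k V W g" using Suc.prems Ck_Suc_D by blast+
  have "\<forall>x\<in>W. ((\<lambda>z. f z * g z) has_derivative (\<lambda>v. f x * g' x v + f' x v * g x)) (at x within W)"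
    using f'(1) g'(1) has_derivative_mult by blast
  moreover have "\<forall>v\<in>V. Ck k V W (\<lambda>x. f x * g' x v + f' x v * g x)"
    using Suc.IH fg f'(2) g'(2) Ck_add[OF W] by blast
  ultimately show ?case unfolding Ck.simps
    by (intro exI[of _ "\<lambda>x v. f x * g' x v + f' x v * g x"]) blast
qed

lemma Ck_bounded_linear:
  assumes "bounded_linear h" and "Ck k V W f"
  shows "Ck k V W (\<lambda>z. h (f z))"
  using assms(2)
proof (induction k arbitrary: f)
  case 0 then show ?case unfolding Ck.simps
    using bounded_linear.continuous_on[OF assms(1)] by blast
next
  case (Suc k)
  obtain f' where f': "\<forall>x\<in>W. (f has_derivative f' x) (at x within W)"
    "\<forall>v\<in>V. Ck k V W (\<lambda>x. f' x v)" using Suc.prems(1) unfolding Ck.simps by blast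
  show ?case unfolding Ck.simps
    by (rule exI[of _ "\<lambda>x v. h (f' x v)"])
       (use f' Suc.IH bounded_linear.has_derivative[OF assms(1)] in blast)
qed

lemma Ck_id: "Ck k V W (\<lambda>z. z)"
proof (cases k)
  case (Suc n)
  show ?thesis unfolding Suc Ck.simps
    by (rule exI[of _ "\<lambda>x v. v"]) (auto simp: Ck_const)
qed (auto intro: continuous_on_id)

text \<open>\<open>E\<close> is an orthonormal basis of \<open>V\<close> and replaces
  \<open>Basis\<close> of the ambient type; it is empty for the zero subspace.\<close>

lemma subspace_orthonormal_expansion:
  fixes V :: "'e::euclidean_space set"
  assumes "subspace V"
  obtains E where "finite E" "E \<subseteq> V" "\<And>v. v \<in> V \<Longrightarrow> v = (\<Sum>b\<in>E. (v \<bullet> b) *\<^sub>R b)"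
proof -
  obtain E where E: "E \<subseteq> V" "pairwise orthogonal E" "\<And>x. x \<in> E \<Longrightarrow> norm x = 1"
    "independent E" "span E = V"
    using orthonormal_basis_subspace[OF assms] by metis
  have fin: "finite E" using E(4) independent_imp_finite by blast
  have "v = (\<Sum>b\<in>E. (v \<bullet> b) *\<^sub>R b)" if "v \<in> V" for v
  proof -
    have orth: "b \<bullet> c = (if b = c then 1 else 0)" if "b \<in> E" "c \<in> E" for b c
      using E(2,3) that by (auto simp: pairwise_def orthogonal_def norm_eq_1)
    obtain u where u: "v = (\<Sum>b\<in>E. u b *\<^sub>R b)"
      using \<open>v \<in> V\<close> E(5) span_finite[OF fin] by auto
    have "v \<bullet> c = u c" if c: "c \<in> E" for c
    proof -
      have "v \<bullet> c = (\<Sum>b\<in>E. if b = c then u b else 0)"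
        unfolding u inner_sum_left by (rule sum.cong) (simp_all add: orth c)
      also have "\<dots> = u c" using fin c by simp
      finally show ?thesis .
    qed
    then show ?thesis using u by simp
  qed
  then show ?thesis using that fin E(1) by blast
qed

text \<open>The chain rule yields \<open>f' (g x) (g' x v)\<close>, where the direction varies with
  \<open>x\<close>. Expanding \<open>g' x v\<close> in a basis of \<open>V'\<close> separates
  direction and base point, and the induction hypothesis applies for each fixed basis
  direction.\<close>

lemma Ck_compose:
  fixes f :: "'f::euclidean_space \<Rightarrow> real" and g :: "'e::euclidean_space \<Rightarrow> 'f"
  assumes W: "relopen V W" and W': "relopen V' W'" and gW: "g ` W \<subseteq> W'"
    and "Ck k V W g" "Ck k V' W' f"
  shows "Ck k V W (\<lambda>z. f (g z))"
  using assms(4,5)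
proof (induction k arbitrary: f)
  case 0 then show ?case unfolding Ck.simps using gW continuous_on_compose2 by blast
next
  case (Suc k)
  obtain E where E: "finite E" "E \<subseteq> V'" "\<And>v. v \<in> V' \<Longrightarrow> v = (\<Sum>b\<in>E. (v \<bullet> b) *\<^sub>R b)"
    using subspace_orthonormal_expansion W' by blast
  obtain g' where g': "\<forall>x\<in>W. (g has_derivative g' x) (at x within W)"
    "\<forall>v\<in>V. Ck k V W (\<lambda>x. g' x v)" using Suc.prems(1) unfolding Ck.simps by blast
  obtain f' where f': "\<forall>x\<in>W'. (f has_derivative f' x) (at x within W')"
    "\<forall>v\<in>V'. Ck k V' W' (\<lambda>x. f' x v)" using Suc.prems(2) unfolding Ck.simps by blast
  have g: "Ck k V W g" using Suc.prems(1) Ck_Suc_D by blast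
  \<comment> \<open>Here \<open>h\<close> subtracts the orthogonal projection to \<open>V'\<close>.
    It is linear and kills \<open>V'\<close>, hence \<open>h (g z)\<close> vanishes on
    \<open>W\<close> and so does its derivative \<open>h (g' z v)\<close>.\<close>
  have g'V: "g' z v \<in> V'" if z: "z \<in> W" and v: "v \<in> V" for z v
  proof -
    define h where "h = (\<lambda>v. v - (\<Sum>b\<in>E. (v \<bullet> b) *\<^sub>R b))"
    have h: "bounded_linear h" unfolding h_def
      by (intro bounded_linear_sub bounded_linear_ident bounded_linear_sum bounded_linear_scaleR_left
            bounded_linear_compose[OF bounded_linear_scaleR_left] bounded_linear_inner_left)
    have "((\<lambda>z. h (g z)) has_derivative (\<lambda>v. h (g' z v))) (at z within W)"
      using bounded_linear.has_derivative[OF h] g'(1) z by blast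
    moreover have "((\<lambda>z. h (g z)) has_derivative (\<lambda>v. 0)) (at z within W)"
    proof (rule has_derivative_transform[OF z])
      fix y assume "y \<in> W"
      then have "g y \<in> V'" using gW relopen_subset[OF W'] by blast
      then show "h (g y) = 0" unfolding h_def using E(3) by simp
    qed simp
    ultimately have "h (g' z v) = 0" using dir_deriv_eq[OF W z v] by metis
    then have "g' z v = (\<Sum>b\<in>E. (g' z v \<bullet> b) *\<^sub>R b)" unfolding h_def by simp
    moreover have "(\<Sum>b\<in>E. (g' z v \<bullet> b) *\<^sub>R b) \<in> V'"
      using E(2) W' by (intro subspace_sum subspace_scale) auto
    ultimately show ?thesis by simp
  qed
  have "\<forall>x\<in>W. ((\<lambda>z. f (g z)) has_derivative (\<lambda>v. f' (g x) (g' x v))) (at x within W)"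
    using has_derivative_in_compose2[of W' f f' g W] gW g'(1) f'(1) by blast
  moreover have "Ck k V W (\<lambda>x. f' (g x) (g' x v))" if v: "v \<in> V" for v
  proof (rule Ck_cong)
    show "Ck k V W (\<lambda>x. \<Sum>b\<in>E. (g' x v \<bullet> b) * f' (g x) b)"
    proof (intro Ck_sum[OF W] Ck_mult[OF W])
      fix b assume b: "b \<in> E"
      show "Ck k V W (\<lambda>x. g' x v \<bullet> b)"
        using Ck_bounded_linear[OF bounded_linear_inner_left] g'(2) v by blast
      show "Ck k V W (\<lambda>x. f' (g x) b)"
        using Suc.IH[OF g, of "\<lambda>y. f' y b"] f'(2) b E(2) by blast
    qed
    fix x assume x: "x \<in> W"
    have "linear (f' (g x))" using f'(1) gW x has_derivative_linear by blast
    then have "f' (g x) (\<Sum>b\<in>E. (g' x v \<bullet> b) *\<^sub>R b) = (\<Sum>b\<in>E. (g' x v \<bullet> b) * f' (g x) b)"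
      by (simp add: linear_sum linear_scale)
    then show "(\<Sum>b\<in>E. (g' x v \<bullet> b) * f' (g x) b) = f' (g x) (g' x v)"
      using E(3)[OF g'V[OF x v]] by simp
  qed
  ultimately show ?case unfolding Ck.simps
    by (intro exI[of _ "\<lambda>x v. f' (g x) (g' x v)"]) blast
qed

section \<open>Bump functions\<close>

definition bump_fun :: "nat \<Rightarrow> real \<Rightarrow> real" where
  "bump_fun m t = (if t > 0 then exp (- (1 / t)) / t ^ m else 0)"

text \<open>Differentiation stays within the span of the family indexed by \<open>m\<close>, so
  smoothness is an induction over the order for all \<open>m\<close> at once. Only
  \<open>m = 0\<close> serves as a bump function.\<close>

lemma bump_fun_deriv:
  "(bump_fun m has_real_derivative (bump_fun (m + 2) t - real m * bump_fun (m + 1) t)) (at t)"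
proof -
  consider "t > 0" | "t < 0" | "t = 0" by linarith
  then show ?thesis
  proof cases
    case 1
    \<comment> \<open>The derivative of a power carries the truncated exponent
      \<open>n - Suc 0\<close>; this settles the case \<open>n = 0\<close>.\<close>
    have P: "n = 0" if "t ^ n \<noteq> t * t ^ (n - Suc 0)" for n
      using that by (cases n) auto
    have "((\<lambda>t. exp (- (1 / t)) / t ^ m) has_real_derivative
        (bump_fun (m + 2) t - real m * bump_fun (m + 1) t)) (at t)"
      unfolding bump_fun_def using 1
      by (cases m) (auto intro!: derivative_eq_intros dest: P simp: field_simps power2_eq_square)
    then show ?thesis
      by (rule has_field_derivative_transform_within_open[where S = "{0<..}"])
         (use 1 in \<open>auto simp: bump_fun_def\<close>)
  next
    case 2
    have "((\<lambda>t. 0) has_real_derivative (bump_fun (m + 2) t - real m * bump_fun (m + 1) t)) (at t)"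
      using 2 by (simp add: bump_fun_def)
    then show ?thesis
      by (rule has_field_derivative_transform_within_open[where S = "{..<0}"])
         (use 2 in \<open>auto simp: bump_fun_def\<close>)
  next
    case 3
    \<comment> \<open>For h > 0 the difference quotient at 0 is exp(-1/h) / h^(m+1); with y = 1/h it
      becomes y^(m+1) / exp y, which tends to 0.\<close>
    have "((\<lambda>x::real. inverse x ^ (m + 1) / exp (inverse x)) \<longlongrightarrow> 0) (at_right 0)"
      by (rule filterlim_compose[OF tendsto_power_div_exp_0 filterlim_inverse_at_top_right])
    then have R: "((\<lambda>h. bump_fun m h / h) \<longlongrightarrow> 0) (at_right 0)"
    proof (rule Lim_transform_eventually)
      show "\<forall>\<^sub>F x in at_right 0. inverse x ^ (m + 1) / exp (inverse x) = bump_fun m x / x"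
        using eventually_at_right_less[of 0]
        by eventually_elim (simp add: bump_fun_def exp_minus field_simps)
    qed
    have L: "((\<lambda>h. bump_fun m h / h) \<longlongrightarrow> 0) (at_left 0)"
    proof (rule Lim_transform_eventually[OF tendsto_const])
      show "\<forall>\<^sub>F x in at_left 0. 0 = bump_fun m x / x"
        by (simp add: eventually_at_filter bump_fun_def)
    qed
    have z: "bump_fun k 0 = 0" for k by (simp add: bump_fun_def)
    have "((\<lambda>h. bump_fun m h / h) \<longlongrightarrow> 0) (at 0)" using R L by (simp add: filterlim_split_at)
    then show ?thesis unfolding DERIV_def 3 by (simp add: z)
  qed
qed

lemma Ck_bump_fun: "Ck k UNIV UNIV (bump_fun m)"
proof (induction k arbitrary: m)
  case 0
  show ?case unfolding Ck.simps
    by (intro continuous_at_imp_continuous_on ballI DERIV_isCont[OF bump_fun_deriv])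
next
  case (Suc k)
  define d where "d t = bump_fun (m + 2) t - real m * bump_fun (m + 1) t" for t
  have U: "relopen UNIV (UNIV :: real set)" by auto
  have "Ck k UNIV UNIV (\<lambda>t. bump_fun (m + 2) t + (- real m) * bump_fun (m + 1) t)"
    by (intro Ck_add[OF U] Ck_mult[OF U] Ck_const Suc.IH)
  then have "Ck k UNIV UNIV d" unfolding d_def by (rule Ck_cong) simp
  then have "\<forall>v\<in>UNIV. Ck k UNIV UNIV (\<lambda>t. d t * v)" by (auto intro: Ck_mult[OF U] Ck_const)
  moreover have "\<forall>t\<in>UNIV. (bump_fun m has_derivative (\<lambda>v. d t * v)) (at t within UNIV)"
    using bump_fun_deriv unfolding d_def has_field_derivative_def by auto
  ultimately show ?case unfolding Ck.simps by (intro exI[of _ "\<lambda>t v. d t * v"]) blast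
qed

lemma ex_bump:
  fixes c :: "'e::euclidean_space"
  assumes W: "relopen V W" and r: "r > 0"
  obtains h :: "'e \<Rightarrow> real" where "smooth_on V W h" "h c \<noteq> 0" "\<forall>z. z \<notin> cball c r \<longrightarrow> h z = 0"
proof
  \<comment> \<open>This is r^2 - |z - c|^2, spelled out in coordinates so that the closure rules
    for \<open>Ck\<close> apply; it is positive exactly in the open ball.\<close>
  let ?q = "\<lambda>z. r\<^sup>2 + (\<Sum>b\<in>Basis. (- 1) * ((z \<bullet> b + (- (c \<bullet> b))) * (z \<bullet> b + (- (c \<bullet> b)))))"
  have q: "?q z = r\<^sup>2 - (norm (z - c))\<^sup>2" for z
  proof -
    have "(norm (z - c))\<^sup>2 = (\<Sum>b\<in>Basis. ((z - c) \<bullet> b) * ((z - c) \<bullet> b))"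
      unfolding power2_norm_eq_inner by (rule euclidean_inner)
    then show ?thesis by (simp add: sum_negf inner_diff_left)
  qed
  have U: "relopen UNIV (UNIV :: real set)" by auto
  have "Ck k V W (\<lambda>z. bump_fun 0 (?q z))" for k
  proof (rule Ck_compose[OF W U _ _ Ck_bump_fun])
    have "Ck k V W (\<lambda>z. z \<bullet> b + (- (c \<bullet> b)))" for b
      by (rule Ck_add[OF W Ck_bounded_linear[OF bounded_linear_inner_left Ck_id] Ck_const])
    then show "Ck k V W ?q"
      by (intro Ck_add[OF W Ck_const] Ck_sum[OF W] Ck_mult[OF W Ck_const] Ck_mult[OF W])
  qed auto
  then show "smooth_on V W (\<lambda>z. bump_fun 0 (?q z))" unfolding smooth_on_def by blast
  show "bump_fun 0 (?q c) \<noteq> 0" using r unfolding q by (simp add: bump_fun_def)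
  show "\<forall>z. z \<notin> cball c r \<longrightarrow> bump_fun 0 (?q z) = 0"
  proof (intro allI impI)
    fix z assume "z \<notin> cball c r"
    then have "r \<le> norm (z - c)" by (simp add: dist_norm norm_minus_commute)
    then have "r\<^sup>2 \<le> (norm (z - c))\<^sup>2" using r by (intro power_mono) auto
    then show "bump_fun 0 (?q z) = 0" unfolding q by (simp add: bump_fun_def)
  qed
qed

section \<open>Hadamard's lemma on convex relatively open sets\<close>

lemma has_derivative_within_subspace_cong:
  assumes f: "(f has_derivative D) (at z within W)" and W: "subspace V" "z \<in> W" "W \<subseteq> V"
    and D': "bounded_linear D'" "\<And>v. v \<in> V \<Longrightarrow> D' v = D v"
  shows "(f has_derivative D') (at z within W)"
proof -
  have "y - z \<in> V" if "y \<in> W" for y using that W subspace_diff by blast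
  then have "((\<lambda>y. norm (f y - f z - D' (y - z)) / norm (y - z)) \<longlongrightarrow> 0) (at z within W)"
    using f[unfolded has_derivative_iff_norm] D'(2)
    by (auto elim!: Lim_transform_eventually simp: eventually_at_filter)
  then show ?thesis using D'(1) unfolding has_derivative_iff_norm by blast
qed

lemma segment_in_convex:
  fixes c :: "'e::real_normed_vector"
  assumes "convex B" "c \<in> B" "z \<in> B" "t \<in> {0..1::real}"
  shows "c + t *\<^sub>R (z - c) \<in> B"
  using convexD_alt[OF assms(1-3), of t] assms(4) by (simp add: algebra_simps)

lemma continuous_on_segment:
  fixes c :: "'e::real_normed_vector"
  assumes B: "convex B" "c \<in> B" and h: "continuous_on B h"
  shows "continuous_on (B \<times> {0..1::real}) (\<lambda>x. h (c + snd x *\<^sub>R (fst x - c)))"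
proof (rule continuous_on_compose2[OF h])
  show "continuous_on (B \<times> {0..1::real}) (\<lambda>x. c + snd x *\<^sub>R (fst x - c))"
    by (intro continuous_intros)
qed (use segment_in_convex[OF B] in auto)

text \<open>Differentiation under the integral sign. The derivative of \<open>h\<close> at
  \<open>c + t *\<^sub>R (z - c)\<close> with respect to \<open>z\<close> brings out a factor t, so
  the weight \<open>t ^ m\<close> with arbitrary \<open>m\<close> is what makes the induction
  close.\<close>

lemma Ck_integral_segment:
  fixes h :: "'e::euclidean_space \<Rightarrow> real"
  assumes W: "relopen V B" and B: "convex B" "c \<in> B" and h: "Ck k V B h"
  shows "Ck k V B (\<lambda>z. integral (cbox 0 1) (\<lambda>t. t ^ m * h (c + t *\<^sub>R (z - c))))"
  using h
proof (induction k arbitrary: h m)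
  case 0
  then have h: "continuous_on B h" by simp
  show ?case unfolding Ck.simps
    by (rule integral_continuous_on_param)
       (auto simp: split_beta intro!: continuous_intros continuous_on_segment[OF B h])
next
  case (Suc k)
  obtain E where E: "finite E" "E \<subseteq> V" "\<And>v. v \<in> V \<Longrightarrow> v = (\<Sum>b\<in>E. (v \<bullet> b) *\<^sub>R b)"
    using subspace_orthonormal_expansion W by blast
  obtain h' where h': "\<forall>x\<in>B. (h has_derivative h' x) (at x within B)"
    "\<forall>v\<in>V. Ck k V B (\<lambda>x. h' x v)" using Suc.prems unfolding Ck.simps by blast
  have h: "continuous_on B h" using Ck_continuous_on[OF Suc.prems] .
  have h'c: "continuous_on B (\<lambda>x. h' x v)" if "v \<in> V" for v using h'(2) that Ck_continuous_on by blast
  \<comment> \<open>The derivative \<open>h' z\<close> is determined, and known to be continuous in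
    \<open>z\<close>, in directions of \<open>V\<close> only. \<open>D z\<close> agrees with it
    there and factors through the projection to \<open>V\<close>, which gives a map on the whole
    space that is continuous in \<open>z\<close>.\<close>
  define D where "D z v = (\<Sum>b\<in>E. (v \<bullet> b) * h' z b)" for z v
  have DV: "D z v = h' z v" if "z \<in> B" "v \<in> V" for z v
  proof -
    have "linear (h' z)" using h'(1) that(1) has_derivative_linear by blast
    then have "h' z (\<Sum>b\<in>E. (v \<bullet> b) *\<^sub>R b) = D z v"
      by (simp add: linear_sum linear_scale D_def)
    then show ?thesis using E(3)[OF that(2)] by simp
  qed
  have D: "(h has_derivative D z) (at z within B)" if z: "z \<in> B" for z
  proof (rule has_derivative_within_subspace_cong)
    show "(h has_derivative h' z) (at z within B)" using h'(1) z by blast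
    show "bounded_linear (D z)" unfolding D_def
      by (intro bounded_linear_sum bounded_linear_compose[OF bounded_linear_mult_left] bounded_linear_inner_left)
  qed (use W z relopen_subset[OF W] DV in auto)
  \<comment> \<open>The derivative of the integrand as a bounded linear function, the form in which
    \<open>leibniz_rule\<close> wants it.\<close>
  define F where "F z t = (\<Sum>b\<in>E. (t ^ Suc m * h' (c + t *\<^sub>R (z - c)) b) *\<^sub>R blinfun_inner_left b)"
    for z :: 'e and t :: real
  have F: "blinfun_apply (F z t) v = t ^ m * D (c + t *\<^sub>R (z - c)) (t *\<^sub>R v)" for z t v
    unfolding F_def D_def
    by (simp add: blinfun.sum_left blinfun.scaleR_left sum_distrib_left mult_ac inner_commute)
  have Fc: "continuous_on (B \<times> cbox 0 1) (\<lambda>(z, t). F z t)"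
    unfolding F_def split_beta
    using E(2) h'c by (auto intro!: continuous_intros continuous_on_segment[OF B])
  have der: "((\<lambda>z. t ^ m * h (c + t *\<^sub>R (z - c))) has_derivative F z t) (at z within B)"
    if z: "z \<in> B" and t: "t \<in> cbox 0 1" for z t
  proof -
    have im: "(\<lambda>z. c + t *\<^sub>R (z - c)) ` B \<subseteq> B" using segment_in_convex[OF B] t by auto
    have "((\<lambda>z. c + t *\<^sub>R (z - c)) has_derivative (\<lambda>v. t *\<^sub>R v)) (at z within B)"
      by (auto intro!: derivative_eq_intros)
    from has_derivative_in_compose2[of B h D, OF D im z this]
    have "((\<lambda>z. h (c + t *\<^sub>R (z - c))) has_derivative (\<lambda>v. D (c + t *\<^sub>R (z - c)) (t *\<^sub>R v))) (at z within B)" .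
    from has_derivative_mult_right[OF this, of "t ^ m"]
    show ?thesis unfolding F[abs_def, symmetric] .
  qed
  have int: "(\<lambda>t. t ^ m * h (c + t *\<^sub>R (z - c))) integrable_on cbox 0 1" if z: "z \<in> B" for z
    by (intro integrable_continuous continuous_intros continuous_on_compose2[OF h])
       (use segment_in_convex[OF B z] in auto)
  have Fint: "F z integrable_on cbox 0 1" if z: "z \<in> B" for z
  proof (rule integrable_continuous)
    have "continuous_on (cbox 0 1) (\<lambda>t. (\<lambda>(z, t). F z t) (z, t))"
      by (rule continuous_on_compose2[OF Fc, of "cbox 0 1" "Pair z"])
         (use z in \<open>auto intro: continuous_on_Pair continuous_on_const continuous_on_id\<close>)
    then show "continuous_on (cbox 0 1) (F z)" by simp
  qed
  have "\<forall>z\<in>B. ((\<lambda>z. integral (cbox 0 1) (\<lambda>t. t ^ m * h (c + t *\<^sub>R (z - c)))) has_derivative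
      integral (cbox 0 1) (F z)) (at z within B)"
    using leibniz_rule[OF der int Fc _ B(1)] by blast
  moreover have "Ck k V B (\<lambda>z. blinfun_apply (integral (cbox 0 1) (F z)) v)" if v: "v \<in> V" for v
  proof (rule Ck_cong)
    show "Ck k V B (\<lambda>z. integral (cbox 0 1) (\<lambda>t. t ^ Suc m * h' (c + t *\<^sub>R (z - c)) v))"
      using Suc.IH h'(2) v by blast
    fix z assume z: "z \<in> B"
    have "t ^ Suc m * h' (c + t *\<^sub>R (z - c)) v = blinfun_apply (F z t) v" if t: "t \<in> cbox 0 1" for t
    proof -
      have *: "c + t *\<^sub>R (z - c) \<in> B" using segment_in_convex[OF B z] t by auto
      have "linear (h' (c + t *\<^sub>R (z - c)))" using h'(1) * has_derivative_linear by blast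
      then show ?thesis unfolding F using DV[OF *] v W by (simp add: linear_scale subspace_scale)
    qed
    then show "integral (cbox 0 1) (\<lambda>t. t ^ Suc m * h' (c + t *\<^sub>R (z - c)) v) =
        blinfun_apply (integral (cbox 0 1) (F z)) v"
      unfolding blinfun_apply_integral[OF Fint[OF z]] by (intro integral_cong) auto
  qed
  ultimately show ?case unfolding Ck.simps
    by (intro exI[of _ "\<lambda>z. blinfun_apply (integral (cbox 0 1) (F z))"]) blast
qed

text \<open>The fundamental theorem of calculus for \<open>h\<close> along the segment from
  \<open>c\<close> to \<open>z\<close>; \<open>g b\<close> is the mean of the derivative in
  direction \<open>b\<close> over that segment, hence equals the derivative itself at
  \<open>z = c\<close>.\<close>

lemma hadamard:
  fixes h :: "'e::euclidean_space \<Rightarrow> real"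
  assumes W: "relopen V B" and B: "convex B" "c \<in> B" and h: "smooth_on V B h"
    and E: "finite E" "E \<subseteq> V" "\<And>v. v \<in> V \<Longrightarrow> v = (\<Sum>b\<in>E. (v \<bullet> b) *\<^sub>R b)"
  obtains g where "\<forall>b\<in>E. smooth_on V B (g b)" "\<forall>b. g b c = dir_deriv h b c"
    "\<forall>z\<in>B. h z = h c + (\<Sum>b\<in>E. ((z - c) \<bullet> b) * g b z)"
proof
  \<comment> \<open>The factor \<open>t ^ 0\<close> matches the weight in
    \<open>Ck_integral_segment\<close>.\<close>
  define g where "g b z = integral (cbox 0 1) (\<lambda>t. t ^ 0 * dir_deriv h b (c + t *\<^sub>R (z - c)))" for b z
  have Ckh: "Ck k V B (dir_deriv h b)" if "b \<in> V" for b k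
    using h that Ck_Suc_iff[OF W] unfolding smooth_on_def by blast
  show "\<forall>b\<in>E. smooth_on V B (g b)"
    unfolding g_def smooth_on_def using Ck_integral_segment[OF W B Ckh] E(2) by blast
  show "\<forall>b. g b c = dir_deriv h b c" by (simp add: g_def)
  show "\<forall>z\<in>B. h z = h c + (\<Sum>b\<in>E. ((z - c) \<bullet> b) * g b z)"
  proof
    fix z assume z: "z \<in> B"
    have zc: "z - c \<in> V" using z B(2) relopen_subset[OF W] W subspace_diff by blast
    have "h differentiable at y within B" if "y \<in> B" for y
      using h Ck_Suc_iff[OF W] that unfolding smooth_on_def by blast
    then obtain h' where h': "\<And>y. y \<in> B \<Longrightarrow> (h has_derivative h' y) (at y within B)"
      unfolding differentiable_def by metis
    let ?s = "\<lambda>t. c + t *\<^sub>R (z - c)"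
    have s: "?s t \<in> B" if "t \<in> {0..1}" for t using segment_in_convex[OF B z that] .
    have hd: "h' y v = (\<Sum>b\<in>E. (v \<bullet> b) * dir_deriv h b y)" if y: "y \<in> B" and v: "v \<in> V" for y v
    proof -
      have "linear (h' y)" using h'[OF y] has_derivative_linear by blast
      then have "h' y (\<Sum>b\<in>E. (v \<bullet> b) *\<^sub>R b) = (\<Sum>b\<in>E. (v \<bullet> b) * h' y b)"
        by (simp add: linear_sum linear_scale)
      also have "\<dots> = (\<Sum>b\<in>E. (v \<bullet> b) * dir_deriv h b y)"
        using dir_deriv_eq[OF W y _ h'[OF y]] E(2) by (intro sum.cong) auto
      finally show ?thesis using E(3)[OF v] by simp
    qed
    have "((\<lambda>t. h (?s t)) has_vector_derivative h' (?s t) (z - c)) (at t within {0..1})"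
      if t: "t \<in> {0..1}" for t
    proof -
      have "(?s has_derivative (\<lambda>u. u *\<^sub>R (z - c))) (at t within {0..1})"
        by (auto intro!: derivative_eq_intros)
      from has_derivative_in_compose2[of B h h', OF h' _ t this]
      have "((\<lambda>t. h (?s t)) has_derivative (\<lambda>u. h' (?s t) (u *\<^sub>R (z - c)))) (at t within {0..1})"
        using s by blast
      moreover have "linear (h' (?s t))" using h'[OF s[OF t]] has_derivative_linear by blast
      ultimately show ?thesis unfolding has_vector_derivative_def by (simp add: linear_scale)
    qed
    then have ftc: "((\<lambda>t. h' (?s t) (z - c)) has_integral h (?s 1) - h (?s 0)) {0..1}"
      by (intro fundamental_theorem_of_calculus) auto
    have "((\<lambda>t. \<Sum>b\<in>E. ((z - c) \<bullet> b) * dir_deriv h b (?s t)) has_integral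
        (\<Sum>b\<in>E. ((z - c) \<bullet> b) * g b z)) {0..1}"
    proof (intro has_integral_sum E(1) has_integral_mult_right)
      fix b assume "b \<in> E"
      then have "continuous_on B (dir_deriv h b)" using Ckh[of b 0] E(2) by auto
      then have "continuous_on (cbox 0 1) (\<lambda>t. dir_deriv h b (?s t))"
        by (rule continuous_on_compose2) (use s in \<open>auto intro!: continuous_intros\<close>)
      then have "(\<lambda>t. dir_deriv h b (?s t)) integrable_on cbox 0 1"
        by (rule integrable_continuous)
      then show "((\<lambda>t. dir_deriv h b (?s t)) has_integral g b z) {0..1}"
        unfolding g_def by (simp add: has_integral_integral)
    qed
    then have "((\<lambda>t. h' (?s t) (z - c)) has_integral (\<Sum>b\<in>E. ((z - c) \<bullet> b) * g b z)) {0..1}"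
      by (rule has_integral_eq[rotated]) (use hd[OF s zc] in simp)
    then have "h (?s 1) - h (?s 0) = (\<Sum>b\<in>E. ((z - c) \<bullet> b) * g b z)"
      using ftc has_integral_unique by blast
    then show "h z = h c + (\<Sum>b\<in>E. ((z - c) \<bullet> b) * g b z)" by simp
  qed
qed

lemma smooth_on_const: "smooth_on V W (\<lambda>z. c)"
  unfolding smooth_on_def using Ck_const by blast

lemma smooth_on_add: "relopen V W \<Longrightarrow> smooth_on V W f \<Longrightarrow> smooth_on V W g \<Longrightarrow> smooth_on V W (\<lambda>z. f z + g z)"
  unfolding smooth_on_def using Ck_add by blast

lemma smooth_on_mult:
  fixes f g :: "'e::euclidean_space \<Rightarrow> real"
  shows "relopen V W \<Longrightarrow> smooth_on V W f \<Longrightarrow> smooth_on V W g \<Longrightarrow> smooth_on V W (\<lambda>z. f z * g z)"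
  unfolding smooth_on_def using Ck_mult by blast

lemma smooth_on_inner: "smooth_on V W (\<lambda>z. z \<bullet> b)"
  unfolding smooth_on_def using Ck_bounded_linear[OF bounded_linear_inner_left Ck_id] by blast

lemma smooth_on_subset: "smooth_on V W f \<Longrightarrow> W' \<subseteq> W \<Longrightarrow> smooth_on V W' f"
  unfolding smooth_on_def using Ck_subset by blast

lemma smooth_on_cong: "smooth_on V W f \<Longrightarrow> (\<And>z. z \<in> W \<Longrightarrow> f z = g z) \<Longrightarrow> smooth_on V W g"
  unfolding smooth_on_def using Ck_cong[of _ V W f g] by blast

lemma smooth_on_dir_deriv: "relopen V W \<Longrightarrow> smooth_on V W f \<Longrightarrow> v \<in> V \<Longrightarrow> smooth_on V W (dir_deriv f v)"
  unfolding smooth_on_def using Ck_Suc_iff by blast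

lemma smooth_on_has_derivative:
  assumes "relopen V W" "smooth_on V W f" "z \<in> W"
  obtains D where "(f has_derivative D) (at z within W)" "\<forall>v\<in>V. dir_deriv f v z = D v"
proof -
  have "f differentiable at z within W"
    using assms(2,3) Ck_Suc_iff[OF assms(1)] unfolding smooth_on_def by blast
  then obtain D where D: "(f has_derivative D) (at z within W)" unfolding differentiable_def by blast
  show ?thesis by (rule that[OF D]) (use dir_deriv_eq[OF assms(1,3) _ D] in blast)
qed

lemma smooth_on_compose:
  fixes f :: "'f::euclidean_space \<Rightarrow> real" and g :: "'e::euclidean_space \<Rightarrow> 'f"
  shows "relopen V W \<Longrightarrow> relopen V' W' \<Longrightarrow> g ` W \<subseteq> W' \<Longrightarrow> smooth_on V W g \<Longrightarrow> smooth_on V' W' f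
    \<Longrightarrow> smooth_on V W (\<lambda>z. f (g z))"
  unfolding smooth_on_def by (intro allI, rule Ck_compose) auto

lemma smooth_on_local:
  assumes "relopen V W"
    and "\<And>z. z \<in> W \<Longrightarrow> \<exists>A. open A \<and> z \<in> A \<and> smooth_on V (W \<inter> A) f"
  shows "smooth_on V W f"
proof -
  have "Ck k V W f" for k
  proof (rule Ck_local[OF assms(1)])
    fix z assume "z \<in> W"
    then obtain A where "open A" "z \<in> A" "smooth_on V (W \<inter> A) f" using assms(2) by blast
    then show "\<exists>A. open A \<and> z \<in> A \<and> Ck k V (W \<inter> A) f" unfolding smooth_on_def by auto
  qed
  then show ?thesis unfolding smooth_on_def by blast
qed

lemma dir_deriv_add:
  assumes "relopen V W" "smooth_on V W f" "smooth_on V W g" "z \<in> W" "v \<in> V"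
  shows "dir_deriv (\<lambda>z. f z + g z) v z = dir_deriv f v z + dir_deriv g v z"
proof -
  obtain D where D: "(f has_derivative D) (at z within W)" "\<forall>v\<in>V. dir_deriv f v z = D v"
    using smooth_on_has_derivative[OF assms(1,2,4)] .
  obtain D' where D': "(g has_derivative D') (at z within W)" "\<forall>v\<in>V. dir_deriv g v z = D' v"
    using smooth_on_has_derivative[OF assms(1,3,4)] .
  show ?thesis using dir_deriv_eq[OF assms(1,4,5) has_derivative_add[OF D(1) D'(1)]] D(2) D'(2) assms(5) by simp
qed

lemma dir_deriv_mult:
  fixes f g :: "'e::euclidean_space \<Rightarrow> real"
  assumes "relopen V W" "smooth_on V W f" "smooth_on V W g" "z \<in> W" "v \<in> V"
  shows "dir_deriv (\<lambda>z. f z * g z) v z = f z * dir_deriv g v z + g z * dir_deriv f v z"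
proof -
  obtain D where D: "(f has_derivative D) (at z within W)" "\<forall>v\<in>V. dir_deriv f v z = D v"
    using smooth_on_has_derivative[OF assms(1,2,4)] .
  obtain D' where D': "(g has_derivative D') (at z within W)" "\<forall>v\<in>V. dir_deriv g v z = D' v"
    using smooth_on_has_derivative[OF assms(1,3,4)] .
  show ?thesis using dir_deriv_eq[OF assms(1,4,5) has_derivative_mult[OF D(1) D'(1)]] D(2) D'(2) assms(5)
    by simp
qed

lemma dir_deriv_const: "dir_deriv (\<lambda>z. c) v z = 0"
  unfolding dir_deriv_def by simp

section \<open>Smooth functions, vector fields and local frames\<close>

locale smooth_mfd =
  fixes M :: "('a::{t2_space,second_countable_topology}, 'e::euclidean_space) manifold"
  assumes smooth_manifold: "smooth_manifold M"
begin

abbreviation C :: "'a scalar set" where "C \<equiv> smooth_functions M"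
abbreviation \<XX> :: "'a vfield set" where "\<XX> \<equiv> vector_fields M"

lemma chart:
  assumes "(U, x) \<in> atlas M"
  shows "open U" "relopen (model M) (x ` U)" "inj_on x U" "continuous_on U x"
    "continuous_on (x ` U) (inv_into U x)"
proof -
  from assms smooth_manifold have *: "subspace (model M)" "open U" "openin (top_of_set (model M)) (x ` U)"
    "\<exists>y. homeomorphism U (x ` U) x y" unfolding smooth_manifold_def by fastforce+
  then obtain y where y: "homeomorphism U (x ` U) x y" by blast
  show "open U" "relopen (model M) (x ` U)" using * by auto
  show inj: "inj_on x U" using y by (metis homeomorphism_apply1 inj_onI)
  show "continuous_on U x" using y homeomorphism_cont1 by blast
  have "inv_into U x z = y z" if "z \<in> x ` U" for z
    using that y inj by (auto simp: homeomorphism_apply1)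
  then show "continuous_on (x ` U) (inv_into U x)"
    using homeomorphism_cont2[OF y] by (simp cong: continuous_on_cong)
qed

lemma chart_open_image:
  assumes U: "(U, x) \<in> atlas M" and S: "open S" "S \<subseteq> U"
  obtains A where "open A" "x ` S = x ` U \<inter> A"
proof -
  have "homeomorphism U (x ` U) x (inv_into U x)"
    using chart[OF U] by (auto simp: homeomorphism_def)
  moreover have "openin (top_of_set U) S" using S by (simp add: open_subset)
  ultimately have "openin (top_of_set (x ` U)) (x ` S)" by (rule homeomorphism_imp_open_map)
  then show ?thesis using that unfolding openin_open by blast
qed

lemma transition:
  assumes "(U, x) \<in> atlas M" "(U', x') \<in> atlas M"
  shows "smooth_on (model M) (x ` (U \<inter> U')) (x' \<circ> inv_into U x)"
  using assms smooth_manifold unfolding smooth_manifold_def by fast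

lemma chart_at: obtains U x where "(U, x) \<in> atlas M" "p \<in> U"
proof -
  have "p \<in> (\<Union>(U, x)\<in>atlas M. U)" using smooth_manifold unfolding smooth_manifold_def by simp
  then show ?thesis using that by auto
qed

lemma C_iff: "f \<in> C \<longleftrightarrow> (\<forall>(U, x)\<in>atlas M. smooth_on (model M) (x ` U) (\<lambda>z. f (inv_into U x z)))"
  by (simp add: smooth_functions_def o_def)

lemma C_const [simp]: "(\<lambda>_. c) \<in> C"
  unfolding C_iff by (auto intro: smooth_on_const)

lemma C_add [simp]: "f \<in> C \<Longrightarrow> g \<in> C \<Longrightarrow> f + g \<in> C"
  unfolding C_iff plus_fun_apply
  by (intro ballI case_prodI2 smooth_on_add[OF chart(2)]) auto

lemma C_mult [simp]: "f \<in> C \<Longrightarrow> g \<in> C \<Longrightarrow> f * g \<in> C"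
  unfolding C_iff times_fun_apply
  by (intro ballI case_prodI2 smooth_on_mult[OF chart(2)]) auto

lemma C_zero [simp]: "0 \<in> C"
  using C_const[of 0] by (simp add: zero_fun_def)

lemma C_one [simp]: "1 \<in> C"
  using C_const[of 1] by (simp add: one_fun_def)

lemma C_numeral [simp]: "numeral n \<in> C"
  using C_const[of "numeral n"] by (simp add: numeral_fun)

lemma C_uminus [simp]: "f \<in> C \<Longrightarrow> - f \<in> C"
  using C_mult[OF C_const[of "-1"], of f] by (simp add: times_fun_def fun_Compl_def)

lemma C_diff [simp]: "f \<in> C \<Longrightarrow> g \<in> C \<Longrightarrow> f - g \<in> C"
  using C_add[OF _ C_uminus, of f g] by simp

lemma C_sum: "(\<And>i. i \<in> I \<Longrightarrow> f i \<in> C) \<Longrightarrow> (\<Sum>i\<in>I. f i) \<in> C"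
  by (induction I rule: infinite_finite_induct) auto

text \<open>The manifold is covered by two kinds of open sets. Near a point over \<open>W\<close>
  the function is \<open>g\<close> after a transition map; off the compact preimage of
  \<open>K\<close> it is 0.\<close>

lemma smooth_extension:
  assumes U: "(U, x) \<in> atlas M" and W: "openin (top_of_set (model M)) W" "W \<subseteq> x ` U"
    and g: "smooth_on (model M) W g" and K: "compact K" "K \<subseteq> W" "\<And>z. z \<in> W - K \<Longrightarrow> g z = 0"
  shows "(\<lambda>q. if q \<in> U \<and> x q \<in> W then g (x q) else 0) \<in> C" (is "?F \<in> C")
  unfolding C_iff
proof clarify
  fix U' x' assume U': "(U', x') \<in> atlas M"
  have V: "relopen (model M) W" using W chart(2)[OF U] by blast
  show "smooth_on (model M) (x' ` U') (\<lambda>z. ?F (inv_into U' x' z))"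
  proof (rule smooth_on_local[OF chart(2)[OF U']])
    fix z' assume "z' \<in> x' ` U'"
    then obtain q where q: "q \<in> U'" "z' = x' q" by blast
    obtain T where T: "open T" "W = model M \<inter> T" using W(1) by (meson openin_open)
    have xU: "x ` U \<subseteq> model M" using relopen_subset chart(2)[OF U] by blast
    show "\<exists>A. open A \<and> z' \<in> A \<and> smooth_on (model M) (x' ` U' \<inter> A) (\<lambda>z. ?F (inv_into U' x' z))"
    proof (cases "q \<in> U \<and> x q \<in> W")
      case True
      define S where "S = U' \<inter> (U \<inter> x -` T)"
      have "open (U \<inter> x -` T)"
        using continuous_open_preimage chart(1,4)[OF U] T(1) by blast
      then have S: "open S" "S \<subseteq> U'" using chart(1)[OF U'] unfolding S_def by auto
      obtain A where A: "open A" "x' ` S = x' ` U' \<inter> A" using chart_open_image[OF U' S] .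
      have "z' \<in> A" using A(2) q True T(2) unfolding S_def by auto
      moreover have "smooth_on (model M) (x' ` S) (\<lambda>z. g ((x \<circ> inv_into U' x') z))"
      proof (rule smooth_on_compose[OF _ V])
        show "relopen (model M) (x' ` S)" using chart(2)[OF U'] A by (auto simp: openin_Int_open)
        show "smooth_on (model M) (x' ` S) (x \<circ> inv_into U' x')"
          by (rule smooth_on_subset[OF transition[OF U' U]]) (auto simp: S_def)
        show "(x \<circ> inv_into U' x') ` x' ` S \<subseteq> W"
          using chart(3)[OF U'] xU T(2) by (auto simp: S_def)
      qed (rule g)
      then have "smooth_on (model M) (x' ` S) (\<lambda>z. ?F (inv_into U' x' z))"
        by (rule smooth_on_cong) (use chart(3)[OF U'] xU T(2) in \<open>auto simp: S_def\<close>)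
      ultimately show ?thesis using A by auto
    next
      case False
      \<comment> \<open>\<open>Q\<close> is compact, hence closed because the space is Hausdorff, so
        that \<open>U' - Q\<close> is an admissible open set around \<open>q\<close>.\<close>
      define Q where "Q = inv_into U x ` K"
      have "compact Q" unfolding Q_def
        by (rule compact_continuous_image[OF continuous_on_subset[OF chart(5)[OF U]] K(1)])
           (use K(2) W(2) in blast)
      then have S: "open (U' - Q)" "U' - Q \<subseteq> U'" using chart(1)[OF U'] by (auto intro: compact_imp_closed)
      obtain A where A: "open A" "x' ` (U' - Q) = x' ` U' \<inter> A" using chart_open_image[OF U' S] .
      have F0: "?F r = 0" if "r \<notin> Q" for r
      proof (cases "r \<in> U \<and> x r \<in> W")
        case True
        then have "x r \<notin> K" using that chart(3)[OF U] unfolding Q_def by (metis imageI inv_into_f_f)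
        then show ?thesis using K(3) True by auto
      qed auto
      have "q \<notin> Q"
      proof
        assume "q \<in> Q"
        then obtain k where k: "k \<in> K" "q = inv_into U x k" unfolding Q_def by blast
        then have "k \<in> x ` U" using K(2) W(2) by blast
        then have "q \<in> U" "x q = k" using k(2) by (simp_all add: inv_into_into f_inv_into_f)
        then show False using False k(1) K(2) by blast
      qed
      then have "z' \<in> A" using q A(2) by auto
      moreover have "smooth_on (model M) (x' ` (U' - Q)) (\<lambda>z. ?F (inv_into U' x' z))"
      proof (rule smooth_on_cong[OF smooth_on_const[of _ _ 0]])
        fix z assume "z \<in> x' ` (U' - Q)"
        then obtain r where r: "r \<in> U'" "r \<notin> Q" "z = x' r" by blast
        then show "0 = ?F (inv_into U' x' z)" using F0[OF r(2)] chart(3)[OF U'] by (auto split: if_splits)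
      qed
      ultimately show ?thesis using A by auto
    qed
  qed
qed

lemma vfI:
  assumes "\<And>f. f \<in> C \<Longrightarrow> X f \<in> C" "\<And>f. f \<notin> C \<Longrightarrow> X f = 0"
    "\<And>f g. f \<in> C \<Longrightarrow> g \<in> C \<Longrightarrow> X (f + g) = X f + X g"
    "\<And>f c. f \<in> C \<Longrightarrow> X ((\<lambda>_. c) * f) = (\<lambda>_. c) * X f"
    "\<And>f g. f \<in> C \<Longrightarrow> g \<in> C \<Longrightarrow> X (f * g) = f * X g + g * X f"
  shows "X \<in> \<XX>"
  using assms unfolding vector_fields_def Let_def by blast

lemma
  assumes "X \<in> \<XX>"
  shows vf_C: "f \<in> C \<Longrightarrow> X f \<in> C"
    and vf_outside: "f \<notin> C \<Longrightarrow> X f = 0"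
    and vf_add: "f \<in> C \<Longrightarrow> g \<in> C \<Longrightarrow> X (f + g) = X f + X g"
    and vf_scale: "f \<in> C \<Longrightarrow> X ((\<lambda>_. c) * f) = (\<lambda>_. c) * X f"
    and vf_mult: "f \<in> C \<Longrightarrow> g \<in> C \<Longrightarrow> X (f * g) = f * X g + g * X f"
  using assms unfolding vector_fields_def Let_def by blast+

lemma vf_zero: assumes "X \<in> \<XX>" shows "X 0 = 0"
proof -
  have "X (0 + 0) = X 0 + X 0" by (rule vf_add[OF assms]) simp_all
  then show ?thesis by (simp only: add_0_left add_cancel_right_right)
qed

lemma vf_const: assumes "X \<in> \<XX>" shows "X (\<lambda>_. c) = 0"
proof -
  have "X (1 * 1) = 1 * X 1 + 1 * X 1" by (rule vf_mult[OF assms]) simp_all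
  then have "X 1 = X 1 + X 1" unfolding mult_1_left .
  then have "X 1 = 0" by (simp only: add_cancel_right_right)
  moreover have "(\<lambda>_. c) = (\<lambda>_. c) * (1 :: 'a scalar)" by simp
  ultimately show ?thesis using vf_scale[OF assms, of 1 c] by simp
qed

lemma vf_uminus: "X \<in> \<XX> \<Longrightarrow> f \<in> C \<Longrightarrow> X (- f) = - X f"
  using vf_scale[of X f "-1"] by (simp add: times_fun_def fun_Compl_def)

lemma vf_diff: "X \<in> \<XX> \<Longrightarrow> f \<in> C \<Longrightarrow> g \<in> C \<Longrightarrow> X (f - g) = X f - X g"
  using vf_add[of X f "- g"] vf_uminus[of X g] by simp

lemma vf_sum: "X \<in> \<XX> \<Longrightarrow> (\<And>i. i \<in> I \<Longrightarrow> f i \<in> C) \<Longrightarrow> X (\<Sum>i\<in>I. f i) = (\<Sum>i\<in>I. X (f i))"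
  by (induction I rule: infinite_finite_induct) (auto simp: vf_zero vf_add C_sum)

lemmas vf_rules = vf_C vf_outside vf_zero vf_const vf_add vf_diff vf_uminus vf_scale vf_mult

end

lemma sum_fun_apply: "(\<Sum>i\<in>I. F i) x = (\<Sum>i\<in>I. F i x)"
  by (induction I rule: infinite_finite_induct) auto

section \<open>The module of vector fields, cut-off coordinate fields and local frames\<close>

context smooth_mfd begin

lemma \<XX>_zero [simp]: "0 \<in> \<XX>"
  by (rule vfI) auto

lemma \<XX>_add [simp]:
  assumes "X \<in> \<XX>" "Y \<in> \<XX>" shows "X + Y \<in> \<XX>"
  by (rule vfI) (simp_all add: vf_rules[OF assms(1)] vf_rules[OF assms(2)] algebra_simps)

lemma \<XX>_smul [simp]:
  assumes "f \<in> C" "X \<in> \<XX>" shows "smul f X \<in> \<XX>"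
  by (rule vfI) (simp_all add: assms(1) smul_def vf_rules[OF assms(2)] algebra_simps)

lemma \<XX>_sum: "(\<And>i. i \<in> I \<Longrightarrow> X i \<in> \<XX>) \<Longrightarrow> (\<Sum>i\<in>I. X i) \<in> \<XX>"
  by (induction I rule: infinite_finite_induct) auto

lemma \<XX>_uminus [simp]: assumes "X \<in> \<XX>" shows "- X \<in> \<XX>"
proof -
  have "- X = smul (\<lambda>_. - 1) X" by (simp add: smul_def fun_eq_iff)
  then show ?thesis using \<XX>_smul[OF C_const assms] by simp
qed

lemma \<XX>_diff [simp]: "X \<in> \<XX> \<Longrightarrow> Y \<in> \<XX> \<Longrightarrow> X - Y \<in> \<XX>"
  using \<XX>_add[of X "- Y"] by simp

definition local_rep :: "'a set \<Rightarrow> ('a \<Rightarrow> 'e) \<Rightarrow> 'a scalar \<Rightarrow> 'e \<Rightarrow> real" where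
  "local_rep U x f z = f (inv_into U x z)"

definition ext_zero :: "'a set \<Rightarrow> ('a \<Rightarrow> 'e) \<Rightarrow> 'e set \<Rightarrow> ('e \<Rightarrow> real) \<Rightarrow> 'a scalar" where
  "ext_zero U x W g = (\<lambda>q. if q \<in> U \<and> x q \<in> W then g (x q) else 0)"

lemma ext_zero_C:
  assumes "(U, x) \<in> atlas M" "openin (top_of_set (model M)) W" "W \<subseteq> x ` U"
    "smooth_on (model M) W g" "compact K" "K \<subseteq> W" "\<And>z. z \<in> W - K \<Longrightarrow> g z = 0"
  shows "ext_zero U x W g \<in> C"
  unfolding ext_zero_def by (rule smooth_extension[OF assms])

lemma local_rep_smooth:
  assumes "(U, x) \<in> atlas M" "f \<in> C" shows "smooth_on (model M) (x ` U) (local_rep U x f)"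
  using assms unfolding C_iff local_rep_def[abs_def] by auto

text \<open>A partial derivative lives only in the chart; the factor \<open>h\<close> of compact
  support makes it global. The value 0 off the smooth functions is the normalization built into
  \<open>vector_fields\<close>.\<close>

lemma coordinate_vector_field:
  assumes U: "(U, x) \<in> atlas M" and h: "smooth_on (model M) (x ` U) h"
    and K: "compact K" "K \<subseteq> x ` U" "\<And>z. z \<in> x ` U - K \<Longrightarrow> h z = 0" and b: "b \<in> model M"
  shows "(\<lambda>f. if f \<in> C then ext_zero U x (x ` U) (\<lambda>z. h z * dir_deriv (local_rep U x f) b z) else 0) \<in> \<XX>"
    (is "?X \<in> _")
proof (rule vfI)
  note W = chart(2)[OF U]
  note r = local_rep_smooth[OF U]
  fix f assume f: "f \<in> C"
  show "?X f \<in> C"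
    using f smooth_on_mult[OF W h smooth_on_dir_deriv[OF W r[OF f] b]] K
    by (auto intro!: ext_zero_C[OF U conjunct2[OF W] subset_refl _ K(1,2)])
  have c: "dir_deriv (local_rep U x ((\<lambda>_. c) * f)) b z = c * dir_deriv (local_rep U x f) b z"
    if z: "z \<in> x ` U" for c z
    using dir_deriv_mult[OF W smooth_on_const[of _ _ c] r[OF f] z b]
    by (simp add: dir_deriv_const local_rep_def[abs_def])
  then show "?X ((\<lambda>_. c) * f) = (\<lambda>_. c) * ?X f" for c
    using f by (auto simp: ext_zero_def fun_eq_iff)
  fix g assume g: "g \<in> C"
  have "dir_deriv (local_rep U x (f + g)) b z = dir_deriv (local_rep U x f) b z + dir_deriv (local_rep U x g) b z"
    if z: "z \<in> x ` U" for z
    using dir_deriv_add[OF W r[OF f] r[OF g] z b] by (simp add: local_rep_def[abs_def])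
  then show "?X (f + g) = ?X f + ?X g"
    using f g by (auto simp: ext_zero_def fun_eq_iff distrib_left)
  have "dir_deriv (local_rep U x (f * g)) b (x q) =
      f q * dir_deriv (local_rep U x g) b (x q) + g q * dir_deriv (local_rep U x f) b (x q)"
    if q: "q \<in> U" for q
    using dir_deriv_mult[OF W r[OF f] r[OF g] imageI[OF q] b] q chart(3)[OF U]
    by (simp add: local_rep_def[abs_def])
  then show "?X (f * g) = f * ?X g + g * ?X f"
    using f g by (auto simp: ext_zero_def fun_eq_iff algebra_simps)
qed auto

text \<open>
  The functions \<open>x\<^sub>b = h z\<^sub>b\<close>, with \<open>h\<close> a bump function, differ from the coordinates \<open>z\<^sub>b\<close> even where
  \<open>h \<noteq> 0\<close>; the summand of index \<open>None\<close>, with \<open>x = h\<close>, corrects for that.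
\<close>

lemma ex_local_frame:
  fixes p :: 'a
  obtains w and I :: "'e option set" and xs e where
    "w \<in> C" "w p \<noteq> 0" "finite I" "\<And>i. i \<in> I \<Longrightarrow> xs i \<in> C" "\<And>i. i \<in> I \<Longrightarrow> e i \<in> \<XX>"
    "\<And>X. X \<in> \<XX> \<Longrightarrow> smul w X = (\<Sum>i\<in>I. smul (X (xs i)) (e i))"
proof -
  obtain U x where U: "(U, x) \<in> atlas M" and p: "p \<in> U" by (rule chart_at)
  note W = chart(2)[OF U]
  have WV: "x ` U \<subseteq> model M" using relopen_subset[OF W] .
  obtain E where E: "finite E" "E \<subseteq> model M" "\<And>v. v \<in> model M \<Longrightarrow> v = (\<Sum>b\<in>E. (v \<bullet> b) *\<^sub>R b)"
    using subspace_orthonormal_expansion[OF conjunct1[OF W]] by blast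
  have balls: "\<exists>s>0. cball y s \<inter> model M \<subseteq> x ` U" if "y \<in> x ` U" for y
    using conjunct2[OF W] that unfolding openin_contains_cball by (elim conjE bspec)
  obtain s where s: "s > 0" "cball (x p) s \<inter> model M \<subseteq> x ` U"
    using balls[OF imageI[OF p]] by (elim exE conjE)
  obtain h :: "'e \<Rightarrow> real" where h: "smooth_on (model M) (x ` U) h" "h (x p) \<noteq> 0" "\<forall>z. z \<notin> cball (x p) s \<longrightarrow> h z = 0"
    using ex_bump[OF W s(1), of "x p"] .
  define K where "K = cball (x p) s \<inter> model M"
  have K: "compact K" "K \<subseteq> x ` U" "\<And>z. z \<in> x ` U - K \<Longrightarrow> h z = 0"
    unfolding K_def using s(2) h(3) WV conjunct1[OF W]
    by (auto intro: compact_Int_closed closed_subspace)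
  let ?ext = "ext_zero U x (x ` U)"
  have extC: "?ext (\<lambda>z. h z * g z) \<in> C" if "smooth_on (model M) (x ` U) g" for g
    by (rule ext_zero_C[OF U conjunct2[OF W] subset_refl smooth_on_mult[OF W h(1) that] K(1,2)])
       (use K(3) in auto)
  define H where "H = ?ext h"
  have H: "H \<in> C" using extC[OF smooth_on_const[of _ _ 1]] unfolding H_def by simp
  define xb where "xb b = ?ext (\<lambda>z. h z * (z \<bullet> b))" for b
  have xb: "xb b \<in> C" for b unfolding xb_def by (rule extC[OF smooth_on_inner])
  define D where "D g b f = (if f \<in> C then ?ext (\<lambda>z. g z * dir_deriv (local_rep U x f) b z) else 0)" for g b f
  \<comment> \<open>Coefficients of the correction field: the sum of the \<open>D (k b) b\<close> is
    minus \<open>h\<close> times the Euler field of the chart, and it is paired with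
    \<open>X H\<close>.\<close>
  define k where "k b z = h z * (- (z \<bullet> b))" for b z
  have "smooth_on (model M) (x ` U) (\<lambda>z. - (z \<bullet> b))" for b
    using smooth_on_mult[OF W smooth_on_const[of _ _ "-1"] smooth_on_inner[of _ _ b]] by simp
  then have ks: "smooth_on (model M) (x ` U) (k b)" for b
    unfolding k_def[abs_def] by (rule smooth_on_mult[OF W h(1)])
  have eh: "D h b \<in> \<XX>" and ek: "D (k b) b \<in> \<XX>" if "b \<in> E" for b
    using coordinate_vector_field[OF U h(1) K] coordinate_vector_field[OF U ks K(1,2)] K(3) that E(2)
    unfolding D_def[abs_def] by (blast, auto simp: k_def)
  define I where "I = insert None (Some ` E)"
  define xs where "xs i = (case i of None \<Rightarrow> H | Some b \<Rightarrow> xb b)" for i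
  define e where "e i = (case i of None \<Rightarrow> \<Sum>b\<in>E. D (k b) b | Some b \<Rightarrow> D h b)" for i
  \<comment> \<open>Formally h X(z_b) = X(h z_b) - z_b X(h). The first term is
    \<open>X (xb b)\<close>, the second is absorbed by the correction fields. A further factor
    \<open>h\<close> is needed because the coordinate fields \<open>D h b\<close> carry one, hence
    the square.\<close>
  have main: "(H q)\<^sup>2 * X f q = X H q * (\<Sum>b\<in>E. D (k b) b f q) + (\<Sum>b\<in>E. X (xb b) q * D h b f q)"
    if X: "X \<in> \<XX>" and f: "f \<in> C" for X f q
  proof (cases "q \<in> U \<and> h (x q) \<noteq> 0")
    \<comment> \<open>Every term on both sides contains a factor that vanishes with
      \<open>h (x q)\<close> or off the chart.\<close>
    case False
    then show ?thesis by (auto simp: H_def ext_zero_def D_def k_def f)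
  next
    case True
    then have q: "q \<in> U" "h (x q) \<noteq> 0" "x q \<in> x ` U" by auto
    define c where "c = x q"
    have cV: "c \<in> model M" using q(3) WV c_def by auto
    obtain r where r: "r > 0" "cball c r \<inter> model M \<subseteq> x ` U"
      using balls[OF q(3)] unfolding c_def by (elim exE conjE)
    define B where "B = ball c r \<inter> model M"
    have BV: "openin (top_of_set (model M)) B" unfolding B_def by (simp add: openin_open_Int Int_commute)
    have B: "relopen (model M) B" using W BV by blast
    have cB: "convex B" "c \<in> B" unfolding B_def
      using r(1) cV W by (auto intro: convex_Int subspace_imp_convex)
    have BU: "B \<subseteq> x ` U" unfolding B_def using r(2) by auto
    let ?f = "local_rep U x f"
    have fs: "smooth_on (model M) B ?f" using smooth_on_subset[OF local_rep_smooth[OF U f] BU] .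
    obtain g where g: "\<forall>b\<in>E. smooth_on (model M) B (g b)" "\<forall>b. g b c = dir_deriv ?f b c"
      "\<forall>z\<in>B. ?f z = ?f c + (\<Sum>b\<in>E. ((z - c) \<bullet> b) * g b z)"
      using hadamard[OF B cB fs E] .
    \<comment> \<open>Hadamard's functions live on \<open>B\<close> only. A second bump function,
      centred at \<open>c\<close> and supported in the ball of half the radius, cuts them off to
      global functions on which \<open>X\<close> can act.\<close>
    have r2: "r / 2 > 0" using r(1) by simp
    obtain \<rho> :: "'e \<Rightarrow> real" where \<rho>: "smooth_on (model M) B \<rho>" "\<rho> c \<noteq> 0" "\<forall>z. z \<notin> cball c (r / 2) \<longrightarrow> \<rho> z = 0"
      using ex_bump[OF B r2, of c] .
    define L where "L = cball c (r / 2) \<inter> model M"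
    have L: "compact L" "L \<subseteq> B" "\<And>z. z \<in> B - L \<Longrightarrow> \<rho> z = 0"
      unfolding L_def B_def using r(1) \<rho>(3) W by (auto intro: compact_Int_closed closed_subspace)
    let ?extB = "ext_zero U x B"
    have extB: "?extB (\<lambda>z. \<rho> z * g z) \<in> C" if "smooth_on (model M) B g" for g
      by (rule ext_zero_C[OF U BV BU smooth_on_mult[OF B \<rho>(1) that] L(1,2)]) (use L(3) in auto)
    define P where "P = ?extB \<rho>"
    define G where "G b = ?extB (\<lambda>z. \<rho> z * g b z)" for b
    define Y where "Y b = ?extB (\<lambda>z. \<rho> z * ((z - c) \<bullet> b))" for b
    have P: "P \<in> C" using extB[OF smooth_on_const[of _ _ 1]] unfolding P_def by simp
    have G: "G b \<in> C" if "b \<in> E" for b unfolding G_def using extB[OF bspec[OF g(1) that]] .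
    have Y: "Y b \<in> C" for b
    proof -
      have "smooth_on (model M) B (\<lambda>z. z \<bullet> b + - (c \<bullet> b))"
        by (rule smooth_on_add[OF B smooth_on_inner smooth_on_const])
      then show ?thesis unfolding Y_def using extB[of "\<lambda>z. (z - c) \<bullet> b"] by (simp add: inner_diff_left)
    qed
    have at_q: "P q = \<rho> c" "Y b q = 0" "G b q = \<rho> c * dir_deriv ?f b c" "H q = h c"
      "xb b q = h c * (c \<bullet> b)" for b
      using q(1,3) cB(2) g(2) by (auto simp: P_def Y_def G_def H_def xb_def ext_zero_def c_def)
    \<comment> \<open>Hadamard's formula with both factors of each product cut off by \<rho>.
      Applying \<open>X\<close> at \<open>q\<close> keeps only the derivatives of \<open>f\<close>
      and of the \<open>Y b\<close>, because \<open>f - f q\<close> and each \<open>Y b\<close>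
      vanish at \<open>q\<close>.\<close>
    have "P * (P * (f - (\<lambda>_. f q))) = (\<Sum>b\<in>E. Y b * G b)"
    proof
      fix y
      show "(P * (P * (f - (\<lambda>_. f q)))) y = (\<Sum>b\<in>E. Y b * G b) y"
      proof (cases "y \<in> U \<and> x y \<in> B")
        case True
        then have "f y - f q = (\<Sum>b\<in>E. ((x y - c) \<bullet> b) * g b (x y))"
          using bspec[OF g(3), of "x y"] q(1) chart(3)[OF U] by (simp add: local_rep_def c_def)
        then show ?thesis using True
          by (simp add: P_def Y_def G_def ext_zero_def sum_fun_apply sum_distrib_left mult_ac)
      qed (auto simp: P_def Y_def G_def ext_zero_def sum_fun_apply)
    qed
    then have "X (P * (P * (f - (\<lambda>_. f q)))) q = X (\<Sum>b\<in>E. Y b * G b) q" by simp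
    then have "P q * (P q * X f q) = (\<Sum>b\<in>E. G b q * X (Y b) q)"
      using P f Y G by (simp add: vf_rules[OF X] vf_sum[OF X] sum_fun_apply at_q)
    then have 1: "\<rho> c * X f q = (\<Sum>b\<in>E. dir_deriv ?f b c * X (Y b) q)"
      using \<rho>(2) by (simp add: at_q mult.assoc sum_distrib_left[symmetric])
    \<comment> \<open>Both \<open>H * Y b\<close> and \<open>P * (xb b - (c \<bullet> b) H)\<close>
      are h \<rho> (z - c)_b on \<open>B\<close> and 0 elsewhere. At \<open>q\<close> the factors
      \<open>Y b\<close> and \<open>xb b - (c \<bullet> b) H\<close> vanish, so one term of each
      Leibniz rule remains.\<close>
    have 2: "h c * X (Y b) q = \<rho> c * (X (xb b) q - (c \<bullet> b) * X H q)" for b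
    proof -
      have "H * Y b = P * (xb b - (\<lambda>_. c \<bullet> b) * H)"
        using BU by (auto simp: fun_eq_iff H_def Y_def P_def xb_def ext_zero_def algebra_simps)
      then have "X (H * Y b) q = X (P * (xb b - (\<lambda>_. c \<bullet> b) * H)) q" by simp
      then show ?thesis using P H Y xb by (simp add: vf_rules[OF X] at_q algebra_simps)
    qed
    have "\<rho> c * (h c * X f q) = h c * (\<rho> c * X f q)" by simp
    also have "\<dots> = (\<Sum>b\<in>E. dir_deriv ?f b c * (h c * X (Y b) q))"
      unfolding 1 by (simp add: sum_distrib_left mult_ac)
    also have "\<dots> = \<rho> c * (\<Sum>b\<in>E. dir_deriv ?f b c * (X (xb b) q - (c \<bullet> b) * X H q))"
      unfolding 2 by (simp add: sum_distrib_left mult_ac)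
    finally have 3: "h c * X f q = (\<Sum>b\<in>E. dir_deriv ?f b c * (X (xb b) q - (c \<bullet> b) * X H q))"
      using \<rho>(2) by simp
    have "(H q)\<^sup>2 * X f q = h c * (h c * X f q)" by (simp add: at_q power2_eq_square)
    also have "\<dots> = X H q * (\<Sum>b\<in>E. D (k b) b f q) + (\<Sum>b\<in>E. X (xb b) q * D h b f q)"
      unfolding 3 using q(1,3) f
      by (simp add: D_def k_def ext_zero_def c_def sum_distrib_left sum.distrib[symmetric] algebra_simps)
    finally show ?thesis .
  qed
  show ?thesis
  proof (rule that[of "H * H" I xs e])
    show "(H * H) p \<noteq> 0" using h(2) p by (simp add: H_def ext_zero_def)
    show "xs i \<in> C" "e i \<in> \<XX>" if "i \<in> I" for i
      using that H xb eh ek by (auto simp: I_def xs_def e_def intro!: \<XX>_sum)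
    fix X assume X: "X \<in> \<XX>"
    have "smul (H * H) X f q = (\<Sum>i\<in>I. smul (X (xs i)) (e i)) f q" for f q
    proof (cases "f \<in> C")
      case True
      have "(\<Sum>i\<in>I. smul (X (xs i)) (e i)) f q = (\<Sum>i\<in>I. X (xs i) q * e i f q)"
        by (simp add: sum_fun_apply smul_def)
      also have "\<dots> = X H q * (\<Sum>b\<in>E. D (k b) b f q) + (\<Sum>b\<in>E. X (xb b) q * D h b f q)"
        unfolding I_def using E(1)
        by (subst sum.insert) (auto simp: sum.reindex xs_def e_def sum_fun_apply)
      finally show ?thesis using main[OF X True, of q] by (simp add: smul_def power2_eq_square)
    next
      case False
      have "(\<Sum>i\<in>I. X (xs i) q * e i f q) = 0"
        by (rule sum.neutral) (use False in \<open>auto simp: I_def e_def D_def sum_fun_apply\<close>)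
      then show ?thesis using vf_outside[OF X False] by (simp add: smul_def sum_fun_apply)
    qed
    then show "smul (H * H) X = (\<Sum>i\<in>I. smul (X (xs i)) (e i))" by (intro ext)
  qed (use H E(1) I_def in auto)
qed

end

section \<open>Differential forms\<close>

lemma nths_minus_single:
  "nths [a] (- {0}) = []" "nths [a, b] (- {0}) = [b]" "nths [a, b] (- {1}) = [a]"
  "nths [a, b] (- {0, 1}) = []"
  "nths [a, b, c] (- {0}) = [b, c]" "nths [a, b, c] (- {1}) = [a, c]" "nths [a, b, c] (- {2}) = [a, b]"
  "nths [a, b, c] (- {0, 1}) = [c]" "nths [a, b, c] (- {0, 2}) = [b]" "nths [a, b, c] (- {1, 2}) = [a]"
  by (simp_all add: nths_Cons)

lemma sum_lessThan_low:
  fixes f :: "nat \<Rightarrow> 'c::comm_monoid_add"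
  shows "sum f {..<1} = f 0" "sum f {..<2} = f 0 + f 1" "sum f {..<3} = f 0 + f 1 + f 2"
  by (simp_all add: numeral_2_eq_2 numeral_3_eq_3)

lemma algebroid_d_1:
  assumes "u \<in> S" shows "algebroid_d S \<rho> br \<omega> [u] = \<rho> u (\<omega> [])"
proof -
  have "length [u] = 1" by simp
  then show ?thesis unfolding algebroid_d_def
    using assms by (simp only: sum_lessThan_low nths_minus_single) (simp add: nths_minus_single)
qed

lemma algebroid_d_2:
  assumes "u \<in> S" "v \<in> S"
  shows "algebroid_d S \<rho> br \<omega> [u, v] = \<rho> u (\<omega> [v]) - \<rho> v (\<omega> [u]) - \<omega> [br u v]"
proof -
  have "length [u, v] = 2" by simp
  then show ?thesis unfolding algebroid_d_def
    using assms by (simp only: sum_lessThan_low nths_minus_single lessThan_0 sum.empty)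
      (simp add: nths_minus_single)
qed

lemma algebroid_d_3:
  assumes "u \<in> S" "v \<in> S" "w \<in> S"
  shows "algebroid_d S \<rho> br \<omega> [u, v, w] = \<rho> u (\<omega> [v, w]) - \<rho> v (\<omega> [u, w]) + \<rho> w (\<omega> [u, v])
    - \<omega> [br u v, w] + \<omega> [br u w, v] - \<omega> [br v w, u]"
proof -
  have "length [u, v, w] = 3" by simp
  then show ?thesis unfolding algebroid_d_def
    using assms by (simp only: sum_lessThan_low nths_minus_single lessThan_0 sum.empty)
      (simp add: nths_minus_single)
qed

lemma length_nths_minus:
  assumes "A \<subseteq> {..<length us}" shows "length (nths us (- A)) = length us - card A"
proof -
  have "{i. i < length us \<and> i \<in> - A} = {..<length us} - A" by auto
  then show ?thesis using assms by (simp add: length_nths card_Diff_subset finite_subset)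
qed

text \<open>Keeps the degree in \<open>forms M 1\<close> from being rewritten to
  \<open>Suc 0\<close>, so that rules about 1-forms continue to match.\<close>

declare One_nat_def [simp del]

lemma length_eq_1: "length xs = 1 \<longleftrightarrow> (\<exists>x. xs = [x])"
  by (simp add: One_nat_def length_Suc_conv)

lemma length_eq_2: "length xs = 2 \<longleftrightarrow> (\<exists>x y. xs = [x, y])"
  by (auto simp: numeral_2_eq_2 length_Suc_conv)

context smooth_mfd begin

abbreviation "\<FF> \<equiv> forms M"

lemma formI:
  assumes "\<And>Xs. \<not> (length Xs = k \<and> set Xs \<subseteq> \<XX>) \<Longrightarrow> \<omega> Xs = 0"
    and "\<And>Xs. length Xs = k \<Longrightarrow> set Xs \<subseteq> \<XX> \<Longrightarrow> \<omega> Xs \<in> C"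
    and "\<And>Xs i Y. length Xs = k \<Longrightarrow> set Xs \<subseteq> \<XX> \<Longrightarrow> i < k \<Longrightarrow> Y \<in> \<XX> \<Longrightarrow>
      \<omega> (Xs[i := Xs ! i + Y]) = \<omega> Xs + \<omega> (Xs[i := Y])"
    and "\<And>Xs i f. length Xs = k \<Longrightarrow> set Xs \<subseteq> \<XX> \<Longrightarrow> i < k \<Longrightarrow> f \<in> C \<Longrightarrow>
      \<omega> (Xs[i := smul f (Xs ! i)]) = f * \<omega> Xs"
    and "\<And>Xs. length Xs = k \<Longrightarrow> set Xs \<subseteq> \<XX> \<Longrightarrow> \<not> distinct Xs \<Longrightarrow> \<omega> Xs = 0"
  shows "\<omega> \<in> \<FF> k"
  using assms unfolding forms_def Let_def by simp

lemma
  assumes "\<omega> \<in> \<FF> k"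
  shows form_outside: "\<not> (length Xs = k \<and> set Xs \<subseteq> \<XX>) \<Longrightarrow> \<omega> Xs = 0"
    and form_C: "length Xs = k \<Longrightarrow> set Xs \<subseteq> \<XX> \<Longrightarrow> \<omega> Xs \<in> C"
    and form_add_slot: "length Xs = k \<Longrightarrow> set Xs \<subseteq> \<XX> \<Longrightarrow> i < k \<Longrightarrow> Y \<in> \<XX> \<Longrightarrow>
      \<omega> (Xs[i := Xs ! i + Y]) = \<omega> Xs + \<omega> (Xs[i := Y])"
    and form_smul_slot: "length Xs = k \<Longrightarrow> set Xs \<subseteq> \<XX> \<Longrightarrow> i < k \<Longrightarrow> f \<in> C \<Longrightarrow>
      \<omega> (Xs[i := smul f (Xs ! i)]) = f * \<omega> Xs"
    and form_alt: "length Xs = k \<Longrightarrow> set Xs \<subseteq> \<XX> \<Longrightarrow> \<not> distinct Xs \<Longrightarrow> \<omega> Xs = 0"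
  using assms unfolding forms_def Let_def by auto

lemma form_C': "\<omega> \<in> \<FF> k \<Longrightarrow> \<omega> Xs \<in> C"
  using form_C form_outside[of \<omega> k Xs] by (cases "length Xs = k \<and> set Xs \<subseteq> \<XX>") auto

lemma form_add0:
  assumes \<omega>: "\<omega> \<in> \<FF> k" and X: "X \<in> \<XX>" and Y: "Y \<in> \<XX>"
  shows "\<omega> ((X + Y) # Zs) = \<omega> (X # Zs) + \<omega> (Y # Zs)"
proof (cases "length (X # Zs) = k \<and> set Zs \<subseteq> \<XX>")
  case True
  then show ?thesis using form_add_slot[OF \<omega>, of "X # Zs" 0 Y] X Y by auto
next
  case False
  then show ?thesis using form_outside[OF \<omega>] X Y by auto
qed

lemma form_smul0:
  assumes \<omega>: "\<omega> \<in> \<FF> k" and X: "X \<in> \<XX>" and f: "f \<in> C"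
  shows "\<omega> (smul f X # Zs) = f * \<omega> (X # Zs)"
proof (cases "length (X # Zs) = k \<and> set Zs \<subseteq> \<XX>")
  case True
  then show ?thesis using form_smul_slot[OF \<omega>, of "X # Zs" 0 f] X f by auto
next
  case False
  then show ?thesis using form_outside[OF \<omega>] by auto
qed

lemma form_zero0:
  assumes "\<omega> \<in> \<FF> k" shows "\<omega> (0 # Zs) = 0"
proof -
  have "\<omega> (0 # Zs) = \<omega> ((0 + 0) # Zs)" by simp
  also have "\<dots> = \<omega> (0 # Zs) + \<omega> (0 # Zs)" by (rule form_add0[OF assms]) simp_all
  finally show ?thesis by (simp only: add_cancel_right_right)
qed

lemma form_diff0:
  assumes "\<omega> \<in> \<FF> k" "X \<in> \<XX>" "Y \<in> \<XX>"
  shows "\<omega> ((X - Y) # Zs) = \<omega> (X # Zs) - \<omega> (Y # Zs)"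
  using form_add0[OF assms(1) \<XX>_diff[OF assms(2,3)] assms(3)] by simp

lemma form_uminus0:
  assumes "\<omega> \<in> \<FF> k" "X \<in> \<XX>"
  shows "\<omega> ((- X) # Zs) = - \<omega> (X # Zs)"
  using form_diff0[OF assms(1) \<XX>_zero assms(2)] form_zero0[OF assms(1)] by simp

lemma form_sum0:
  assumes "\<omega> \<in> \<FF> k" "\<And>i. i \<in> I \<Longrightarrow> X i \<in> \<XX>"
  shows "\<omega> ((\<Sum>i\<in>I. X i) # Zs) = (\<Sum>i\<in>I. \<omega> (X i # Zs))"
  using assms(2)
proof (induction I rule: infinite_finite_induct)
  case (insert i I)
  have "\<omega> ((\<Sum>j\<in>insert i I. X j) # Zs) = \<omega> ((X i + (\<Sum>j\<in>I. X j)) # Zs)"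
    by (subst sum.insert[OF insert(1,2)]) (rule refl)
  also have "\<dots> = \<omega> (X i # Zs) + \<omega> ((\<Sum>j\<in>I. X j) # Zs)"
    by (rule form_add0[OF assms(1) insert(4) \<XX>_sum]) (use insert(4) in auto)
  also have "\<dots> = (\<Sum>j\<in>insert i I. \<omega> (X j # Zs))"
    unfolding sum.insert[OF insert(1,2)] by (subst insert(3)) (use insert(4) in auto)
  finally show ?case .
qed (simp_all add: form_zero0[OF assms(1)])

lemmas form_slot0 = form_add0 form_smul0 form_zero0 form_diff0 form_uminus0

text \<open>Polarization of \<open>\<omega> [X + Y, X + Y] = 0\<close>. Arguments that are not
  vector fields give 0 on both sides, so the rule rewrites without side conditions on
  \<open>X\<close> and \<open>Y\<close>.\<close>

lemma form2_skew:
  assumes \<omega>: "\<omega> \<in> \<FF> 2" shows "\<omega> [X, Y] = - \<omega> [Y, X]"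
proof (cases "X \<in> \<XX> \<and> Y \<in> \<XX>")
  case True
  then have X: "X \<in> \<XX>" and Y: "Y \<in> \<XX>" by auto
  have 2: "\<omega> [Z, X + Y] = \<omega> [Z, X] + \<omega> [Z, Y]" if "Z \<in> \<XX>" for Z
    using form_add_slot[OF \<omega>, of "[Z, X]" "Suc 0" Y] that X Y by simp
  have 0: "\<omega> [Z, Z] = 0" if "Z \<in> \<XX>" for Z using form_alt[OF \<omega>, of "[Z, Z]"] that by simp
  have "0 = \<omega> [X + Y, X + Y]" using 0[of "X + Y"] X Y by simp
  also have "\<dots> = \<omega> [X, Y] + \<omega> [Y, X]"
    unfolding form_add0[OF \<omega> X Y] using 2[OF X] 2[OF Y] 0[OF X] 0[OF Y] by simp
  finally show ?thesis by (simp add: eq_neg_iff_add_eq_0)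
next
  case False
  then have "\<omega> [X, Y] = 0" "\<omega> [Y, X] = 0" using form_outside[OF \<omega>] by auto
  then show ?thesis by simp
qed

lemma form2_slot1:
  assumes \<omega>: "\<omega> \<in> \<FF> 2" and X: "X \<in> \<XX>" and Y: "Y \<in> \<XX>"
  shows "\<omega> [Z, X + Y] = \<omega> [Z, X] + \<omega> [Z, Y]" "\<omega> [Z, X - Y] = \<omega> [Z, X] - \<omega> [Z, Y]"
    "f \<in> C \<Longrightarrow> \<omega> [Z, smul f X] = f * \<omega> [Z, X]"
  using assms form_slot0[OF \<omega>] by (simp_all add: form2_skew[OF \<omega>, of Z])

lemma form_add [simp]:
  assumes "\<omega> \<in> \<FF> k" "\<eta> \<in> \<FF> k" shows "\<omega> + \<eta> \<in> \<FF> k"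
proof (rule formI)
  fix Xs i Y f
  assume *: "length Xs = k" "set Xs \<subseteq> \<XX>" "i < k"
  show "(\<omega> + \<eta>) (Xs[i := Xs ! i + Y]) = (\<omega> + \<eta>) Xs + (\<omega> + \<eta>) (Xs[i := Y])" if "Y \<in> \<XX>"
    using form_add_slot[OF assms(1) * that] form_add_slot[OF assms(2) * that] by (simp add: fun_eq_iff)
  show "(\<omega> + \<eta>) (Xs[i := smul f (Xs ! i)]) = f * (\<omega> + \<eta>) Xs" if "f \<in> C"
    using form_smul_slot[OF assms(1) * that] form_smul_slot[OF assms(2) * that]
    by (simp add: fun_eq_iff distrib_left)
qed (simp_all add: form_outside[OF assms(1)] form_outside[OF assms(2)] form_C[OF assms(1)] form_C[OF assms(2)]
       form_alt[OF assms(1)] form_alt[OF assms(2)])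

lemma form_smul [simp]:
  assumes g: "g \<in> C" and \<omega>: "\<omega> \<in> \<FF> k" shows "smul g \<omega> \<in> \<FF> k"
proof (rule formI)
  fix Xs i Y f
  assume *: "length Xs = k" "set Xs \<subseteq> \<XX>" "i < k"
  show "smul g \<omega> (Xs[i := Xs ! i + Y]) = smul g \<omega> Xs + smul g \<omega> (Xs[i := Y])" if "Y \<in> \<XX>"
    using form_add_slot[OF \<omega> * that] by (simp add: smul_def[of g \<omega>] distrib_left)
  show "smul g \<omega> (Xs[i := smul f (Xs ! i)]) = f * smul g \<omega> Xs" if "f \<in> C"
    using form_smul_slot[OF \<omega> * that] by (simp add: smul_def[of g \<omega>] mult_ac)
qed (simp_all add: smul_def[of g \<omega>] g form_outside[OF \<omega>] form_C[OF \<omega>] form_alt[OF \<omega>])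

lemma form_zero [simp]: "0 \<in> \<FF> k"
  by (rule formI) simp_all

lemma form_sum: "(\<And>i. i \<in> I \<Longrightarrow> \<omega> i \<in> \<FF> k) \<Longrightarrow> (\<Sum>i\<in>I. \<omega> i) \<in> \<FF> k"
  by (induction I rule: infinite_finite_induct) auto

lemma form_uminus [simp]: assumes "\<omega> \<in> \<FF> k" shows "- \<omega> \<in> \<FF> k"
proof -
  have "- \<omega> = smul (\<lambda>_. - 1) \<omega>" by (simp add: smul_def fun_eq_iff)
  then show ?thesis using form_smul[OF C_const assms] by simp
qed

lemma form_diff [simp]: "\<omega> \<in> \<FF> k \<Longrightarrow> \<eta> \<in> \<FF> k \<Longrightarrow> \<omega> - \<eta> \<in> \<FF> k"
  using form_add[of \<omega> k "- \<eta>"] by simp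

lemma iprod_form:
  assumes \<omega>: "\<omega> \<in> \<FF> (Suc k)" and X: "X \<in> \<XX>" shows "iprod X \<omega> \<in> \<FF> k"
proof (rule formI)
  fix Xs :: "'a vfield list"
  show "iprod X \<omega> Xs = 0" if "\<not> (length Xs = k \<and> set Xs \<subseteq> \<XX>)"
    unfolding iprod_def by (rule form_outside[OF \<omega>]) (use that X in auto)
  assume Xs: "length Xs = k" "set Xs \<subseteq> \<XX>"
  show "iprod X \<omega> Xs \<in> C" unfolding iprod_def using form_C'[OF \<omega>] .
  show "iprod X \<omega> Xs = 0" if "\<not> distinct Xs"
    unfolding iprod_def by (rule form_alt[OF \<omega>]) (use that X Xs in auto)
  fix i assume i: "i < k"
  show "iprod X \<omega> (Xs[i := Xs ! i + Y]) = iprod X \<omega> Xs + iprod X \<omega> (Xs[i := Y])" if "Y \<in> \<XX>" for Y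
    using form_add_slot[OF \<omega>, of "X # Xs" "Suc i" Y] Xs X i that unfolding iprod_def by simp
  show "iprod X \<omega> (Xs[i := smul f (Xs ! i)]) = f * iprod X \<omega> Xs" if "f \<in> C" for f
    using form_smul_slot[OF \<omega>, of "X # Xs" "Suc i" f] Xs X i that unfolding iprod_def by simp
qed

lemma form1I:
  assumes "\<And>Xs. (\<And>X. X \<in> \<XX> \<Longrightarrow> Xs \<noteq> [X]) \<Longrightarrow> \<alpha> Xs = 0"
    and "\<And>X. X \<in> \<XX> \<Longrightarrow> \<alpha> [X] \<in> C"
    and "\<And>X Y. X \<in> \<XX> \<Longrightarrow> Y \<in> \<XX> \<Longrightarrow> \<alpha> [X + Y] = \<alpha> [X] + \<alpha> [Y]"
    and "\<And>f X. f \<in> C \<Longrightarrow> X \<in> \<XX> \<Longrightarrow> \<alpha> [smul f X] = f * \<alpha> [X]"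
  shows "\<alpha> \<in> \<FF> 1"
proof (rule formI)
  show "\<alpha> Xs = 0" if "\<not> (length Xs = 1 \<and> set Xs \<subseteq> \<XX>)" for Xs
    by (rule assms(1)) (use that in \<open>auto simp: length_eq_1\<close>)
qed (use assms(2-4) in \<open>auto simp: length_eq_1\<close>)

text \<open>Skewness carries additivity and homogeneity from the second slot to the first, and it
  implies vanishing on equal arguments, as a real number equal to its negative is 0.\<close>

lemma form2I:
  assumes "\<And>Xs. (\<And>X Y. X \<in> \<XX> \<Longrightarrow> Y \<in> \<XX> \<Longrightarrow> Xs \<noteq> [X, Y]) \<Longrightarrow> \<omega> Xs = 0"
    and "\<And>X Y. X \<in> \<XX> \<Longrightarrow> Y \<in> \<XX> \<Longrightarrow> \<omega> [X, Y] \<in> C"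
    and skew: "\<And>X Y. X \<in> \<XX> \<Longrightarrow> Y \<in> \<XX> \<Longrightarrow> \<omega> [Y, X] = - \<omega> [X, Y]"
    and add: "\<And>X Y Z. X \<in> \<XX> \<Longrightarrow> Y \<in> \<XX> \<Longrightarrow> Z \<in> \<XX> \<Longrightarrow> \<omega> [Z, X + Y] = \<omega> [Z, X] + \<omega> [Z, Y]"
    and smul: "\<And>f X Z. f \<in> C \<Longrightarrow> X \<in> \<XX> \<Longrightarrow> Z \<in> \<XX> \<Longrightarrow> \<omega> [Z, smul f X] = f * \<omega> [Z, X]"
  shows "\<omega> \<in> \<FF> 2"
proof (rule formI)
  show "\<omega> Xs = 0" if "\<not> (length Xs = 2 \<and> set Xs \<subseteq> \<XX>)" for Xs
    by (rule assms(1)) (use that in auto)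
next
  have add': "\<omega> [X + Y, Z] = \<omega> [X, Z] + \<omega> [Y, Z]" if "X \<in> \<XX>" "Y \<in> \<XX>" "Z \<in> \<XX>" for X Y Z
    using that skew[of Z] add[of X Y Z] by simp
  have smul': "\<omega> [smul f X, Z] = f * \<omega> [X, Z]" if "f \<in> C" "X \<in> \<XX>" "Z \<in> \<XX>" for f X Z
    using that skew[of Z] smul[of f X Z] by simp
  have alt: "\<omega> [X, X] = 0" if "X \<in> \<XX>" for X
    using skew[OF that that] by (simp add: fun_eq_iff)
  fix Xs :: "'a vfield list"
  assume "length Xs = 2" "set Xs \<subseteq> \<XX>"
  then obtain X Y where Xs: "Xs = [X, Y]" "X \<in> \<XX>" "Y \<in> \<XX>"
    by (auto simp: length_eq_2)
  show "\<omega> Xs \<in> C" using Xs assms(2) by simp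
  show "\<omega> Xs = 0" if "\<not> distinct Xs" using Xs alt that by auto
  fix i :: nat assume "i < 2"
  then have i: "i = 0 \<or> i = Suc 0" by auto
  show "\<omega> (Xs[i := Xs ! i + Z]) = \<omega> Xs + \<omega> (Xs[i := Z])" if "Z \<in> \<XX>" for Z
    using i Xs add add' that by auto
  show "\<omega> (Xs[i := smul f (Xs ! i)]) = f * \<omega> Xs" if "f \<in> C" for f
    using i Xs smul smul' that by auto
qed

lemma form1_cases_eq:
  assumes "\<alpha> \<in> \<FF> 1" "\<beta> \<in> \<FF> 1" "\<And>X. X \<in> \<XX> \<Longrightarrow> \<alpha> [X] = \<beta> [X]"
  shows "\<alpha> = \<beta>"
proof
  fix Xs show "\<alpha> Xs = \<beta> Xs"
  proof (cases "length Xs = 1 \<and> set Xs \<subseteq> \<XX>")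
    case True
    then obtain X where "Xs = [X]" "X \<in> \<XX>" by (auto simp: length_eq_1)
    then show ?thesis using assms(3) by simp
  next
    case False
    then show ?thesis using form_outside[OF assms(1) False] form_outside[OF assms(2) False] by simp
  qed
qed

lemma form0_form: "f \<in> C \<Longrightarrow> form0 f \<in> \<FF> 0"
  by (rule formI) (auto simp: form0_def)

section \<open>Differentials given by an anchor and a skew bracket\<close>

lemma algebroid_d_outside:
  assumes \<omega>: "\<omega> \<in> \<FF> k" and \<rho>: "\<And>X. X \<in> \<XX> \<Longrightarrow> \<rho> X \<in> \<XX>"
    and Xs: "\<not> (length Xs = Suc k \<and> set Xs \<subseteq> \<XX>)"
  shows "algebroid_d \<XX> \<rho> br \<omega> Xs = 0"
proof (cases "set Xs \<subseteq> \<XX>")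
  case False
  then show ?thesis by (simp add: algebroid_d_def)
next
  case True
  then have n: "length Xs \<noteq> Suc k" using Xs by simp
  have 1: "\<rho> (Xs ! i) (\<omega> (nths Xs (- {i}))) = 0" if i: "i < length Xs" for i
  proof -
    have "length (nths Xs (- {i})) \<noteq> k" using i n length_nths_minus[of "{i}" Xs] by auto
    then have "\<omega> (nths Xs (- {i})) = 0" by (intro form_outside[OF \<omega>]) simp
    moreover have "\<rho> (Xs ! i) \<in> \<XX>" using True i by (intro \<rho>) auto
    ultimately show ?thesis using vf_zero[of "\<rho> (Xs ! i)"] by simp
  qed
  have 2: "\<omega> (br (Xs ! i) (Xs ! j) # nths Xs (- {i, j})) = 0" if "i < j" "j < length Xs" for i j
  proof -
    have "Suc (length (nths Xs (- {i, j}))) \<noteq> k" using that n length_nths_minus[of "{i, j}" Xs] by auto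
    then show ?thesis by (intro form_outside[OF \<omega>]) simp
  qed
  show ?thesis unfolding algebroid_d_def using 1 2 by simp
qed

lemma lie_bracket_vf [simp]:
  assumes X: "X \<in> \<XX>" and Y: "Y \<in> \<XX>" shows "lie_bracket X Y \<in> \<XX>"
  unfolding lie_bracket_def
  by (rule vfI) (simp_all add: vf_rules[OF X] vf_rules[OF Y] algebra_simps)

lemma lie_bracket_skew: "lie_bracket X Y = - lie_bracket Y X"
  by (simp add: lie_bracket_def fun_eq_iff)

lemma lie_bracket_add:
  assumes X: "X \<in> \<XX>" and Y: "Y \<in> \<XX>" and Z: "Z \<in> \<XX>"
  shows "lie_bracket X (Y + Z) = lie_bracket X Y + lie_bracket X Z"
proof
  fix f show "lie_bracket X (Y + Z) f = (lie_bracket X Y + lie_bracket X Z) f"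
    by (cases "f \<in> C") (simp_all add: lie_bracket_def vf_rules[OF X] vf_rules[OF Y] vf_rules[OF Z] algebra_simps)
qed

lemma lie_bracket_smul:
  assumes X: "X \<in> \<XX>" and Y: "Y \<in> \<XX>" and f: "f \<in> C"
  shows "lie_bracket X (smul f Y) = smul f (lie_bracket X Y) + smul (X f) Y"
proof
  fix g show "lie_bracket X (smul f Y) g = (smul f (lie_bracket X Y) + smul (X f) Y) g"
    by (cases "g \<in> C") (simp_all add: lie_bracket_def smul_def vf_rules[OF X] vf_rules[OF Y] f algebra_simps)
qed

lemma form0_Nil [simp]: "form0 f [] = f"
  by (simp add: form0_def)

lemma algebroid_d_form0:
  assumes \<rho>: "\<And>X. X \<in> \<XX> \<Longrightarrow> \<rho> X \<in> \<XX>"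
    and \<rho>_add: "\<And>X Y. X \<in> \<XX> \<Longrightarrow> Y \<in> \<XX> \<Longrightarrow> \<rho> (X + Y) = \<rho> X + \<rho> Y"
    and \<rho>_smul: "\<And>f X. f \<in> C \<Longrightarrow> X \<in> \<XX> \<Longrightarrow> \<rho> (smul f X) = smul f (\<rho> X)"
    and f: "f \<in> C"
  shows "algebroid_d \<XX> \<rho> br (form0 f) \<in> \<FF> 1"
proof (rule form1I)
  have *: "algebroid_d \<XX> \<rho> br (form0 f) [X] = \<rho> X f" if "X \<in> \<XX>" for X
    using algebroid_d_1[OF that, of \<rho> br "form0 f"] by simp
  fix X assume X: "X \<in> \<XX>"
  show "algebroid_d \<XX> \<rho> br (form0 f) [X] \<in> C" using * X vf_C[OF \<rho>] f by simp
  show "algebroid_d \<XX> \<rho> br (form0 f) [X + Y] = algebroid_d \<XX> \<rho> br (form0 f) [X] + algebroid_d \<XX> \<rho> br (form0 f) [Y]"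
    if "Y \<in> \<XX>" for Y using * X that \<rho>_add by simp
  show "algebroid_d \<XX> \<rho> br (form0 f) [smul g X] = g * algebroid_d \<XX> \<rho> br (form0 f) [X]"
    if "g \<in> C" for g using * X that \<rho>_smul by (simp add: smul_def[of g "\<rho> X"])
next
  fix Xs :: "'a vfield list" assume "\<And>X. X \<in> \<XX> \<Longrightarrow> Xs \<noteq> [X]"
  then have "\<not> (length Xs = Suc 0 \<and> set Xs \<subseteq> \<XX>)"
    unfolding length_Suc_conv length_0_conv by (metis insert_subset list.simps(15))
  then show "algebroid_d \<XX> \<rho> br (form0 f) Xs = 0"
    by (intro algebroid_d_outside[OF form0_form[OF f]] \<rho>)
qed

text \<open>Tensoriality comes from skewness and the Leibniz rule of the bracket. This form covers
  \<open>bracket_tensor N\<close>, which may fail the Jacobi identity when \<open>N\<close> has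
  torsion.\<close>

lemma algebroid_d_form1:
  assumes \<rho>: "\<And>X. X \<in> \<XX> \<Longrightarrow> \<rho> X \<in> \<XX>"
    and \<rho>_add: "\<And>X Y. X \<in> \<XX> \<Longrightarrow> Y \<in> \<XX> \<Longrightarrow> \<rho> (X + Y) = \<rho> X + \<rho> Y"
    and \<rho>_smul: "\<And>f X. f \<in> C \<Longrightarrow> X \<in> \<XX> \<Longrightarrow> \<rho> (smul f X) = smul f (\<rho> X)"
    and br: "\<And>X Y. X \<in> \<XX> \<Longrightarrow> Y \<in> \<XX> \<Longrightarrow> br X Y \<in> \<XX>"
    and br_skew: "\<And>X Y. X \<in> \<XX> \<Longrightarrow> Y \<in> \<XX> \<Longrightarrow> br Y X = - br X Y"
    and br_add: "\<And>X Y Z. X \<in> \<XX> \<Longrightarrow> Y \<in> \<XX> \<Longrightarrow> Z \<in> \<XX> \<Longrightarrow> br X (Y + Z) = br X Y + br X Z"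
    and br_smul: "\<And>f X Y. f \<in> C \<Longrightarrow> X \<in> \<XX> \<Longrightarrow> Y \<in> \<XX> \<Longrightarrow>
      br X (smul f Y) = smul f (br X Y) + smul (\<rho> X f) Y"
    and \<alpha>: "\<alpha> \<in> \<FF> 1"
  shows "algebroid_d \<XX> \<rho> br \<alpha> \<in> \<FF> 2"
proof (rule form2I)
  note [simp] = vf_rules[OF \<rho>] form_slot0[OF \<alpha>] form_C'[OF \<alpha>] \<rho> br
  fix X Y assume X: "X \<in> \<XX>" and Y: "Y \<in> \<XX>"
  show "algebroid_d \<XX> \<rho> br \<alpha> [X, Y] \<in> C" using X Y by (simp add: algebroid_d_2)
  show "algebroid_d \<XX> \<rho> br \<alpha> [Y, X] = - algebroid_d \<XX> \<rho> br \<alpha> [X, Y]"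
    using X Y by (simp add: algebroid_d_2 br_skew[OF X Y])
  fix Z assume Z: "Z \<in> \<XX>"
  show "algebroid_d \<XX> \<rho> br \<alpha> [Z, X + Y] = algebroid_d \<XX> \<rho> br \<alpha> [Z, X] + algebroid_d \<XX> \<rho> br \<alpha> [Z, Y]"
    using X Y Z by (simp add: algebroid_d_2 \<rho>_add br_add)
next
  note [simp] = vf_rules[OF \<rho>] form_slot0[OF \<alpha>] form_C'[OF \<alpha>] \<rho> br
  fix f X Z assume f: "f \<in> C" and X: "X \<in> \<XX>" and Z: "Z \<in> \<XX>"
  show "algebroid_d \<XX> \<rho> br \<alpha> [Z, smul f X] = f * algebroid_d \<XX> \<rho> br \<alpha> [Z, X]"
    using f X Z by (simp add: algebroid_d_2 \<rho>_smul br_smul smul_def[of f "\<rho> X"] algebra_simps)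
next
  fix Xs :: "'a vfield list" assume "\<And>X Y. X \<in> \<XX> \<Longrightarrow> Y \<in> \<XX> \<Longrightarrow> Xs \<noteq> [X, Y]"
  then have "\<not> (length Xs = 2 \<and> set Xs \<subseteq> \<XX>)"
    unfolding length_eq_2 by (metis insert_subset list.simps(15))
  then show "algebroid_d \<XX> \<rho> br \<alpha> Xs = 0"
    using algebroid_d_outside[OF \<alpha> \<rho>] by (simp add: numeral_2_eq_2 One_nat_def)
qed

section \<open>Exact 1-forms and the duality between vector fields and 1-forms\<close>

abbreviation D0 :: "'a scalar \<Rightarrow> 'a form" where "D0 f \<equiv> ext_d M (form0 f)"

lemma D0_form [simp]: "f \<in> C \<Longrightarrow> D0 f \<in> \<FF> 1"
  unfolding ext_d_def by (rule algebroid_d_form0) auto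

lemma D0_eval: "X \<in> \<XX> \<Longrightarrow> D0 f [X] = X f"
  unfolding ext_d_def by (subst algebroid_d_1) simp_all

text \<open>Exact 1-forms already separate fields, as \<open>D0 f [X] = X f\<close>. This turns
  identities of vector fields into identities tested against a 1-form.\<close>

lemma vf_eqI:
  assumes X: "X \<in> \<XX>" and Y: "Y \<in> \<XX>" and eq: "\<And>\<beta>. \<beta> \<in> \<FF> 1 \<Longrightarrow> \<beta> [X] = \<beta> [Y]"
  shows "X = Y"
proof
  fix f show "X f = Y f"
  proof (cases "f \<in> C")
    case True
    then show ?thesis using eq[OF D0_form[OF True]] X Y by (simp add: D0_eval)
  qed (simp add: vf_outside[OF X] vf_outside[OF Y])
qed

lemma D0_add:
  assumes "f \<in> C" "g \<in> C" shows "D0 (f + g) = D0 f + D0 g"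
proof (rule form1_cases_eq)
  show "D0 (f + g) [X] = (D0 f + D0 g) [X]" if X: "X \<in> \<XX>" for X
    using assms by (simp add: D0_eval[OF X] vf_rules[OF X])
qed (use assms in simp_all)

lemma D0_mult:
  assumes "f \<in> C" "g \<in> C" shows "D0 (f * g) = smul f (D0 g) + smul g (D0 f)"
proof (rule form1_cases_eq)
  show "D0 (f * g) [X] = (smul f (D0 g) + smul g (D0 f)) [X]" if X: "X \<in> \<XX>" for X
    using assms by (simp add: D0_eval[OF X] vf_rules[OF X] smul_def)
qed (use assms in simp_all)

lemma D0_scale:
  assumes "f \<in> C" shows "D0 ((\<lambda>_. c) * f) = smul (\<lambda>_. c) (D0 f)"
proof (rule form1_cases_eq)
  show "D0 ((\<lambda>_. c) * f) [X] = smul (\<lambda>_. c) (D0 f) [X]" if X: "X \<in> \<XX>" for X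
    using assms by (simp add: D0_eval[OF X] vf_rules[OF X] smul_def)
qed (use assms in simp_all)

text \<open>A representing field is forced by its values on exact forms, so the candidate is f
  \<mapsto> \<open>F (D0 f)\<close>. That it represents \<open>F\<close> on all 1-forms is checked
  point by point: for each p, a local frame writes some multiple w \<beta> with w(p) \<noteq> 0 as a
  finite combination of exact forms; linearity of \<open>F\<close> over smooth functions applies,
  and w(p) is divided out.\<close>

lemma vector_field_of:
  assumes FC: "\<And>\<beta>. \<beta> \<in> \<FF> 1 \<Longrightarrow> F \<beta> \<in> C"
    and F_add: "\<And>\<beta> \<gamma>. \<beta> \<in> \<FF> 1 \<Longrightarrow> \<gamma> \<in> \<FF> 1 \<Longrightarrow> F (\<beta> + \<gamma>) = F \<beta> + F \<gamma>"
    and F_smul: "\<And>f \<beta>. f \<in> C \<Longrightarrow> \<beta> \<in> \<FF> 1 \<Longrightarrow> F (smul f \<beta>) = f * F \<beta>"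
  shows "vector_field_of M F \<in> \<XX>" and "\<And>\<beta>. \<beta> \<in> \<FF> 1 \<Longrightarrow> \<beta> [vector_field_of M F] = F \<beta>"
proof -
  define X where "X f = (if f \<in> C then F (D0 f) else 0)" for f
  have X: "X \<in> \<XX>"
  proof (rule vfI)
    show "X ((\<lambda>_. c) * f) = (\<lambda>_. c) * X f" if "f \<in> C" for f c
      using that by (simp add: X_def D0_scale F_smul)
  qed (simp_all add: X_def FC D0_add D0_mult F_add F_smul)
  have F_sum: "F (\<Sum>i\<in>I. \<beta> i) = (\<Sum>i\<in>I. F (\<beta> i))" if "finite I" "\<And>i. i \<in> I \<Longrightarrow> \<beta> i \<in> \<FF> 1"
    for I :: "'e option set" and \<beta>
    using that
  proof (induction I)
    case empty
    have "smul 0 0 = (0 :: 'a form)" by (simp add: smul_def fun_eq_iff)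
    moreover have "F (smul 0 0) = 0 * F 0" by (rule F_smul) simp_all
    ultimately show ?case by (simp only: sum.empty mult_zero_left)
  next
    case (insert i I)
    then have "F (\<beta> i + (\<Sum>j\<in>I. \<beta> j)) = F (\<beta> i) + F (\<Sum>j\<in>I. \<beta> j)"
      by (intro F_add form_sum) auto
    moreover have "F (\<Sum>j\<in>I. \<beta> j) = (\<Sum>j\<in>I. F (\<beta> j))"
      using insert by (intro insert(3)) auto
    ultimately show ?case unfolding sum.insert[OF insert(1,2)] by metis
  qed
  have "\<beta> [X] = F \<beta>" if \<beta>: "\<beta> \<in> \<FF> 1" for \<beta>
  proof
    fix p
    obtain w and I :: "'e option set" and xs e where fr: "w \<in> C" "w p \<noteq> 0" "finite I"
      "\<And>i. i \<in> I \<Longrightarrow> xs i \<in> C" "\<And>i. i \<in> I \<Longrightarrow> e i \<in> \<XX>"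
      "\<And>X. X \<in> \<XX> \<Longrightarrow> smul w X = (\<Sum>i\<in>I. smul (X (xs i)) (e i))"
      using ex_local_frame[of p] by blast
    have exp: "w * \<beta> [Y] = (\<Sum>i\<in>I. Y (xs i) * \<beta> [e i])" if Y: "Y \<in> \<XX>" for Y
    proof -
      have "w * \<beta> [Y] = \<beta> [smul w Y]" using form_smul0[OF \<beta> Y fr(1)] by simp
      also have "\<dots> = (\<Sum>i\<in>I. \<beta> [smul (Y (xs i)) (e i)])"
        unfolding fr(6)[OF Y] by (rule form_sum0[OF \<beta>]) (simp add: fr vf_C[OF Y])
      also have "\<dots> = (\<Sum>i\<in>I. Y (xs i) * \<beta> [e i])"
        by (rule sum.cong) (simp_all add: form_smul0[OF \<beta>] fr vf_C[OF Y])
      finally show ?thesis .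
    qed
    have "smul w \<beta> = (\<Sum>i\<in>I. smul (\<beta> [e i]) (D0 (xs i)))"
    proof (rule form1_cases_eq)
      show "(\<Sum>i\<in>I. smul (\<beta> [e i]) (D0 (xs i))) \<in> \<FF> 1"
        by (rule form_sum) (simp add: fr form_C'[OF \<beta>])
      show "smul w \<beta> [Y] = (\<Sum>i\<in>I. smul (\<beta> [e i]) (D0 (xs i))) [Y]" if Y: "Y \<in> \<XX>" for Y
        using exp[OF Y] by (simp add: smul_def sum_fun_apply D0_eval[OF Y] mult.commute)
    qed (simp add: fr \<beta>)
    then have "w * F \<beta> = F (\<Sum>i\<in>I. smul (\<beta> [e i]) (D0 (xs i)))"
      using F_smul[OF fr(1) \<beta>] by simp
    also have "\<dots> = (\<Sum>i\<in>I. F (smul (\<beta> [e i]) (D0 (xs i))))"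
      by (rule F_sum[OF fr(3)]) (simp add: fr form_C'[OF \<beta>])
    also have "\<dots> = (\<Sum>i\<in>I. X (xs i) * \<beta> [e i])"
      by (rule sum.cong) (simp_all add: fr F_smul form_C'[OF \<beta>] X_def mult.commute)
    also have "\<dots> = w * \<beta> [X]" using exp[OF X] by simp
    finally have "w p * F \<beta> p = w p * \<beta> [X] p" by (metis times_fun_apply)
    then show "\<beta> [X] p = F \<beta> p" using fr(2) by simp
  qed
  then have "X \<in> \<XX> \<and> (\<forall>\<beta>\<in>\<FF> 1. pairing \<beta> X = F \<beta>)" using X by (simp add: pairing_def)
  note * = this
  have "Y = X" if "Y \<in> \<XX> \<and> (\<forall>\<beta>\<in>\<FF> 1. pairing \<beta> Y = F \<beta>)" for Y
    using that * by (intro vf_eqI) (auto simp: pairing_def)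
  with * have "vector_field_of M F \<in> \<XX> \<and> (\<forall>\<beta>\<in>\<FF> 1. pairing \<beta> (vector_field_of M F) = F \<beta>)"
    unfolding vector_field_of_def
    by (rule theI[of "\<lambda>X. X \<in> \<XX> \<and> (\<forall>\<beta>\<in>\<FF> 1. pairing \<beta> X = F \<beta>)" X])
  then show "vector_field_of M F \<in> \<XX>" "\<And>\<beta>. \<beta> \<in> \<FF> 1 \<Longrightarrow> \<beta> [vector_field_of M F] = F \<beta>"
    by (auto simp: pairing_def)
qed

end

section \<open>The operator \<open>d_tensor\<close> as a differential with anchor N and bracket
  [X,Y]_N\<close>

lemma nths_list_update_notin: "m \<notin> A \<Longrightarrow> nths (xs[m := y]) A = nths xs A"
proof (induction xs arbitrary: m A)
  case (Cons x xs)
  then show ?case by (cases m) (simp_all add: nths_Cons)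
qed simp

text \<open>Reindexes the sum in \<open>i_tensor\<close> over a sublist by positions of the full
  list, so that terms of i_N d and d i_N can be compared index by index.\<close>

lemma sum_nths_list_update:
  fixes F :: "'b list \<Rightarrow> 'c::comm_monoid_add"
  shows "(\<Sum>m\<in>{..<length xs} \<inter> A. F (nths (xs[m := g (xs ! m)]) A)) =
    (\<Sum>l<length (nths xs A). F ((nths xs A)[l := g (nths xs A ! l)]))"
proof (induction xs arbitrary: A F)
  case (Cons x xs)
  let ?A = "{j. Suc j \<in> A}"
  have S: "{..<length (x # xs)} \<inter> A = ({0} \<inter> A) \<union> Suc ` ({..<length xs} \<inter> ?A)"
    by (auto simp: less_Suc_eq_0_disj)
  have "(\<Sum>m\<in>{..<length (x # xs)} \<inter> A. F (nths ((x # xs)[m := g ((x # xs) ! m)]) A)) =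
      (\<Sum>m\<in>{0} \<inter> A. F (nths ((x # xs)[m := g ((x # xs) ! m)]) A)) +
      (\<Sum>m\<in>{..<length xs} \<inter> ?A. F ((if 0 \<in> A then [x] else []) @ nths (xs[m := g (xs ! m)]) ?A))"
    unfolding S by (subst sum.union_disjoint) (auto simp: sum.reindex nths_Cons)
  also have "(\<Sum>m\<in>{0} \<inter> A. F (nths ((x # xs)[m := g ((x # xs) ! m)]) A)) =
      (if 0 \<in> A then F (g x # nths xs ?A) else 0)"
    by (simp add: nths_Cons)
  also have "(\<Sum>m\<in>{..<length xs} \<inter> ?A. F ((if 0 \<in> A then [x] else []) @ nths (xs[m := g (xs ! m)]) ?A)) =
      (\<Sum>l<length (nths xs ?A). F ((if 0 \<in> A then [x] else []) @ (nths xs ?A)[l := g (nths xs ?A ! l)]))"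
    using Cons.IH[of "\<lambda>ys. F ((if 0 \<in> A then [x] else []) @ ys)" ?A] .
  also have "(if 0 \<in> A then F (g x # nths xs ?A) else 0) +
      (\<Sum>l<length (nths xs ?A). F ((if 0 \<in> A then [x] else []) @ (nths xs ?A)[l := g (nths xs ?A ! l)])) = (\<Sum>l<length (nths (x # xs) A). F ((nths (x # xs) A)[l := g (nths (x # xs) A ! l)]))"
    by (simp add: nths_Cons sum.lessThan_Suc_shift del: sum.lessThan_Suc)
  finally show ?case .
qed simp

context smooth_mfd begin

lemma
  assumes "N \<in> tensor11 M"
  shows tensor11_vf: "X \<in> \<XX> \<Longrightarrow> N X \<in> \<XX>"
    and tensor11_add: "X \<in> \<XX> \<Longrightarrow> Y \<in> \<XX> \<Longrightarrow> N (X + Y) = N X + N Y"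
    and tensor11_smul: "f \<in> C \<Longrightarrow> X \<in> \<XX> \<Longrightarrow> N (smul f X) = smul f (N X)"
  using assms unfolding tensor11_def Let_def by auto

lemma tensor11_uminus:
  assumes N: "N \<in> tensor11 M" and X: "X \<in> \<XX>" shows "N (- X) = - N X"
proof -
  have "- Y = smul (\<lambda>_. - 1) Y" for Y :: "'a vfield" by (simp add: smul_def fun_eq_iff)
  then show ?thesis using tensor11_smul[OF N C_const X, of "- 1"] by metis
qed

lemma bracket_tensor_vf:
  assumes N: "N \<in> tensor11 M" and X: "X \<in> \<XX>" and Y: "Y \<in> \<XX>"
  shows "bracket_tensor N X Y \<in> \<XX>"
  unfolding bracket_tensor_def using tensor11_vf[OF N] X Y by simp

lemma i_tensor_Cons:
  assumes N: "N \<in> tensor11 M" and Z: "Z \<in> \<XX>" and zs: "set zs \<subseteq> \<XX>"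
  shows "i_tensor M N \<omega> (Z # zs) = \<omega> (N Z # zs) + (\<Sum>l<length zs. \<omega> (Z # zs[l := N (zs ! l)]))"
  unfolding i_tensor_def using Z zs by (simp add: sum.lessThan_Suc_shift del: sum.lessThan_Suc)

lemma i_tensor_nths:
  assumes Xs: "set Xs \<subseteq> \<XX>"
  shows "i_tensor M N \<omega> (nths Xs A) = (\<Sum>m\<in>{..<length Xs} \<inter> A. \<omega> (nths (Xs[m := N (Xs ! m)]) A))"
proof -
  have "set (nths Xs A) \<subseteq> \<XX>" using Xs set_nths_subset by fast
  then show ?thesis unfolding i_tensor_def sum_nths_list_update by (rule if_P)
qed

text \<open>In i_N d the tensor hits every argument, in d i_N only those that are left for \<psi>.
  The terms common to both cancel; what survives has \<open>N\<close> in the anchor or inside and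
  around the Lie bracket.\<close>

lemma d_tensor_eq:
  assumes N: "N \<in> tensor11 M" and \<psi>: "\<psi> \<in> \<FF> k"
  shows "d_tensor M N \<psi> = algebroid_d \<XX> N (bracket_tensor N) \<psi>"
proof
  fix Xs
  show "d_tensor M N \<psi> Xs = algebroid_d \<XX> N (bracket_tensor N) \<psi> Xs"
  proof (cases "set Xs \<subseteq> \<XX>")
    case False
    then show ?thesis by (simp add: d_tensor_def ext_d_def i_tensor_def algebroid_d_def)
  next
    case Xs: True
    define n where "n = length Xs"
    define Y where "Y m = Xs[m := N (Xs ! m)]" for m
    have x: "Xs ! i \<in> \<XX>" if "i < n" for i using Xs that unfolding n_def by auto
    have Y: "set (Y m) \<subseteq> \<XX>" if "m < n" for m
      unfolding Y_def using Xs tensor11_vf[OF N x[OF that]] set_update_subset_insert[of Xs m] by fast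
    have nY: "length (Y m) = n" for m by (simp add: Y_def n_def)
    have Yi: "Y m ! i = (if m = i then N (Xs ! i) else Xs ! i)" if "i < n" for m i
      using that by (auto simp: Y_def n_def nth_list_update)
    \<comment> \<open>\<open>a i\<close> and \<open>b i j\<close> are the coefficients of
      \<open>(-1) ^ i\<close> and \<open>(-1) ^ (i + j)\<close> in the difference; \<open>m\<close>
      is the position at which \<open>N\<close> is applied.\<close>
    define a where "a i = (\<Sum>m<n. (Y m ! i) (\<psi> (nths (Y m) (- {i})))) - (Xs ! i) (i_tensor M N \<psi> (nths Xs (- {i})))" for i
    define b where "b i j = (\<Sum>m<n. \<psi> (lie_bracket (Y m ! i) (Y m ! j) # nths (Y m) (- {i, j})))
        - i_tensor M N \<psi> (lie_bracket (Xs ! i) (Xs ! j) # nths Xs (- {i, j}))" for i j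
    \<comment> \<open>Only \<open>m = i\<close> puts \<open>N\<close> into the derivation; the other
      \<open>m\<close> cancel against \<open>i_tensor\<close> of the shortened list.\<close>
    have A: "a i = N (Xs ! i) (\<psi> (nths Xs (- {i})))" if i: "i < n" for i
    proof -
      have "(\<Sum>m<n. (Y m ! i) (\<psi> (nths (Y m) (- {i})))) =
          (Y i ! i) (\<psi> (nths (Y i) (- {i}))) + (\<Sum>m\<in>{..<n} - {i}. (Y m ! i) (\<psi> (nths (Y m) (- {i}))))"
        by (rule sum.remove) (use i in auto)
      also have "(Y i ! i) (\<psi> (nths (Y i) (- {i}))) = N (Xs ! i) (\<psi> (nths Xs (- {i})))"
        unfolding Yi[OF i] unfolding Y_def by (subst nths_list_update_notin) simp_all
      also have "(\<Sum>m\<in>{..<n} - {i}. (Y m ! i) (\<psi> (nths (Y m) (- {i})))) =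
          (\<Sum>m\<in>{..<n} - {i}. (Xs ! i) (\<psi> (nths (Y m) (- {i}))))"
        by (rule sum.cong) (auto simp: Yi[OF i])
      also have "\<dots> = (Xs ! i) (\<Sum>m\<in>{..<n} - {i}. \<psi> (nths (Y m) (- {i})))"
        by (rule vf_sum[OF x[OF i], symmetric]) (rule form_C'[OF \<psi>])
      also have "(\<Sum>m\<in>{..<n} - {i}. \<psi> (nths (Y m) (- {i}))) = i_tensor M N \<psi> (nths Xs (- {i}))"
        unfolding i_tensor_nths[OF Xs] n_def Y_def Diff_eq ..
      finally have fin: "(\<Sum>m<n. (Y m ! i) (\<psi> (nths (Y m) (- {i})))) = N (Xs ! i) (\<psi> (nths Xs (- {i}))) +
          (Xs ! i) (i_tensor M N \<psi> (nths Xs (- {i})))" .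
      show ?thesis unfolding a_def fin by (rule add_diff_cancel_right')
    qed
    \<comment> \<open>The positions \<open>m = i\<close> and \<open>m = j\<close> put
      \<open>N\<close> inside the bracket, and the leading slot of \<open>i_tensor\<close> gives the
      term with \<open>N\<close> outside; together they form \<open>bracket_tensor\<close>. All
      other \<open>m\<close> cancel.\<close>
    have B: "b i j = \<psi> (bracket_tensor N (Xs ! i) (Xs ! j) # nths Xs (- {i, j}))" if ij: "i < j" "j < n" for i j
    proof -
      have i: "i < n" using ij by simp
      note j = ij(2)
      let ?zs = "nths Xs (- {i, j})"
      let ?t = "\<lambda>m. \<psi> (lie_bracket (Y m ! i) (Y m ! j) # nths (Y m) (- {i, j}))"
      let ?Z = "lie_bracket (Xs ! i) (Xs ! j)"
      have zs: "set ?zs \<subseteq> \<XX>" using Xs set_nths_subset by fast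
      have Z: "?Z \<in> \<XX>" using x i j by simp
      have "(\<Sum>m<n. ?t m) = ?t i + (\<Sum>m\<in>{..<n} - {i}. ?t m)"
        by (rule sum.remove) (use i in auto)
      also have "(\<Sum>m\<in>{..<n} - {i}. ?t m) = ?t j + (\<Sum>m\<in>{..<n} - {i} - {j}. ?t m)"
        by (rule sum.remove) (use ij in auto)
      also have "?t i = \<psi> (lie_bracket (N (Xs ! i)) (Xs ! j) # ?zs)"
        using ij unfolding Yi[OF i] Yi[OF j] unfolding Y_def by (subst nths_list_update_notin) simp_all
      also have "?t j = \<psi> (lie_bracket (Xs ! i) (N (Xs ! j)) # ?zs)"
        using ij unfolding Yi[OF i] Yi[OF j] unfolding Y_def by (subst nths_list_update_notin) simp_all
      also have "{..<n} - {i} - {j} = {..<length Xs} \<inter> - {i, j}" unfolding n_def by auto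
      also have "(\<Sum>m\<in>{..<length Xs} \<inter> - {i, j}. ?t m) =
          (\<Sum>m\<in>{..<length Xs} \<inter> - {i, j}. \<psi> (?Z # nths (Xs[m := N (Xs ! m)]) (- {i, j})))"
        by (rule sum.cong) (auto simp: Yi[OF i] Yi[OF j] Y_def)
      also have "\<dots> = (\<Sum>l<length ?zs. \<psi> (?Z # ?zs[l := N (?zs ! l)]))"
        by (rule sum_nths_list_update)
      finally have 1: "(\<Sum>m<n. ?t m) = \<psi> (lie_bracket (N (Xs ! i)) (Xs ! j) # ?zs) +
        (\<psi> (lie_bracket (Xs ! i) (N (Xs ! j)) # ?zs) + (\<Sum>l<length ?zs. \<psi> (?Z # ?zs[l := N (?zs ! l)])))" .
      have NX: "N (Xs ! i) \<in> \<XX>" "N (Xs ! j) \<in> \<XX>" "N ?Z \<in> \<XX>" using tensor11_vf[OF N] x i j Z by auto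
      have "\<psi> (bracket_tensor N (Xs ! i) (Xs ! j) # ?zs) = \<psi> (lie_bracket (N (Xs ! i)) (Xs ! j) # ?zs) +
          \<psi> (lie_bracket (Xs ! i) (N (Xs ! j)) # ?zs) - \<psi> (N ?Z # ?zs)"
        unfolding bracket_tensor_def using NX x i j by (simp add: form_diff0[OF \<psi>] form_add0[OF \<psi>])
      then show ?thesis unfolding b_def 1 i_tensor_Cons[OF N Z zs] by simp
    qed
    have "i_tensor M N (ext_d M \<psi>) Xs = (\<Sum>m<n. ext_d M \<psi> (Y m))"
      unfolding i_tensor_def Y_def n_def using Xs by simp
    also have "\<dots> = (\<Sum>m<n. (\<Sum>i<n. (- 1) ^ i * (Y m ! i) (\<psi> (nths (Y m) (- {i})))) +
       (\<Sum>j<n. \<Sum>i<j. (- 1) ^ (i + j) * \<psi> (lie_bracket (Y m ! i) (Y m ! j) # nths (Y m) (- {i, j}))))"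
      by (rule sum.cong) (use Y in \<open>auto simp: ext_d_def algebroid_d_def nY\<close>)
    also have "\<dots> = (\<Sum>i<n. (- 1) ^ i * (\<Sum>m<n. (Y m ! i) (\<psi> (nths (Y m) (- {i}))))) +
       (\<Sum>j<n. \<Sum>i<j. (- 1) ^ (i + j) * (\<Sum>m<n. \<psi> (lie_bracket (Y m ! i) (Y m ! j) # nths (Y m) (- {i, j}))))"
    proof -
      have "(\<Sum>m<n. \<Sum>j<n. \<Sum>i<j. (- 1) ^ (i + j) * \<psi> (lie_bracket (Y m ! i) (Y m ! j) # nths (Y m) (- {i, j}))) =
          (\<Sum>j<n. \<Sum>m<n. \<Sum>i<j. (- 1) ^ (i + j) * \<psi> (lie_bracket (Y m ! i) (Y m ! j) # nths (Y m) (- {i, j})))"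
        by (rule sum.swap)
      also have "\<dots> = (\<Sum>j<n. \<Sum>i<j. \<Sum>m<n. (- 1) ^ (i + j) * \<psi> (lie_bracket (Y m ! i) (Y m ! j) # nths (Y m) (- {i, j})))"
        by (intro sum.cong refl sum.swap)
      finally have 2: "(\<Sum>m<n. \<Sum>j<n. \<Sum>i<j. (- 1) ^ (i + j) * \<psi> (lie_bracket (Y m ! i) (Y m ! j) # nths (Y m) (- {i, j}))) =
          (\<Sum>j<n. \<Sum>i<j. \<Sum>m<n. (- 1) ^ (i + j) * \<psi> (lie_bracket (Y m ! i) (Y m ! j) # nths (Y m) (- {i, j})))" .
      have 1: "(\<Sum>m<n. \<Sum>i<n. (- 1) ^ i * (Y m ! i) (\<psi> (nths (Y m) (- {i})))) =
          (\<Sum>i<n. \<Sum>m<n. (- 1) ^ i * (Y m ! i) (\<psi> (nths (Y m) (- {i}))))"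
        by (rule sum.swap)
      show ?thesis unfolding sum.distrib 1 2 sum_distrib_left ..
    qed
    finally have I: "i_tensor M N (ext_d M \<psi>) Xs = \<dots>" .
    have II: "ext_d M (i_tensor M N \<psi>) Xs = (\<Sum>i<n. (- 1) ^ i * (Xs ! i) (i_tensor M N \<psi> (nths Xs (- {i})))) +
       (\<Sum>j<n. \<Sum>i<j. (- 1) ^ (i + j) * i_tensor M N \<psi> (lie_bracket (Xs ! i) (Xs ! j) # nths Xs (- {i, j})))"
      unfolding ext_d_def algebroid_d_def n_def using Xs by (rule if_P)
    have "d_tensor M N \<psi> Xs = (\<Sum>i<n. (- 1) ^ i * a i) + (\<Sum>j<n. \<Sum>i<j. (- 1) ^ (i + j) * b i j)"
    proof -
      have "d_tensor M N \<psi> Xs = i_tensor M N (ext_d M \<psi>) Xs - ext_d M (i_tensor M N \<psi>) Xs"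
        unfolding d_tensor_def by simp
      then show ?thesis
        unfolding I II a_def b_def right_diff_distrib sum_subtractf by (simp only: add_diff_add)
    qed
    also have "(\<Sum>i<n. (- 1) ^ i * a i) = (\<Sum>i<n. (- 1) ^ i * N (Xs ! i) (\<psi> (nths Xs (- {i}))))"
      by (rule sum.cong) (auto simp: A)
    also have "(\<Sum>j<n. \<Sum>i<j. (- 1) ^ (i + j) * b i j) =
        (\<Sum>j<n. \<Sum>i<j. (- 1) ^ (i + j) * \<psi> (bracket_tensor N (Xs ! i) (Xs ! j) # nths Xs (- {i, j})))"
      by (intro sum.cong refl) (auto simp: B)
    also have "(\<Sum>i<n. (- 1) ^ i * N (Xs ! i) (\<psi> (nths Xs (- {i})))) + \<dots> = algebroid_d \<XX> N (bracket_tensor N) \<psi> Xs"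
      unfolding algebroid_d_def n_def using Xs by (rule if_P[symmetric])
    finally show ?thesis .
  qed
qed

lemma
  assumes N: "N \<in> tensor11 M"
  shows d_tensor_form0: "f \<in> C \<Longrightarrow> d_tensor M N (form0 f) \<in> \<FF> 1"
    and d_tensor_form1: "\<alpha> \<in> \<FF> 1 \<Longrightarrow> d_tensor M N \<alpha> \<in> \<FF> 2"
proof -
  assume f: "f \<in> C"
  show "d_tensor M N (form0 f) \<in> \<FF> 1"
    unfolding d_tensor_eq[OF N form0_form[OF f]]
    by (rule algebroid_d_form0[OF tensor11_vf[OF N] tensor11_add[OF N] tensor11_smul[OF N] f])
next
  assume \<alpha>: "\<alpha> \<in> \<FF> 1"
  note [simp] = tensor11_vf[OF N] tensor11_add[OF N] tensor11_smul[OF N] tensor11_uminus[OF N]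
  show "d_tensor M N \<alpha> \<in> \<FF> 2"
    unfolding d_tensor_eq[OF N \<alpha>]
  proof (rule algebroid_d_form1[OF _ _ _ _ _ _ _ \<alpha>])
    fix X Y assume X: "X \<in> \<XX>" and Y: "Y \<in> \<XX>"
    show "bracket_tensor N X Y \<in> \<XX>" by (rule bracket_tensor_vf[OF N X Y])
    show "bracket_tensor N Y X = - bracket_tensor N X Y"
      unfolding bracket_tensor_def lie_bracket_skew[of Y X] lie_bracket_skew[of "N Y" X] lie_bracket_skew[of Y "N X"]
      using X Y by simp
    show "bracket_tensor N X (Y + Z) = bracket_tensor N X Y + bracket_tensor N X Z" if Z: "Z \<in> \<XX>" for Z
      unfolding bracket_tensor_def using X Y Z by (simp add: lie_bracket_add)
    show "bracket_tensor N X (smul f Y) = smul f (bracket_tensor N X Y) + smul (N X f) Y" if f: "f \<in> C" for f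
    proof -
      have XC: "X f \<in> C" using vf_C[OF X f] .
      have "bracket_tensor N X (smul f Y) = (smul f (lie_bracket (N X) Y) + smul (N X f) Y) +
          (smul f (lie_bracket X (N Y)) + smul (X f) (N Y)) - (smul f (N (lie_bracket X Y)) + smul (X f) (N Y))"
        unfolding bracket_tensor_def using X Y f XC by (simp add: lie_bracket_smul)
      then show ?thesis by (simp add: bracket_tensor_def smul_def fun_eq_iff algebra_simps)
    qed
  qed simp_all
qed

lemma lie_bracket_smul_left:
  assumes X: "X \<in> \<XX>" and Y: "Y \<in> \<XX>" and f: "f \<in> C"
  shows "lie_bracket (smul f X) Y = smul f (lie_bracket X Y) - smul (Y f) X"
  unfolding lie_bracket_skew[of "smul f X" Y] lie_bracket_smul[OF Y X f] lie_bracket_skew[of Y X]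
  by (simp add: smul_def fun_eq_iff)

lemma lie_bracket_add_left:
  assumes X: "X \<in> \<XX>" and Y: "Y \<in> \<XX>" and Z: "Z \<in> \<XX>"
  shows "lie_bracket (X + Y) Z = lie_bracket X Z + lie_bracket Y Z"
proof -
  have "lie_bracket (X + Y) Z = - (lie_bracket Z X + lie_bracket Z Y)"
    unfolding lie_bracket_skew[of "X + Y" Z] lie_bracket_add[OF Z X Y] ..
  also have "\<dots> = lie_bracket X Z + lie_bracket Y Z"
    unfolding lie_bracket_skew[of X Z] lie_bracket_skew[of Y Z] by simp
  finally show ?thesis .
qed

lemma lie_derivative_form1_eval:
  "X \<in> \<XX> \<Longrightarrow> Z \<in> \<XX> \<Longrightarrow> lie_derivative M X \<alpha> [Z] = X (\<alpha> [Z]) - \<alpha> [lie_bracket X Z]"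
  unfolding lie_derivative_def by (simp add: One_nat_def)

lemma lie_derivative_form1:
  assumes X: "X \<in> \<XX>" and \<alpha>: "\<alpha> \<in> \<FF> 1" shows "lie_derivative M X \<alpha> \<in> \<FF> 1"
proof (rule form1I)
  note [simp] = lie_derivative_form1_eval[OF X] vf_rules[OF X] form_slot0[OF \<alpha>] form_C'[OF \<alpha>] X
  show "lie_derivative M X \<alpha> [Z] \<in> C" if "Z \<in> \<XX>" for Z using that by simp
  show "lie_derivative M X \<alpha> [Y + Z] = lie_derivative M X \<alpha> [Y] + lie_derivative M X \<alpha> [Z]"
    if "Y \<in> \<XX>" "Z \<in> \<XX>" for Y Z using that by (simp add: lie_bracket_add)
  show "lie_derivative M X \<alpha> [smul f Z] = f * lie_derivative M X \<alpha> [Z]"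
    if "f \<in> C" "Z \<in> \<XX>" for f Z using that by (simp add: lie_bracket_smul algebra_simps)
next
  fix Xs :: "'a vfield list" assume "\<And>X. X \<in> \<XX> \<Longrightarrow> Xs \<noteq> [X]"
  then have *: "\<not> (length Xs = 1 \<and> set Xs \<subseteq> \<XX>)"
    unfolding length_eq_1 by (metis insert_subset list.simps(15))
  show "lie_derivative M X \<alpha> Xs = 0"
  proof (cases "set Xs \<subseteq> \<XX>")
    case True
    then have "length Xs \<noteq> 1" using * by simp
    then have "\<alpha> Xs = 0" "\<And>i Y. \<alpha> (Xs[i := Y]) = 0" by (auto intro: form_outside[OF \<alpha>])
    then show ?thesis using vf_zero[OF X] by (simp add: lie_derivative_def)
  qed (simp add: lie_derivative_def)
qed

end

section \<open>Bivector fields and the graph of a closed 2-form\<close>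

locale bivector = smooth_mfd +
  fixes \<pi> :: "'a bivector"
  assumes bivector: "\<pi> \<in> bivector_fields M"
begin

abbreviation S :: "'a form \<Rightarrow> 'a vfield" where "S \<equiv> sharp M \<pi>"

lemma \<pi>_C: "\<alpha> \<in> \<FF> 1 \<Longrightarrow> \<beta> \<in> \<FF> 1 \<Longrightarrow> \<pi> \<alpha> \<beta> \<in> C"
  and \<pi>_alt: "\<alpha> \<in> \<FF> 1 \<Longrightarrow> \<pi> \<alpha> \<alpha> = 0"
  and \<pi>_add: "\<alpha> \<in> \<FF> 1 \<Longrightarrow> \<beta> \<in> \<FF> 1 \<Longrightarrow> \<gamma> \<in> \<FF> 1 \<Longrightarrow> \<pi> (\<alpha> + \<beta>) \<gamma> = \<pi> \<alpha> \<gamma> + \<pi> \<beta> \<gamma>"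
  and \<pi>_add_right: "\<alpha> \<in> \<FF> 1 \<Longrightarrow> \<beta> \<in> \<FF> 1 \<Longrightarrow> \<gamma> \<in> \<FF> 1 \<Longrightarrow> \<pi> \<gamma> (\<alpha> + \<beta>) = \<pi> \<gamma> \<alpha> + \<pi> \<gamma> \<beta>"
  and \<pi>_smul: "f \<in> C \<Longrightarrow> \<alpha> \<in> \<FF> 1 \<Longrightarrow> \<beta> \<in> \<FF> 1 \<Longrightarrow> \<pi> (smul f \<alpha>) \<beta> = f * \<pi> \<alpha> \<beta>"
  and \<pi>_smul_right: "f \<in> C \<Longrightarrow> \<alpha> \<in> \<FF> 1 \<Longrightarrow> \<beta> \<in> \<FF> 1 \<Longrightarrow> \<pi> \<alpha> (smul f \<beta>) = f * \<pi> \<alpha> \<beta>"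
  using bivector unfolding bivector_fields_def Let_def by auto

lemma \<pi>_skew: assumes "\<alpha> \<in> \<FF> 1" "\<beta> \<in> \<FF> 1" shows "\<pi> \<alpha> \<beta> = - \<pi> \<beta> \<alpha>"
proof -
  have ab: "\<alpha> + \<beta> \<in> \<FF> 1" using assms by simp
  have "\<pi> (\<alpha> + \<beta>) (\<alpha> + \<beta>) = 0" by (rule \<pi>_alt[OF ab])
  then have "\<pi> \<alpha> \<beta> + \<pi> \<beta> \<alpha> = 0"
    unfolding \<pi>_add[OF assms ab] \<pi>_add_right[OF assms assms(1)] \<pi>_add_right[OF assms assms(2)]
      \<pi>_alt[OF assms(1)] \<pi>_alt[OF assms(2)] by simp
  then show ?thesis by (simp only: eq_neg_iff_add_eq_0)
qed

lemma sharp_vf [simp]: "\<alpha> \<in> \<FF> 1 \<Longrightarrow> S \<alpha> \<in> \<XX>"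
  and sharp_eval: "\<alpha> \<in> \<FF> 1 \<Longrightarrow> \<beta> \<in> \<FF> 1 \<Longrightarrow> \<beta> [S \<alpha>] = \<pi> \<alpha> \<beta>"
  using vector_field_of[of "\<pi> \<alpha>"] \<pi>_C[of \<alpha>] \<pi>_add_right[of _ _ \<alpha>] \<pi>_smul_right[of _ \<alpha>]
  by (simp_all add: sharp_def)

lemma sharp_skew:
  assumes a: "\<alpha> \<in> \<FF> 1" and b: "\<beta> \<in> \<FF> 1" shows "\<beta> [S \<alpha>] = - \<alpha> [S \<beta>]"
  unfolding sharp_eval[OF a b] sharp_eval[OF b a] by (rule \<pi>_skew[OF a b])

lemma sharp_add:
  assumes a: "\<alpha> \<in> \<FF> 1" and b: "\<beta> \<in> \<FF> 1" shows "S (\<alpha> + \<beta>) = S \<alpha> + S \<beta>"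
proof (rule vf_eqI)
  fix \<gamma> assume c: "\<gamma> \<in> \<FF> 1"
  show "\<gamma> [S (\<alpha> + \<beta>)] = \<gamma> [S \<alpha> + S \<beta>]"
    unfolding form_add0[OF c sharp_vf[OF a] sharp_vf[OF b]] sharp_eval[OF a c] sharp_eval[OF b c]
      sharp_eval[OF form_add[OF a b] c] by (rule \<pi>_add[OF a b c])
qed (use a b in simp_all)

lemma sharp_smul:
  assumes f: "f \<in> C" and a: "\<alpha> \<in> \<FF> 1" shows "S (smul f \<alpha>) = smul f (S \<alpha>)"
proof (rule vf_eqI)
  fix \<gamma> assume c: "\<gamma> \<in> \<FF> 1"
  show "\<gamma> [S (smul f \<alpha>)] = \<gamma> [smul f (S \<alpha>)]"
    unfolding form_smul0[OF c sharp_vf[OF a] f] sharp_eval[OF a c]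
      sharp_eval[OF form_smul[OF f a] c] by (rule \<pi>_smul[OF f a c])
qed (use f a in simp_all)

lemma bracket1_eval:
  assumes "\<alpha> \<in> \<FF> 1" "\<beta> \<in> \<FF> 1" "Z \<in> \<XX>"
  shows "bracket1 M \<pi> \<alpha> \<beta> [Z] = S \<alpha> (\<beta> [Z]) - \<beta> [lie_bracket (S \<alpha>) Z]
    - S \<beta> (\<alpha> [Z]) + \<alpha> [lie_bracket (S \<beta>) Z] - Z (\<beta> [S \<alpha>])"
  using assms unfolding bracket1_def pairing_def
  by (simp add: lie_derivative_form1_eval D0_eval)

lemma bracket1_form: "\<alpha> \<in> \<FF> 1 \<Longrightarrow> \<beta> \<in> \<FF> 1 \<Longrightarrow> bracket1 M \<pi> \<alpha> \<beta> \<in> \<FF> 1"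
  unfolding bracket1_def pairing_def
  by (intro form_diff lie_derivative_form1 sharp_vf D0_form) (auto intro: form_C')

text \<open>The terms in which the anchor differentiates a pairing with \<open>Y\<close> cancel
  against those in \<open>bracket1\<close>.\<close>

lemma d_pi1_eval:
  assumes \<alpha>: "\<alpha> \<in> \<FF> 1" and \<beta>: "\<beta> \<in> \<FF> 1" and Y: "Y \<in> \<XX>"
  shows "d_pi1 M \<pi> Y \<alpha> \<beta> = \<beta> [lie_bracket (S \<alpha>) Y] - \<alpha> [lie_bracket (S \<beta>) Y] + Y (\<beta> [S \<alpha>])"
  unfolding d_pi1_def pairing_def bracket1_eval[OF assms] by simp

lemma d_pi1_vf:
  assumes \<alpha>: "\<alpha> \<in> \<FF> 1" and Y: "Y \<in> \<XX>"
  shows "vector_field_of M (d_pi1 M \<pi> Y \<alpha>) \<in> \<XX>"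
    and "\<And>\<beta>. \<beta> \<in> \<FF> 1 \<Longrightarrow> \<beta> [vector_field_of M (d_pi1 M \<pi> Y \<alpha>)] = d_pi1 M \<pi> Y \<alpha> \<beta>"
proof -
  note [simp] = vf_rules[OF Y] form_slot0[OF \<alpha>] form_C'[OF \<alpha>] \<alpha> Y
  have 1: "d_pi1 M \<pi> Y \<alpha> \<beta> \<in> C" if \<beta>: "\<beta> \<in> \<FF> 1" for \<beta>
    unfolding d_pi1_eval[OF \<alpha> \<beta> Y] using form_C'[OF \<beta>] by simp
  have 2: "d_pi1 M \<pi> Y \<alpha> (\<beta> + \<gamma>) = d_pi1 M \<pi> Y \<alpha> \<beta> + d_pi1 M \<pi> Y \<alpha> \<gamma>"
    if \<beta>: "\<beta> \<in> \<FF> 1" and \<gamma>: "\<gamma> \<in> \<FF> 1" for \<beta> \<gamma>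
    unfolding d_pi1_eval[OF \<alpha> \<beta> Y] d_pi1_eval[OF \<alpha> \<gamma> Y] d_pi1_eval[OF \<alpha> form_add[OF \<beta> \<gamma>] Y]
    using form_C'[OF \<beta>] form_C'[OF \<gamma>] \<beta> \<gamma> by (simp add: sharp_add lie_bracket_add_left)
  \<comment> \<open>The derivative \<open>Y f\<close> enters twice, from the Lie bracket with f S
    \<beta> and from \<open>Y\<close> applied to f \<beta>(S \<alpha>); the two occurrences cancel
    because \<pi> is skew.\<close>
  have 3: "d_pi1 M \<pi> Y \<alpha> (smul f \<beta>) = f * d_pi1 M \<pi> Y \<alpha> \<beta>"
    if f: "f \<in> C" and \<beta>: "\<beta> \<in> \<FF> 1" for f \<beta>
    unfolding d_pi1_eval[OF \<alpha> \<beta> Y] d_pi1_eval[OF \<alpha> form_smul[OF f \<beta>] Y]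
      sharp_smul[OF f \<beta>] lie_bracket_smul_left[OF sharp_vf[OF \<beta>] Y f]
    using form_C'[OF \<beta>] f \<beta>
    by (simp add: smul_def[of f \<beta>] sharp_skew[OF \<alpha> \<beta>] algebra_simps)
  show "vector_field_of M (d_pi1 M \<pi> Y \<alpha>) \<in> \<XX>"
    "\<And>\<beta>. \<beta> \<in> \<FF> 1 \<Longrightarrow> \<beta> [vector_field_of M (d_pi1 M \<pi> Y \<alpha>)] = d_pi1 M \<pi> Y \<alpha> \<beta>"
    using vector_field_of[of "d_pi1 M \<pi> Y \<alpha>", OF 1 2 3] by blast+
qed

lemma d_pi0_vf:
  assumes f: "f \<in> C"
  shows "d_pi0 M \<pi> f \<in> \<XX>" and "\<And>\<beta>. \<beta> \<in> \<FF> 1 \<Longrightarrow> \<beta> [d_pi0 M \<pi> f] = S \<beta> f"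
proof -
  have 1: "S \<beta> f \<in> C" if "\<beta> \<in> \<FF> 1" for \<beta> using vf_C[OF sharp_vf[OF that] f] .
  have 2: "S (\<beta> + \<gamma>) f = S \<beta> f + S \<gamma> f" if "\<beta> \<in> \<FF> 1" "\<gamma> \<in> \<FF> 1" for \<beta> \<gamma>
    using that by (simp add: sharp_add)
  have 3: "S (smul g \<beta>) f = g * S \<beta> f" if "g \<in> C" "\<beta> \<in> \<FF> 1" for g \<beta>
    using that by (simp add: sharp_smul smul_def[of g "S \<beta>"])
  show "d_pi0 M \<pi> f \<in> \<XX>" "\<And>\<beta>. \<beta> \<in> \<FF> 1 \<Longrightarrow> \<beta> [d_pi0 M \<pi> f] = S \<beta> f"
    unfolding d_pi0_def using vector_field_of[of "\<lambda>\<beta>. S \<beta> f", OF 1 2 3] by blast+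
qed

end

section \<open>The graph of a closed 2-form: its lift, anchor, bracket and 3-form\<close>

locale twist = bivector +
  fixes N :: "'a vfield \<Rightarrow> 'a vfield" and \<phi> \<Omega> :: "'a form"
  assumes N: "N \<in> tensor11 M" and \<phi>: "\<phi> \<in> \<FF> 3" and \<Omega>: "\<Omega> \<in> \<FF> 2" and \<Omega>_closed: "ext_d M \<Omega> = 0"
begin

definition flat :: "'a vfield \<Rightarrow> 'a form" where "flat X = iprod X \<Omega>"
definition P :: "'a vfield \<Rightarrow> 'a vfield" where "P X = S (flat X)"
abbreviation L :: "'a esection set" where "L \<equiv> graph_sections M \<Omega>"
abbreviation N' :: "'a vfield \<Rightarrow> 'a vfield" where "N' \<equiv> \<lambda>X. N X + sharp M \<pi> (iprod X \<Omega>)"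

lemma flat_form [simp]: "X \<in> \<XX> \<Longrightarrow> flat X \<in> \<FF> 1"
  unfolding flat_def by (rule iprod_form) (simp_all add: \<Omega> One_nat_def numeral_2_eq_2[symmetric])

lemma flat_eval [simp]: "flat X [Y] = \<Omega> [X, Y]"
  unfolding flat_def iprod_def ..

lemma \<Omega>_C [simp]: "\<Omega> Xs \<in> C"
  using form_C'[OF \<Omega>] .

lemma N_vf [simp]: "X \<in> \<XX> \<Longrightarrow> N X \<in> \<XX>"
  using tensor11_vf[OF N] .

lemma P_vf [simp]: "X \<in> \<XX> \<Longrightarrow> P X \<in> \<XX>"
  unfolding P_def by simp

text \<open>Skewness of \<pi> moves \<open>S\<close> from \<open>flat X\<close> to \<beta>, leaving
  a value of \<Omega> at the single field \<open>S \<beta>\<close>, to which closedness can be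
  applied.\<close>

lemma P_eval: "X \<in> \<XX> \<Longrightarrow> \<beta> \<in> \<FF> 1 \<Longrightarrow> \<beta> [P X] = - \<Omega> [X, S \<beta>]"
  unfolding P_def by (subst sharp_skew) simp_all

lemma flat_add: "X \<in> \<XX> \<Longrightarrow> Y \<in> \<XX> \<Longrightarrow> flat (X + Y) = flat X + flat Y"
  by (rule form1_cases_eq) (simp_all add: form_add0[OF \<Omega>])

lemma flat_smul: "f \<in> C \<Longrightarrow> X \<in> \<XX> \<Longrightarrow> flat (smul f X) = smul f (flat X)"
proof (rule form1_cases_eq)
  assume "f \<in> C" "X \<in> \<XX>"
  then show "flat (smul f X) [Y] = smul f (flat X) [Y]" for Y
    by (simp add: form_smul0[OF \<Omega>] smul_def[of f "flat X"])
qed simp_all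

lemma N'_eq: "N' = (\<lambda>X. N X + P X)"
  by (simp add: P_def flat_def)

lemma N'_tensor: "N' \<in> tensor11 M"
  unfolding N'_eq tensor11_def Let_def
  by (auto simp: tensor11_add[OF N] tensor11_smul[OF N] P_def flat_add flat_smul sharp_add sharp_smul)
     (simp_all add: smul_def fun_eq_iff distrib_left)

lemma closed_eval:
  assumes "X \<in> \<XX>" "Y \<in> \<XX>" "Z \<in> \<XX>"
  shows "X (\<Omega> [Y, Z]) - Y (\<Omega> [X, Z]) + Z (\<Omega> [X, Y])
    - \<Omega> [lie_bracket X Y, Z] + \<Omega> [lie_bracket X Z, Y] - \<Omega> [lie_bracket Y Z, X] = 0"
proof -
  have "ext_d M \<Omega> [X, Y, Z] = 0" unfolding \<Omega>_closed by simp
  then show ?thesis unfolding ext_d_def algebroid_d_3[OF assms] .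
qed

definition graph_bracket :: "'a vfield \<Rightarrow> 'a vfield \<Rightarrow> 'a vfield" where
  "graph_bracket X Y = bracket_tensor N' X Y"

lemma graph_bracket_vf [simp]: "X \<in> \<XX> \<Longrightarrow> Y \<in> \<XX> \<Longrightarrow> graph_bracket X Y \<in> \<XX>"
  unfolding graph_bracket_def by (rule bracket_tensor_vf[OF N'_tensor])

lemma graph_bracket_eval:
  assumes X: "X \<in> \<XX>" and Y: "Y \<in> \<XX>" and \<beta>: "\<beta> \<in> \<FF> k"
  shows "\<beta> (graph_bracket X Y # Zs) = \<beta> (bracket_tensor N X Y # Zs) + \<beta> (lie_bracket (P X) Y # Zs)
    + \<beta> (lie_bracket X (P Y) # Zs) - \<beta> (P (lie_bracket X Y) # Zs)"
proof -
  have "graph_bracket X Y = bracket_tensor N X Y + lie_bracket (P X) Y + lie_bracket X (P Y) - P (lie_bracket X Y)"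
    unfolding graph_bracket_def N'_eq bracket_tensor_def
    using X Y by (simp add: lie_bracket_add lie_bracket_add_left)
  then show ?thesis using X Y bracket_tensor_vf[OF N X Y]
    by (simp add: form_diff0[OF \<beta>] form_add0[OF \<beta>])
qed

text \<open>Both sides are tested against a 1-form \<beta>. With b = S \<beta>, the terms that do
  not match literally add up to d\<Omega>(b, X, Y).\<close>

lemma courant_fst:
  assumes X: "X \<in> \<XX>" and Y: "Y \<in> \<XX>"
  shows "fst (courant M \<pi> N \<phi> (X, flat X) (Y, flat Y)) = graph_bracket X Y"
proof -
  let ?h = "\<lambda>_. 1 / 2 :: real"
  let ?A = "vector_field_of M (d_pi1 M \<pi> Y (flat X))" and ?A' = "vector_field_of M (d_pi1 M \<pi> X (flat Y))"
  let ?B = "d_pi0 M \<pi> (\<Omega> [X, Y])" and ?B' = "d_pi0 M \<pi> (\<Omega> [Y, X])"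
  note vf = d_pi1_vf(1)[OF flat_form[OF X] Y] d_pi1_vf(1)[OF flat_form[OF Y] X]
    d_pi0_vf(1)[OF \<Omega>_C] bracket_tensor_vf[OF N X Y]
  have eq: "fst (courant M \<pi> N \<phi> (X, flat X) (Y, flat Y)) =
      bracket_tensor N X Y + (?A + smul ?h ?B) - (?A' + smul ?h ?B')"
    by (simp add: courant_def courant_mixed_def pairing_def)
  show ?thesis unfolding eq
  proof (rule vf_eqI)
    show "bracket_tensor N X Y + (?A + smul ?h ?B) - (?A' + smul ?h ?B') \<in> \<XX>" using vf by simp
    show "graph_bracket X Y \<in> \<XX>" using X Y by simp
    fix \<beta> assume \<beta>: "\<beta> \<in> \<FF> 1"
    let ?b = "S \<beta>"
    have b: "?b \<in> \<XX>" using \<beta> by simp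
    have 1: "\<beta> [bracket_tensor N X Y + (?A + smul ?h ?B) - (?A' + smul ?h ?B')] =
        \<beta> [bracket_tensor N X Y] + (\<beta> [?A] + ?h * \<beta> [?B]) - (\<beta> [?A'] + ?h * \<beta> [?B'])"
      using vf by (simp add: form_slot0[OF \<beta>])
    have A: "\<beta> [?A] = \<beta> [lie_bracket (P X) Y] - \<Omega> [X, lie_bracket ?b Y] - Y (\<Omega> [X, ?b])"
      unfolding d_pi1_vf(2)[OF flat_form[OF X] Y \<beta>] d_pi1_eval[OF flat_form[OF X] \<beta> Y] flat_eval
        P_def[symmetric] P_eval[OF X \<beta>] vf_uminus[OF Y \<Omega>_C] by simp
    have A': "\<beta> [?A'] = \<beta> [lie_bracket (P Y) X] - \<Omega> [Y, lie_bracket ?b X] - X (\<Omega> [Y, ?b])"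
      unfolding d_pi1_vf(2)[OF flat_form[OF Y] X \<beta>] d_pi1_eval[OF flat_form[OF Y] \<beta> X] flat_eval
        P_def[symmetric] P_eval[OF Y \<beta>] vf_uminus[OF X \<Omega>_C] by simp
    \<comment> \<open>The two exact terms, each with factor 1/2, have opposite signs in the bracket
      and opposite values by skewness of \<Omega>; together they supply one full b(\<Omega>(X,
      Y)).\<close>
    have B: "\<beta> [?B] = ?b (\<Omega> [X, Y])" by (rule d_pi0_vf(2)[OF \<Omega>_C \<beta>])
    have B': "\<beta> [?B'] = - ?b (\<Omega> [X, Y])"
    proof -
      have "?b (\<Omega> [Y, X]) = ?b (- \<Omega> [X, Y])" by (subst form2_skew[OF \<Omega>, of Y X]) (rule refl)
      then show ?thesis unfolding d_pi0_vf(2)[OF \<Omega>_C \<beta>] vf_uminus[OF b \<Omega>_C] .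
    qed
    have 2: "\<beta> [graph_bracket X Y] = \<beta> [bracket_tensor N X Y] + \<beta> [lie_bracket (P X) Y] + \<beta> [lie_bracket X (P Y)]
        + \<Omega> [lie_bracket X Y, ?b]"
      unfolding graph_bracket_eval[OF X Y \<beta>] using X Y P_eval[OF _ \<beta>] by simp
    have 3: "\<beta> [lie_bracket (P Y) X] = - \<beta> [lie_bracket X (P Y)]"
      unfolding lie_bracket_skew[of "P Y" X] using X Y by (simp add: form_uminus0[OF \<beta>])
    \<comment> \<open>This is d\<Omega>(b, X, Y) = 0, with \<open>?b\<close> moved to the second
      slot.\<close>
    have 4: "?b (\<Omega> [X, Y]) + X (\<Omega> [Y, ?b]) - Y (\<Omega> [X, ?b])
      + \<Omega> [Y, lie_bracket ?b X] - \<Omega> [X, lie_bracket ?b Y] - \<Omega> [lie_bracket X Y, ?b] = 0"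
      using closed_eval[OF b X Y]
      unfolding form2_skew[OF \<Omega>, of ?b] form2_skew[OF \<Omega>, of "lie_bracket ?b Z" for Z]
        vf_uminus[OF X \<Omega>_C] vf_uminus[OF Y \<Omega>_C] by simp
    show "\<beta> [bracket_tensor N X Y + (?A + smul ?h ?B) - (?A' + smul ?h ?B')] = \<beta> [graph_bracket X Y]"
    proof
      fix p
      show "\<beta> [bracket_tensor N X Y + (?A + smul ?h ?B) - (?A' + smul ?h ?B')] p = \<beta> [graph_bracket X Y] p"
        using fun_cong[OF 4, of p] unfolding 1 2 A A' B B' 3 by (simp add: field_simps)
    qed
  qed
qed

text \<open>The form part with respect to TM \<oplus> T^*M. The component along T^*M in the
  splitting L \<oplus> T^*M differs from it by \<open>flat (graph_bracket X Y)\<close>.\<close>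

definition graph_cobracket :: "'a vfield \<Rightarrow> 'a vfield \<Rightarrow> 'a form" where
  "graph_cobracket X Y = snd (courant M \<pi> N \<phi> (X, flat X) (Y, flat Y))"

lemma graph_cobracket_eq:
  "graph_cobracket X Y = iprod Y (iprod X \<phi>) + bracket1 M \<pi> (flat X) (flat Y)
    - (iprod Y (d_tensor M N (flat X)) + rsmul (1 / 2) (d_tensor M N (form0 (\<Omega> [X, Y]))))
    + (iprod X (d_tensor M N (flat Y)) + rsmul (1 / 2) (d_tensor M N (form0 (\<Omega> [Y, X]))))"
  unfolding graph_cobracket_def by (simp add: courant_def courant_mixed_def pairing_def)

lemma graph_cobracket_form:
  assumes X: "X \<in> \<XX>" and Y: "Y \<in> \<XX>" shows "graph_cobracket X Y \<in> \<FF> 1"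
proof -
  have "iprod X \<phi> \<in> \<FF> 2" using iprod_form[of \<phi> 2 X] \<phi> X by simp
  then have "iprod Y (iprod X \<phi>) \<in> \<FF> 1" using iprod_form[of _ 1 Y] Y by simp
  moreover have "iprod Z \<omega> \<in> \<FF> 1" if "\<omega> \<in> \<FF> 2" "Z \<in> \<XX>" for \<omega> Z using iprod_form[of \<omega> 1 Z] that by simp
  ultimately show ?thesis unfolding graph_cobracket_eq using X Y
    by (intro form_add form_diff form_smul bracket1_form d_tensor_form0[OF N])
       (simp_all add: d_tensor_form1[OF N])
qed

lemma courant_lift: "X \<in> \<XX> \<Longrightarrow> Y \<in> \<XX> \<Longrightarrow> courant M \<pi> N \<phi> (X, flat X) (Y, flat Y) = (graph_bracket X Y, graph_cobracket X Y)"
  using courant_fst[of X Y] by (simp add: graph_cobracket_def prod_eq_iff)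

lemma in_L: "u \<in> L \<longleftrightarrow> (\<exists>X\<in>\<XX>. u = (X, flat X))"
  unfolding graph_sections_def flat_def by auto

text \<open>Against \<open>(0, \<alpha>)\<close> the factor 2 cancels the 1/2 of the pairing, so the
  defining condition only says that the lift has vector field part \<open>X\<close>.\<close>

lemma lift_L:
  assumes X: "X \<in> \<XX>" shows "lift_L M L X = (X, flat X)"
  unfolding lift_L_def
proof (rule the_equality)
  have *: "(\<lambda>_. 2) * pairing_E (Y, flat Y) (0, \<alpha>) = \<alpha> [Y]" if Y: "Y \<in> \<XX>" for Y \<alpha>
  proof -
    have "flat Y [0] = 0"
      using form_zero0[OF flat_form[OF Y]] .
    then show ?thesis unfolding pairing_E_def pairing_def by (simp add: fun_eq_iff)
  qed
  show "(X, flat X) \<in> L \<and> (\<forall>\<alpha>\<in>\<FF> 1. pairing \<alpha> X = (\<lambda>_. 2) * pairing_E (X, flat X) (0, \<alpha>))"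
    unfolding in_L pairing_def[of _ X] *[OF X] using X by blast
  fix u assume u: "u \<in> L \<and> (\<forall>\<alpha>\<in>\<FF> 1. pairing \<alpha> X = (\<lambda>_. 2) * pairing_E u (0, \<alpha>))"
  then obtain Y where Y: "Y \<in> \<XX>" "u = (Y, flat Y)" unfolding in_L by blast
  have "X = Y"
  proof (rule vf_eqI[OF X Y(1)])
    fix \<alpha> assume "\<alpha> \<in> \<FF> 1"
    then have "pairing \<alpha> X = (\<lambda>_. 2) * pairing_E u (0, \<alpha>)" using u by blast
    then show "\<alpha> [X] = \<alpha> [Y]" unfolding Y(2) *[OF Y(1)] pairing_def .
  qed
  then show "u = (X, flat X)" using Y(2) by simp
qed

lemma component_L:
  assumes X: "X \<in> \<XX>" and \<alpha>: "\<alpha> \<in> \<FF> 1" shows "component_L M L (X, \<alpha>) = (X, flat X)"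
  unfolding component_L_def
proof (rule the_equality)
  have "(X, \<alpha>) = (X, flat X) + (0, \<alpha> - flat X)" by simp
  moreover have "\<alpha> - flat X \<in> \<FF> 1" using \<alpha> X by simp
  ultimately show "(X, flat X) \<in> L \<and> (\<exists>\<beta>\<in>\<FF> 1. (X, \<alpha>) = (X, flat X) + (0, \<beta>))"
    unfolding in_L using X by blast
  show "v = (X, flat X)" if "v \<in> L \<and> (\<exists>\<beta>\<in>\<FF> 1. (X, \<alpha>) = v + (0, \<beta>))" for v
    using that unfolding in_L by auto
qed

lemma form_on_lift:
  assumes "set Xs \<subseteq> \<XX>" shows "form_on M L \<psi> (map (lift_L M L) Xs) = \<psi> Xs"
proof -
  have inj: "inj_on (lift_L M L) \<XX>" by (rule inj_onI) (simp add: lift_L)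
  have "map (inv_into \<XX> (lift_L M L)) (map (lift_L M L) Xs) = Xs"
    unfolding map_map by (rule map_idI) (use assms inv_into_f_f[OF inj] in auto)
  then show ?thesis unfolding form_on_def by simp
qed

text \<open>Under the lift the anchor of L becomes \<open>N'\<close>, and the L-component of the
  Courant bracket becomes \<open>bracket_tensor N'\<close>. The two differentials therefore agree
  term by term in every degree.\<close>

lemma d_L_eq:
  assumes \<psi>: "\<psi> \<in> \<FF> k"
  shows "d_L M \<pi> N \<phi> L \<psi> = d_tensor M N' \<psi>"
  unfolding d_tensor_eq[OF N'_tensor \<psi>]
proof
  fix Xs
  let ?l = "lift_L M L" and ?br = "\<lambda>u v. component_L M L (courant M \<pi> N \<phi> u v)"
  show "d_L M \<pi> N \<phi> L \<psi> Xs = algebroid_d \<XX> N' (bracket_tensor N') \<psi> Xs"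
  proof (cases "set Xs \<subseteq> \<XX>")
    case False
    then show ?thesis by (simp add: d_L_def algebroid_d_def)
  next
    case True
    have x: "Xs ! i \<in> \<XX>" if "i < length Xs" for i using True that by auto
    have nths: "set (nths Xs A) \<subseteq> \<XX>" for A using True set_nths_subset by fast
    have sub: "set (map ?l Xs) \<subseteq> L" using True by (auto simp: lift_L in_L)
    have anchor: "anchor_E M \<pi> N (?l X) = N' X" if "X \<in> \<XX>" for X
      by (simp add: anchor_E_def lift_L[OF that] flat_def)
    have br: "?br (?l X) (?l Y) = ?l (bracket_tensor N' X Y)" if "X \<in> \<XX>" "Y \<in> \<XX>" for X Y
      using that graph_bracket_vf[OF that] graph_cobracket_form[OF that]
      by (simp add: lift_L courant_lift component_L graph_bracket_def[symmetric])
    have 1: "anchor_E M \<pi> N (map ?l Xs ! i) (form_on M L \<psi> (nths (map ?l Xs) (- {i}))) =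
        N' (Xs ! i) (\<psi> (nths Xs (- {i})))" if "i < length Xs" for i
      unfolding nths_map form_on_lift[OF nths] nth_map[OF that] anchor[OF x[OF that]] ..
    have 2: "form_on M L \<psi> (?br (map ?l Xs ! i) (map ?l Xs ! j) # nths (map ?l Xs) (- {i, j})) =
        \<psi> (bracket_tensor N' (Xs ! i) (Xs ! j) # nths Xs (- {i, j}))"
      if "i < length Xs" "j < length Xs" for i j
    proof -
      have "set (bracket_tensor N' (Xs ! i) (Xs ! j) # nths Xs (- {i, j})) \<subseteq> \<XX>"
        using nths bracket_tensor_vf[OF N'_tensor x[OF that(1)] x[OF that(2)]] by simp
      from form_on_lift[OF this, of \<psi>] show ?thesis
        unfolding nths_map nth_map[OF that(1)] nth_map[OF that(2)] br[OF x[OF that(1)] x[OF that(2)]] by simp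
    qed
    have "d_L M \<pi> N \<phi> L \<psi> Xs =
        (\<Sum>i<length Xs. (-1) ^ i * anchor_E M \<pi> N (map ?l Xs ! i) (form_on M L \<psi> (nths (map ?l Xs) (- {i})))) +
        (\<Sum>j<length Xs. \<Sum>i<j. (-1) ^ (i + j) *
          form_on M L \<psi> (?br (map ?l Xs ! i) (map ?l Xs ! j) # nths (map ?l Xs) (- {i, j})))"
      unfolding d_L_def algebroid_d_def length_map if_P[OF True] if_P[OF sub] ..
    also have "\<dots> = (\<Sum>i<length Xs. (-1) ^ i * N' (Xs ! i) (\<psi> (nths Xs (- {i})))) +
        (\<Sum>j<length Xs. \<Sum>i<j. (-1) ^ (i + j) * \<psi> (bracket_tensor N' (Xs ! i) (Xs ! j) # nths Xs (- {i, j})))"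
      by (intro arg_cong2[of _ _ _ _ "(+)"] sum.cong refl) (simp_all only: 1 2 lessThan_iff less_trans)
    also have "\<dots> = algebroid_d \<XX> N' (bracket_tensor N') \<psi> Xs"
      unfolding algebroid_d_def if_P[OF True] ..
    finally show ?thesis .
  qed
qed

text \<open>Twice the pairing of the bracket with the lift of \<open>Z\<close> is \<Omega>(Z, vector
  field part) plus the form part at \<open>Z\<close>. The terms containing \<open>N\<close> assemble
  to d_N \<Omega>; the terms containing \<open>P\<close> stay in parentheses and are identified in
  \<open>d_P_\<Omega>\<close>.\<close>

lemma phi_L_eval:
  assumes X: "X \<in> \<XX>" and Y: "Y \<in> \<XX>" and Z: "Z \<in> \<XX>"
  shows "phi_L M \<pi> N \<phi> L [X, Y, Z] = \<phi> [X, Y, Z] + d_tensor M N \<Omega> [X, Y, Z]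
    + (bracket1 M \<pi> (flat X) (flat Y) [Z]
       + \<Omega> [Z, lie_bracket (P X) Y + lie_bracket X (P Y) - P (lie_bracket X Y)])"
proof -
  have 0: "phi_L M \<pi> N \<phi> L [X, Y, Z] = \<Omega> [Z, graph_bracket X Y] + graph_cobracket X Y [Z]"
    using X Y Z by (simp add: phi_L_def lift_L courant_lift pairing_E_def pairing_def fun_eq_iff)
  define Q where "Q = lie_bracket (P X) Y + lie_bracket X (P Y) - P (lie_bracket X Y)"
  have Q: "Q \<in> \<XX>" unfolding Q_def using X Y by simp
  have b: "bracket_tensor N A B \<in> \<XX>" if "A \<in> \<XX>" "B \<in> \<XX>" for A B by (rule bracket_tensor_vf[OF N that])
  have WQ: "graph_bracket X Y = bracket_tensor N X Y + Q"
    unfolding graph_bracket_def N'_eq bracket_tensor_def Q_def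
    using X Y by (simp add: lie_bracket_add lie_bracket_add_left)
  have 1: "\<Omega> [Z, graph_bracket X Y] = - \<Omega> [bracket_tensor N X Y, Z] + \<Omega> [Z, Q]"
    unfolding WQ form2_slot1[OF \<Omega> b[OF X Y] Q] form2_skew[OF \<Omega>, of Z "bracket_tensor N X Y"] ..
  have dN1: "d_tensor M N (flat A) [B, Z] = N B (\<Omega> [A, Z]) - N Z (\<Omega> [A, B]) + \<Omega> [bracket_tensor N B Z, A]"
    if "A \<in> \<XX>" "B \<in> \<XX>" for A B
    unfolding d_tensor_eq[OF N flat_form[OF that(1)]] algebroid_d_2[OF that(2) Z] flat_eval
      form2_skew[OF \<Omega>, of "bracket_tensor N B Z" A] by simp
  have dN0: "d_tensor M N (form0 f) [Z] = N Z f" if "f \<in> C" for f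
    unfolding d_tensor_eq[OF N form0_form[OF that]] algebroid_d_1[OF Z] by simp
  have dN2: "d_tensor M N \<Omega> [X, Y, Z] = N X (\<Omega> [Y, Z]) - N Y (\<Omega> [X, Z]) + N Z (\<Omega> [X, Y])
    - \<Omega> [bracket_tensor N X Y, Z] + \<Omega> [bracket_tensor N X Z, Y] - \<Omega> [bracket_tensor N Y Z, X]"
    unfolding d_tensor_eq[OF N \<Omega>] algebroid_d_3[OF X Y Z] ..
  have NZ: "N Z (\<Omega> [Y, X]) = - N Z (\<Omega> [X, Y])"
    unfolding form2_skew[OF \<Omega>, of Y X] by (rule vf_uminus) (simp_all add: Z)
  have i: "iprod A \<omega> [Z] = \<omega> [A, Z]" for A and \<omega> :: "'a form" unfolding iprod_def ..
  have i2: "iprod X \<phi> [Y, Z] = \<phi> [X, Y, Z]" unfolding iprod_def ..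
  \<comment> \<open>The differentials of \<open>flat X\<close> and \<open>flat Y\<close> produce N Z
    (\<Omega>(X, Y)) twice, and the exact terms remove one half each, so it occurs once, as in d_N
    \<Omega>.\<close>
  have 2: "graph_cobracket X Y [Z] = \<phi> [X, Y, Z] + bracket1 M \<pi> (flat X) (flat Y) [Z]
     - (d_tensor M N (flat X) [Y, Z] + (\<lambda>_. 1 / 2) * N Z (\<Omega> [X, Y]))
     + (d_tensor M N (flat Y) [X, Z] + (\<lambda>_. 1 / 2) * N Z (\<Omega> [Y, X]))"
    unfolding graph_cobracket_eq smul_def plus_fun_apply minus_apply i i2 dN0[OF \<Omega>_C] ..
  show ?thesis unfolding Q_def[symmetric]
  proof
    fix p
    show "phi_L M \<pi> N \<phi> L [X, Y, Z] p = (\<phi> [X, Y, Z] + d_tensor M N \<Omega> [X, Y, Z]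
      + (bracket1 M \<pi> (flat X) (flat Y) [Z] + \<Omega> [Z, Q])) p"
      unfolding 0 1 2 dN1[OF X Y] dN1[OF Y X] dN2 NZ
      by (simp add: form2_skew[OF \<Omega>, of Y X] field_simps)
  qed
qed

lemma phi_L_outside: "\<not> (length Xs = 3 \<and> set Xs \<subseteq> \<XX>) \<Longrightarrow> phi_L M \<pi> N \<phi> L Xs = 0"
  unfolding phi_L_def by (rule if_not_P)

end

section \<open>Wedge products with functions and 1-forms\<close>

lemma nths_singleton: "i < length xs \<Longrightarrow> nths xs {i} = [xs ! i]"
proof (induction xs arbitrary: i)
  case (Cons x xs)
  show ?case
  proof (cases i)
    case 0
    then show ?thesis by (simp add: nths_Cons nths_empty)
  next
    case (Suc k)
    then have "{j. Suc j = i} = {k}" by auto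
    then show ?thesis using Suc Cons by (simp add: nths_Cons)
  qed
qed simp

lemma length_nths_subset: "A \<subseteq> {..<length xs} \<Longrightarrow> length (nths xs A) = card A"
  unfolding length_nths by (rule arg_cong[of _ _ card]) auto

text \<open>Only the empty set of positions contributes, with no inversions.\<close>

lemma wedge_form0:
  fixes f :: "'a scalar" shows "wedge (form0 f) \<omega> = smul f \<omega>"
proof
  fix Xs :: "'a vfield list"
  let ?n = "length Xs"
  let ?t = "\<lambda>A. (-1) ^ card {(i, j). i < j \<and> i \<in> {..<?n} - A \<and> j \<in> A} * form0 f (nths Xs A) * \<omega> (nths Xs (- A))"
  have "wedge (form0 f) \<omega> Xs = ?t {} + (\<Sum>A\<in>Pow {..<?n} - {{}}. ?t A)"
    unfolding wedge_def by (rule sum.remove) auto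
  also have "(\<Sum>A\<in>Pow {..<?n} - {{}}. ?t A) = 0"
  proof (rule sum.neutral, rule ballI)
    fix A assume A: "A \<in> Pow {..<?n} - {{}}"
    then have "finite A" using finite_subset by blast
    then have "nths Xs A \<noteq> []" using A length_nths_subset[of A Xs] by auto
    then show "?t A = 0" by (simp add: form0_def)
  qed
  also have "?t {} = f * \<omega> Xs" by (simp add: form0_def nths_all)
  finally show "wedge (form0 f) \<omega> Xs = smul f \<omega> Xs" by (simp add: smul_def fun_eq_iff)
qed

context smooth_mfd begin

text \<open>Only singletons contribute, and for the position \<open>k\<close> exactly the
  \<open>k\<close> earlier positions form inversions with it.\<close>

lemma wedge_form1_left:
  assumes \<alpha>: "\<alpha> \<in> \<FF> 1"
  shows "wedge \<alpha> \<omega> Xs = (\<Sum>i<length Xs. (-1) ^ i * \<alpha> [Xs ! i] * \<omega> (nths Xs (- {i})))"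
proof -
  let ?n = "length Xs"
  let ?t = "\<lambda>A. (-1) ^ card {(i, j). i < j \<and> i \<in> {..<?n} - A \<and> j \<in> A} * \<alpha> (nths Xs A) * \<omega> (nths Xs (- A))"
  have "wedge \<alpha> \<omega> Xs = (\<Sum>A\<in>(\<lambda>i. {i}) ` {..<?n}. ?t A)"
    unfolding wedge_def
  proof (rule sum.mono_neutral_right)
    show "\<forall>A\<in>Pow {..<?n} - (\<lambda>i. {i}) ` {..<?n}. ?t A = 0"
    proof
      fix A assume A: "A \<in> Pow {..<?n} - (\<lambda>i. {i}) ` {..<?n}"
      have "card A \<noteq> 1" using A by (auto simp: card_1_singleton_iff One_nat_def)
      then have "length (nths Xs A) \<noteq> 1" using A length_nths_subset[of A Xs] by auto
      then have "\<alpha> (nths Xs A) = 0" by (intro form_outside[OF \<alpha>]) simp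
      then show "?t A = 0" by simp
    qed
  qed auto
  also have "\<dots> = (\<Sum>i<?n. ?t {i})" by (subst sum.reindex) auto
  also have "\<dots> = (\<Sum>i<?n. (-1) ^ i * \<alpha> [Xs ! i] * \<omega> (nths Xs (- {i})))"
  proof (rule sum.cong[OF refl])
    fix k assume "k \<in> {..<?n}"
    then have k: "k < ?n" by simp
    have "{(i, j). i < j \<and> i \<in> {..<?n} - {k} \<and> j \<in> {k}} = (\<lambda>i. (i, k)) ` {..<k}" using k by auto
    then have "card {(i, j). i < j \<and> i \<in> {..<?n} - {k} \<and> j \<in> {k}} = k"
      by (simp add: card_image inj_on_def)
    then show "?t {k} = (-1) ^ k * \<alpha> [Xs ! k] * \<omega> (nths Xs (- {k}))"
      unfolding nths_singleton[OF k] by simp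
  qed
  finally show ?thesis .
qed

text \<open>Only complements of singletons contribute; the omitted position \<open>k\<close> forms
  inversions with the later positions.\<close>

lemma wedge_form1_right:
  assumes \<alpha>: "\<alpha> \<in> \<FF> 1"
  shows "wedge \<omega> \<alpha> Xs = (\<Sum>i<length Xs. (-1) ^ (length Xs - Suc i) * \<omega> (nths Xs (- {i})) * \<alpha> [Xs ! i])"
proof -
  let ?n = "length Xs"
  let ?t = "\<lambda>A. (-1) ^ card {(i, j). i < j \<and> i \<in> {..<?n} - A \<and> j \<in> A} * \<omega> (nths Xs A) * \<alpha> (nths Xs (- A))"
  let ?c = "\<lambda>i. {..<?n} - {i}"
  \<comment> \<open>\<open>wedge\<close> takes complements among all natural numbers; positions
    beyond the end of the list have no effect.\<close>
  have nths_cong: "nths Xs A = nths Xs A'" if "A \<inter> {..<?n} = A' \<inter> {..<?n}" for A A'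
  proof -
    have "filter (\<lambda>z. snd z \<in> A) (zip Xs [0..<?n]) = filter (\<lambda>z. snd z \<in> A') (zip Xs [0..<?n])"
    proof (rule filter_cong[OF refl])
      fix z assume "z \<in> set (zip Xs [0..<?n])"
      then have "snd z \<in> {..<?n}" by (auto simp: set_zip)
      then show "(snd z \<in> A) = (snd z \<in> A')" using that by blast
    qed
    then show ?thesis unfolding nths_def by simp
  qed
  have "wedge \<omega> \<alpha> Xs = (\<Sum>A\<in>?c ` {..<?n}. ?t A)"
    unfolding wedge_def
  proof (rule sum.mono_neutral_right)
    show "\<forall>A\<in>Pow {..<?n} - ?c ` {..<?n}. ?t A = 0"
    proof
      fix A assume A: "A \<in> Pow {..<?n} - ?c ` {..<?n}"
      have "card ({..<?n} - A) \<noteq> 1"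
      proof
        assume "card ({..<?n} - A) = 1"
        then obtain i where i: "{..<?n} - A = {i}" by (auto simp: card_1_singleton_iff One_nat_def)
        then have "i < ?n" "A = ?c i" using A by auto
        then show False using A by blast
      qed
      moreover have "nths Xs (- A) = nths Xs ({..<?n} - A)" by (rule nths_cong) auto
      ultimately have "length (nths Xs (- A)) \<noteq> 1" using length_nths_subset[of "{..<?n} - A" Xs] by auto
      then have "\<alpha> (nths Xs (- A)) = 0" by (intro form_outside[OF \<alpha>]) simp
      then show "?t A = 0" by simp
    qed
  qed auto
  also have "\<dots> = (\<Sum>i<?n. ?t (?c i))" by (subst sum.reindex) (auto simp: inj_on_def)
  also have "\<dots> = (\<Sum>i<?n. (-1) ^ (?n - Suc i) * \<omega> (nths Xs (- {i})) * \<alpha> [Xs ! i])"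
  proof (rule sum.cong[OF refl])
    fix k assume "k \<in> {..<?n}"
    then have k: "k < ?n" by simp
    have "{(i, j). i < j \<and> i \<in> {..<?n} - ?c k \<and> j \<in> ?c k} = (\<lambda>j. (k, j)) ` {k<..<?n}" using k by auto
    then have c: "card {(i, j). i < j \<and> i \<in> {..<?n} - ?c k \<and> j \<in> ?c k} = ?n - Suc k"
      by (simp add: card_image inj_on_def)
    have "nths Xs (?c k) = nths Xs (- {k})" "nths Xs (- ?c k) = nths Xs {k}" by (rule nths_cong; use k in auto)+
    then show "?t (?c k) = (-1) ^ (?n - Suc k) * \<omega> (nths Xs (- {k})) * \<alpha> [Xs ! k]"
      unfolding c nths_singleton[OF k] by simp
  qed
  finally show ?thesis .
qed

lemma wedge_eval_1: "\<alpha> \<in> \<FF> 1 \<Longrightarrow> wedge \<alpha> \<omega> [X] = \<alpha> [X] * \<omega> []"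
  by (simp add: wedge_form1_left nths_minus_single)

lemma wedge_eval_2:
  assumes "\<alpha> \<in> \<FF> 1" shows "wedge \<alpha> \<omega> [X, Y] = \<alpha> [X] * \<omega> [Y] - \<alpha> [Y] * \<omega> [X]"
proof -
  have l: "length [X, Y] = 2" by simp
  show ?thesis unfolding wedge_form1_left[OF assms] l sum_lessThan_low nths_minus_single by simp
qed

lemma wedge_eval_12:
  assumes "\<alpha> \<in> \<FF> 1"
  shows "wedge \<alpha> \<omega> [X, Y, Z] = \<alpha> [X] * \<omega> [Y, Z] - \<alpha> [Y] * \<omega> [X, Z] + \<alpha> [Z] * \<omega> [X, Y]"
proof -
  have l: "length [X, Y, Z] = 3" by simp
  show ?thesis unfolding wedge_form1_left[OF assms] l sum_lessThan_low nths_minus_single by simp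
qed

lemma wedge_eval_21:
  assumes "\<alpha> \<in> \<FF> 1"
  shows "wedge \<omega> \<alpha> [X, Y, Z] = \<omega> [Y, Z] * \<alpha> [X] - \<omega> [X, Z] * \<alpha> [Y] + \<omega> [X, Y] * \<alpha> [Z]"
proof -
  have l: "length [X, Y, Z] = 3" by simp
  show ?thesis unfolding wedge_form1_right[OF assms] l sum_lessThan_low nths_minus_single
    by (simp add: numeral_3_eq_3)
qed

lemma wedge_form2:
  assumes \<alpha>: "\<alpha> \<in> \<FF> 1" and \<beta>: "\<beta> \<in> \<FF> 1" shows "wedge \<alpha> \<beta> \<in> \<FF> 2"
proof (rule form2I)
  note e = wedge_eval_2[OF \<alpha>]
  show "wedge \<alpha> \<beta> [X, Y] \<in> C" for X Y unfolding e by (simp add: form_C'[OF \<alpha>] form_C'[OF \<beta>])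
  show "wedge \<alpha> \<beta> [Y, X] = - wedge \<alpha> \<beta> [X, Y]" for X Y unfolding e by simp
  show "wedge \<alpha> \<beta> [Z, X + Y] = wedge \<alpha> \<beta> [Z, X] + wedge \<alpha> \<beta> [Z, Y]" if "X \<in> \<XX>" "Y \<in> \<XX>" for X Y Z
    unfolding e form_add0[OF \<alpha> that] form_add0[OF \<beta> that] by (simp add: algebra_simps)
  show "wedge \<alpha> \<beta> [Z, smul f X] = f * wedge \<alpha> \<beta> [Z, X]" if "f \<in> C" "X \<in> \<XX>" for f X Z
    unfolding e form_smul0[OF \<alpha> that(2,1)] form_smul0[OF \<beta> that(2,1)] by (simp add: algebra_simps)
  fix Xs :: "'a vfield list" assume no: "\<And>X Y. X \<in> \<XX> \<Longrightarrow> Y \<in> \<XX> \<Longrightarrow> Xs \<noteq> [X, Y]"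
  show "wedge \<alpha> \<beta> Xs = 0"
  proof (cases "length Xs = 2")
    case True
    then obtain X Y where XY: "Xs = [X, Y]" unfolding length_eq_2 by blast
    then have "X \<notin> \<XX> \<or> Y \<notin> \<XX>" using no by blast
    then have "\<alpha> [X] = 0 \<and> \<beta> [X] = 0 \<or> \<alpha> [Y] = 0 \<and> \<beta> [Y] = 0"
      using form_outside[OF \<alpha>] form_outside[OF \<beta>] by auto
    then show ?thesis unfolding XY e by auto
  next
    case False
    have "\<beta> (nths Xs (- {i})) = 0" if "i < length Xs" for i
    proof (rule form_outside[OF \<beta>])
      have "length (nths Xs (- {i})) \<noteq> 1" using that False length_nths_minus[of "{i}" Xs] by auto
      then show "\<not> (length (nths Xs (- {i})) = 1 \<and> set (nths Xs (- {i})) \<subseteq> \<XX>)" by simp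
    qed
    then show ?thesis unfolding wedge_form1_left[OF \<alpha>] by simp
  qed
qed

section \<open>Localization of first-order operators on 2-forms\<close>

lemma form2_cases_eq:
  assumes "\<omega> \<in> \<FF> 2" "\<eta> \<in> \<FF> 2" "\<And>X Y. X \<in> \<XX> \<Longrightarrow> Y \<in> \<XX> \<Longrightarrow> \<omega> [X, Y] = \<eta> [X, Y]"
  shows "\<omega> = \<eta>"
proof
  fix Xs show "\<omega> Xs = \<eta> Xs"
  proof (cases "length Xs = 2 \<and> set Xs \<subseteq> \<XX>")
    case True
    then obtain X Y where "Xs = [X, Y]" "X \<in> \<XX>" "Y \<in> \<XX>" by (auto simp: length_eq_2)
    then show ?thesis using assms(3) by simp
  next
    case False
    then show ?thesis using form_outside[OF assms(1) False] form_outside[OF assms(2) False] by simp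
  qed
qed

text \<open>
  If \<open>w(p) = 1\<close>, then \<open>u = 3w\<^sup>2 - 2w\<^sup>3\<close> satisfies \<open>u(p) = 1\<close> and \<open>du(p) = 0\<close>: a local frame is enough
  for localization, and no bump function that is constant near \<open>p\<close> is needed.
\<close>

lemma ex_flat_local_frame:
  fixes p :: 'a
  obtains u and I :: "'e option set" and xs e where
    "u \<in> C" "u p = 1" "\<forall>X\<in>\<XX>. X u p = 0" "finite I" "\<forall>i\<in>I. xs i \<in> C" "\<forall>i\<in>I. e i \<in> \<XX>"
    "\<forall>X\<in>\<XX>. smul u X = (\<Sum>i\<in>I. smul (X (xs i)) (e i))"
proof -
  obtain v and I :: "'e option set" and xs e where fr: "v \<in> C" "v p \<noteq> 0" "finite I"
      "\<And>i. i \<in> I \<Longrightarrow> xs i \<in> C" "\<And>i. i \<in> I \<Longrightarrow> e i \<in> \<XX>"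
      "\<And>X. X \<in> \<XX> \<Longrightarrow> smul v X = (\<Sum>i\<in>I. smul (X (xs i)) (e i))"
      using ex_local_frame[of p] by blast
  define w where "w = (\<lambda>_. 1 / v p) * v"
  have w: "w \<in> C" "w p = 1" unfolding w_def using fr by simp_all
  \<comment> \<open>Since 3w^2 - 2w^3 = (3w - 2w^2) w and w is v / v(p), the function
    \<open>u\<close> is \<open>k * v\<close>, and the factor \<open>k\<close> can be absorbed into
    the fields of the frame.\<close>
  define k where "k = (3 * w - 2 * (w * w)) * (\<lambda>_. 1 / v p)"
  define u where "u = 3 * (w * w) - 2 * (w * (w * w))"
  have u: "u = k * v" unfolding u_def k_def w_def by (simp add: fun_eq_iff algebra_simps)
  have k: "k \<in> C" unfolding k_def using w by simp
  show ?thesis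
  proof (rule that[of u I xs "\<lambda>i. smul k (e i)"])
    show "u \<in> C" unfolding u using k fr by simp
    show "u p = 1" unfolding u_def using w by simp
    have num: "numeral n = (\<lambda>_. numeral n :: real)" for n by (simp add: numeral_fun)
    show "\<forall>X\<in>\<XX>. X u p = 0"
    proof
      fix X assume X: "X \<in> \<XX>"
      \<comment> \<open>This is 6 w (1 - w) X w, which vanishes at p because w(p) = 1.\<close>
      have "X u = 3 * (w * X w + w * X w) - 2 * (w * (w * X w + w * X w) + (w * w) * X w)"
        unfolding u_def num using w by (simp add: vf_rules[OF X])
      then show "X u p = 0" using w by simp
    qed
    show "\<forall>X\<in>\<XX>. smul u X = (\<Sum>i\<in>I. smul (X (xs i)) (smul k (e i)))"
    proof
      fix X assume X: "X \<in> \<XX>"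
      have "smul u X = smul k (smul v X)" unfolding u by (simp add: smul_def fun_eq_iff)
      also have "\<dots> = (\<Sum>i\<in>I. smul (X (xs i)) (smul k (e i)))"
        unfolding fr(6)[OF X] by (intro ext) (simp add: smul_def sum_fun_apply sum_distrib_left mult_ac)
      finally show "smul u X = (\<Sum>i\<in>I. smul (X (xs i)) (smul k (e i)))" .
    qed
  qed (use fr k in auto)
qed

lemma additive_sum:
  fixes \<Phi> :: "'a form \<Rightarrow> real"
  assumes add: "\<And>\<eta> \<eta>'. \<eta> \<in> \<FF> k \<Longrightarrow> \<eta>' \<in> \<FF> k \<Longrightarrow> \<Phi> (\<eta> + \<eta>') = \<Phi> \<eta> + \<Phi> \<eta>'"
    and "finite J" "\<And>j. j \<in> J \<Longrightarrow> \<zeta> j \<in> \<FF> k"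
  shows "\<Phi> (\<Sum>j\<in>J. \<zeta> j) = (\<Sum>j\<in>J. \<Phi> (\<zeta> j))"
  using assms(2,3)
proof (induction J)
  case empty
  have "\<Phi> (0 + 0) = \<Phi> 0 + \<Phi> 0" by (rule add) simp_all
  then have "\<Phi> 0 = 0" unfolding add_0_left by linarith
  then show ?case by (simp only: sum.empty)
next
  case (insert j J)
  have "\<Phi> (\<zeta> j + (\<Sum>j\<in>J. \<zeta> j)) = \<Phi> (\<zeta> j) + \<Phi> (\<Sum>j\<in>J. \<zeta> j)"
    using insert(4) by (intro add form_sum) auto
  moreover have "\<Phi> (\<Sum>j\<in>J. \<zeta> j) = (\<Sum>j\<in>J. \<Phi> (\<zeta> j))" using insert(4) by (intro insert(3)) auto
  ultimately show ?case unfolding sum.insert[OF insert(1,2)] by linarith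
qed

text \<open>A function that is 1 at p with vanishing differential may be multiplied in without
  changing either operator at p. After multiplication by a power of the frame function, \<eta> is a
  finite global sum of terms f dg \<and> dh. Additivity and this weak locality replace linearity
  over functions, since the operators in question may differentiate coefficients.\<close>

lemma form2_local_principle:
  fixes \<Phi> \<Psi> :: "'a form \<Rightarrow> real" and p :: 'a
  assumes \<Phi>_add: "\<And>\<eta> \<eta>'. \<eta> \<in> \<FF> 2 \<Longrightarrow> \<eta>' \<in> \<FF> 2 \<Longrightarrow> \<Phi> (\<eta> + \<eta>') = \<Phi> \<eta> + \<Phi> \<eta>'"
    and \<Psi>_add: "\<And>\<eta> \<eta>'. \<eta> \<in> \<FF> 2 \<Longrightarrow> \<eta>' \<in> \<FF> 2 \<Longrightarrow> \<Psi> (\<eta> + \<eta>') = \<Psi> \<eta> + \<Psi> \<eta>'"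
    and \<Phi>_local: "\<And>u \<eta>. u \<in> C \<Longrightarrow> u p = 1 \<Longrightarrow> \<forall>X\<in>\<XX>. X u p = 0 \<Longrightarrow> \<eta> \<in> \<FF> 2 \<Longrightarrow> \<Phi> (smul u \<eta>) = \<Phi> \<eta>"
    and \<Psi>_local: "\<And>u \<eta>. u \<in> C \<Longrightarrow> u p = 1 \<Longrightarrow> \<forall>X\<in>\<XX>. X u p = 0 \<Longrightarrow> \<eta> \<in> \<FF> 2 \<Longrightarrow> \<Psi> (smul u \<eta>) = \<Psi> \<eta>"
    and gen: "\<And>f g h. f \<in> C \<Longrightarrow> g \<in> C \<Longrightarrow> h \<in> C \<Longrightarrow>
      \<Phi> (smul f (wedge (D0 g) (D0 h))) = \<Psi> (smul f (wedge (D0 g) (D0 h)))"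
    and \<eta>: "\<eta> \<in> \<FF> 2"
  shows "\<Phi> \<eta> = \<Psi> \<eta>"
proof -
  obtain u and I :: "'e option set" and xs e where fr: "u \<in> C" "u p = 1" "\<forall>X\<in>\<XX>. X u p = 0" "finite I"
    "\<forall>i\<in>I. xs i \<in> C" "\<forall>i\<in>I. e i \<in> \<XX>" "\<forall>X\<in>\<XX>. smul u X = (\<Sum>i\<in>I. smul (X (xs i)) (e i))"
    using ex_flat_local_frame[of p] .
  \<comment> \<open>The sum runs over ordered pairs, so each wedge of two coordinate differentials
    is counted twice; hence 1/2.\<close>
  define c where "c i j = (\<lambda>_. 1 / 2) * \<eta> [e i, e j]" for i j
  define \<zeta> where "\<zeta> = (\<lambda>(i, j). smul (c i j) (wedge (D0 (xs i)) (D0 (xs j))))"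
  have c: "c i j \<in> C" for i j unfolding c_def using form_C'[OF \<eta>] by simp
  have \<zeta>: "\<zeta> ij \<in> \<FF> 2" if "ij \<in> I \<times> I" for ij
    unfolding \<zeta>_def using that c fr(5) by (auto intro!: form_smul wedge_form2 D0_form)
  have expand: "u * \<eta> [X, Y] = (\<Sum>i\<in>I. X (xs i) * \<eta> [e i, Y])" if X: "X \<in> \<XX>" for X Y
  proof -
    have XC: "X (xs i) \<in> C" if "i \<in> I" for i using vf_C[OF X] fr(5) that by blast
    have "u * \<eta> [X, Y] = \<eta> [smul u X, Y]" using form_smul0[OF \<eta> X fr(1)] by simp
    also have "\<dots> = (\<Sum>i\<in>I. \<eta> [smul (X (xs i)) (e i), Y])"
      unfolding bspec[OF fr(7) X] by (rule form_sum0[OF \<eta>]) (simp add: fr(6) XC)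
    also have "\<dots> = (\<Sum>i\<in>I. X (xs i) * \<eta> [e i, Y])"
      by (rule sum.cong[OF refl], rule form_smul0[OF \<eta>]) (simp_all add: fr(6) XC)
    finally show ?thesis .
  qed
  \<comment> \<open>One factor \<open>u\<close> for the frame expansion of each of the two
    arguments.\<close>
  have "smul (u * u) \<eta> = (\<Sum>ij\<in>I \<times> I. \<zeta> ij)"
  proof (rule form2_cases_eq)
    show "smul (u * u) \<eta> \<in> \<FF> 2" using fr(1) \<eta> by simp
    show "(\<Sum>ij\<in>I \<times> I. \<zeta> ij) \<in> \<FF> 2" by (rule form_sum[OF \<zeta>])
    fix X Y assume X: "X \<in> \<XX>" and Y: "Y \<in> \<XX>"
    have "u q * u q * \<eta> [X, Y] q = (\<Sum>i\<in>I. \<Sum>j\<in>I. X (xs i) q * Y (xs j) q * \<eta> [e i, e j] q)"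
      (is "_ = ?s") for q
    proof -
      have "u q * u q * \<eta> [X, Y] q = u q * (\<Sum>i\<in>I. X (xs i) q * \<eta> [e i, Y] q)"
        using fun_cong[OF expand[OF X, of Y], of q] by (simp add: sum_fun_apply)
      also have "\<dots> = (\<Sum>i\<in>I. X (xs i) q * (u q * \<eta> [e i, Y] q))"
        by (simp add: sum_distrib_left mult_ac)
      also have "\<dots> = (\<Sum>i\<in>I. X (xs i) q * (\<Sum>j\<in>I. Y (xs j) q * \<eta> [e i, e j] q))"
      proof (rule sum.cong[OF refl])
        fix i
        \<comment> \<open>\<open>expand\<close> acts on the first slot, so the second is brought
          there by skewness and then returned.\<close>
        have "u q * \<eta> [e i, Y] q = - (u * \<eta> [Y, e i]) q" by (subst form2_skew[OF \<eta>]) simp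
        also have "\<dots> = (\<Sum>j\<in>I. Y (xs j) q * \<eta> [e i, e j] q)"
          unfolding expand[OF Y] form2_skew[OF \<eta>, of "e i"] by (simp add: sum_fun_apply sum_negf)
        finally show "X (xs i) q * (u q * \<eta> [e i, Y] q) = X (xs i) q * (\<Sum>j\<in>I. Y (xs j) q * \<eta> [e i, e j] q)"
          by simp
      qed
      finally show ?thesis by (simp add: sum_distrib_left mult.assoc)
    qed
    note 1 = this
    have 2: "(\<Sum>ij\<in>I \<times> I. \<zeta> ij [X, Y] q) =
        (\<Sum>i\<in>I. \<Sum>j\<in>I. X (xs i) q * Y (xs j) q * \<eta> [e i, e j] q)" for q
    proof -
      have "\<zeta> (i, j) [X, Y] q = 1 / 2 * (X (xs i) q * Y (xs j) q * \<eta> [e i, e j] q) +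
          1 / 2 * (X (xs j) q * Y (xs i) q * \<eta> [e j, e i] q)" if "i \<in> I" "j \<in> I" for i j
        using that fr(5) unfolding \<zeta>_def c_def smul_def form2_skew[OF \<eta>, of "e j" "e i"]
        by (simp add: wedge_eval_2 D0_eval[OF X] D0_eval[OF Y] field_simps)
      note t = this
      have "(\<Sum>ij\<in>I \<times> I. \<zeta> ij [X, Y] q) = (\<Sum>i\<in>I. \<Sum>j\<in>I. \<zeta> (i, j) [X, Y] q)"
        by (rule sum.cartesian_product')
      also have "\<dots> =
          (\<Sum>i\<in>I. \<Sum>j\<in>I. 1 / 2 * (X (xs i) q * Y (xs j) q * \<eta> [e i, e j] q)) +
          (\<Sum>i\<in>I. \<Sum>j\<in>I. 1 / 2 * (X (xs j) q * Y (xs i) q * \<eta> [e j, e i] q))"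
        unfolding sum.distrib[symmetric] by (intro sum.cong refl t)
      also have "(\<Sum>i\<in>I. \<Sum>j\<in>I. 1 / 2 * (X (xs j) q * Y (xs i) q * \<eta> [e j, e i] q)) =
          (\<Sum>i\<in>I. \<Sum>j\<in>I. 1 / 2 * (X (xs i) q * Y (xs j) q * \<eta> [e i, e j] q))"
        by (rule sum.swap)
      finally show ?thesis by (simp add: sum_distrib_left)
    qed
    show "smul (u * u) \<eta> [X, Y] = (\<Sum>ij\<in>I \<times> I. \<zeta> ij) [X, Y]"
      by (rule ext) (simp add: smul_def sum_fun_apply 1 2)
  qed
  note eq = this
  have uu: "u * u \<in> C" "(u * u) p = 1" "\<forall>X\<in>\<XX>. X (u * u) p = 0"
    using fr(1-3) vf_mult[OF _ fr(1) fr(1)] by auto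
  have "\<Phi> \<eta> = \<Phi> (smul (u * u) \<eta>)" by (rule \<Phi>_local[OF uu \<eta>, symmetric])
  also have "\<dots> = (\<Sum>ij\<in>I \<times> I. \<Phi> (\<zeta> ij))" unfolding eq
    by (rule additive_sum[of 2 \<Phi>, OF \<Phi>_add]) (use \<zeta> fr(4) in auto)
  also have "\<dots> = (\<Sum>ij\<in>I \<times> I. \<Psi> (\<zeta> ij))"
    by (rule sum.cong[OF refl]) (use gen c fr(5) in \<open>auto simp: \<zeta>_def\<close>)
  also have "\<dots> = \<Psi> (smul (u * u) \<eta>)" unfolding eq
    by (rule additive_sum[of 2 \<Psi>, OF \<Psi>_add, symmetric]) (use \<zeta> fr(4) in auto)
  also have "\<dots> = \<Psi> \<eta>" by (rule \<Psi>_local[OF uu \<eta>])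
  finally show ?thesis .
qed

end

section \<open>The bracket of forms with a closed 2-form\<close>

lemma wedge_zero_left: "wedge 0 \<omega> = 0"
  by (rule ext) (simp add: wedge_def)

locale extended_bracket = bivector +
  fixes B :: "'a form \<Rightarrow> 'a form \<Rightarrow> 'a form"
  assumes extends: "extends_bracket M \<pi> B"
begin

lemma B_form: "\<eta> \<in> \<FF> q \<Longrightarrow> \<eta>' \<in> \<FF> q' \<Longrightarrow> q + q' \<noteq> 0 \<Longrightarrow> B \<eta> \<eta>' \<in> \<FF> (q + q' - 1)"
  using conjunct1[OF extends[unfolded extends_bracket_def]] by presburger

lemma B_form0_form0: "f \<in> C \<Longrightarrow> g \<in> C \<Longrightarrow> B (form0 f) (form0 g) = 0"
  using conjunct1[OF extends[unfolded extends_bracket_def], rule_format, OF form0_form form0_form, of f g]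
  by simp

lemma B_add:
  assumes "\<eta> \<in> \<FF> q" "\<eta>\<^sub>1 \<in> \<FF> q'" "\<eta>\<^sub>2 \<in> \<FF> q'"
  shows "B \<eta> (\<eta>\<^sub>1 + \<eta>\<^sub>2) = B \<eta> \<eta>\<^sub>1 + B \<eta> \<eta>\<^sub>2"
  using extends[unfolded extends_bracket_def, THEN conjunct2, THEN conjunct1, rule_format, THEN conjunct2,
    OF assms(2,3,1)] .

lemma B_skew:
  assumes "\<eta> \<in> \<FF> q" "\<eta>' \<in> \<FF> q'"
  shows "B \<eta> \<eta>' = rsmul (- ((-1) ^ ((q + 1) * (q' + 1)))) (B \<eta>' \<eta>)"
  using extends[unfolded extends_bracket_def, THEN conjunct2, THEN conjunct2, THEN conjunct2,
    THEN conjunct1, rule_format, OF assms] .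

lemma B_form1_form1:
  assumes "\<alpha> \<in> \<FF> 1" "\<beta> \<in> \<FF> 1" shows "B \<alpha> \<beta> = bracket1 M \<pi> \<alpha> \<beta>"
  using extends[unfolded extends_bracket_def, THEN conjunct2, THEN conjunct2, THEN conjunct2,
    THEN conjunct2, THEN conjunct1, rule_format, OF assms] .

lemma B_form1_form0:
  assumes "\<alpha> \<in> \<FF> 1" "f \<in> C" shows "B \<alpha> (form0 f) = form0 (D0 f [S \<alpha>])"
proof -
  have "\<forall>\<alpha>\<in>\<FF> 1. \<forall>f\<in>C. B \<alpha> (form0 f) = form0 (pairing (D0 f) (S \<alpha>))"
    using extends unfolding extends_bracket_def by (elim conjE)
  from bspec[OF bspec[OF this assms(1)] assms(2)] show ?thesis unfolding pairing_def .
qed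

lemma B_wedge: "\<eta> \<in> \<FF> q \<Longrightarrow> \<eta>' \<in> \<FF> q' \<Longrightarrow> \<eta>'' \<in> \<FF> q'' \<Longrightarrow>
    B \<eta> (wedge \<eta>' \<eta>'') = wedge (B \<eta> \<eta>') \<eta>'' + rsmul ((-1) ^ ((q + 1) * q')) (wedge \<eta>' (B \<eta> \<eta>''))"
  using extends[unfolded extends_bracket_def, THEN conjunct2, THEN conjunct2, THEN conjunct2,
    THEN conjunct2, THEN conjunct2, THEN conjunct2, rule_format] .

lemma rsmul_one: "rsmul 1 F = F" and rsmul_minus_one: "rsmul (- 1) F = - F" for F :: "'u \<Rightarrow> 'a scalar"
  by (simp_all add: smul_def fun_eq_iff)

text \<open>A function is a wedge factor of degree 0, so the Leibniz sign is +1. The value of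
  \<open>B \<eta>\<close> on functions thus measures how far \<open>B \<eta>\<close> is from being
  linear over them.\<close>

lemma B_smul:
  assumes \<eta>: "\<eta> \<in> \<FF> q" and f: "f \<in> C" and \<zeta>: "\<zeta> \<in> \<FF> k"
  shows "B \<eta> (smul f \<zeta>) = wedge (B \<eta> (form0 f)) \<zeta> + smul f (B \<eta> \<zeta>)"
  using B_wedge[OF \<eta> form0_form[OF f] \<zeta>] unfolding wedge_form0 by (simp add: rsmul_one)

lemma B_form0_form1:
  assumes f: "f \<in> C" and \<alpha>: "\<alpha> \<in> \<FF> 1" shows "B (form0 f) \<alpha> = form0 (\<alpha> [S (D0 f)])"
proof -
  have "B (form0 f) \<alpha> = - form0 (D0 f [S \<alpha>])"
    using B_skew[OF form0_form[OF f] \<alpha>] unfolding B_form1_form0[OF \<alpha> f] by (simp add: rsmul_minus_one)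
  also have "\<dots> = form0 (\<alpha> [S (D0 f)])"
    unfolding sharp_skew[OF \<alpha> D0_form[OF f]] by (simp add: form0_def fun_eq_iff)
  finally show ?thesis .
qed

text \<open>The bracket of two functions is 0, so the bracket with \<open>form0 f\<close> is linear
  over functions. It then suffices to compare on dg \<and> dh, where the Leibniz sign -1 is the sign
  of a contraction.\<close>

lemma B_form0_form2:
  assumes f: "f \<in> C" and \<eta>: "\<eta> \<in> \<FF> 2"
  shows "B (form0 f) \<eta> [Z] = \<eta> [S (D0 f), Z]"
proof
  fix p
  have a: "S (D0 f) \<in> \<XX>" using f by simp
  have smul: "B (form0 f) (smul u \<zeta>) = smul u (B (form0 f) \<zeta>)" if "u \<in> C" "\<zeta> \<in> \<FF> 2" for u \<zeta>
    using B_smul[OF form0_form[OF f] that] unfolding B_form0_form0[OF f that(1)] wedge_zero_left by simp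
  show "B (form0 f) \<eta> [Z] p = \<eta> [S (D0 f), Z] p"
  proof (rule form2_local_principle[where \<Phi> = "\<lambda>\<eta>. B (form0 f) \<eta> [Z] p" and \<Psi> = "\<lambda>\<eta>. \<eta> [S (D0 f), Z] p", OF _ _ _ _ _ \<eta>])
    show "B (form0 f) (\<eta>1 + \<eta>2) [Z] p = B (form0 f) \<eta>1 [Z] p + B (form0 f) \<eta>2 [Z] p"
      if "\<eta>1 \<in> \<FF> 2" "\<eta>2 \<in> \<FF> 2" for \<eta>1 \<eta>2
      unfolding B_add[OF form0_form[OF f] that] by simp
    show "B (form0 f) (smul u \<zeta>) [Z] p = B (form0 f) \<zeta> [Z] p"
      if "u \<in> C" "u p = 1" "\<zeta> \<in> \<FF> 2" for u \<zeta>
      unfolding smul[OF that(1,3)] using that(2) by (simp add: smul_def)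
    fix f' g h assume f': "f' \<in> C" and g: "g \<in> C" and h: "h \<in> C"
    let ?\<zeta> = "wedge (D0 g) (D0 h)"
    have "B (form0 f) ?\<zeta> [Z] = D0 g [S (D0 f)] * D0 h [Z] - D0 g [Z] * D0 h [S (D0 f)]"
      unfolding B_wedge[OF form0_form[OF f] D0_form[OF g] D0_form[OF h]]
        B_form0_form1[OF f D0_form[OF g]] B_form0_form1[OF f D0_form[OF h]] wedge_form0
      by (simp add: smul_def wedge_eval_1[OF D0_form[OF g]] fun_eq_iff)
    then show "B (form0 f) (smul f' ?\<zeta>) [Z] p = smul f' ?\<zeta> [S (D0 f), Z] p"
      unfolding smul[OF f' wedge_form2[OF D0_form[OF g] D0_form[OF h]]]
      by (simp add: smul_def wedge_eval_2[OF D0_form[OF g]])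
  qed (simp_all add: smul_def)
qed

text \<open>The right side is the Lie derivative along \<open>S (D0 h)\<close>. All other terms of
  \<open>bracket1\<close> cancel because S \<beta> applied to h is -\<beta>(S dh).\<close>

lemma B_exact_form1:
  assumes h: "h \<in> C" and \<beta>: "\<beta> \<in> \<FF> 1" and Z: "Z \<in> \<XX>"
  shows "B (D0 h) \<beta> [Z] = S (D0 h) (\<beta> [Z]) - \<beta> [lie_bracket (S (D0 h)) Z]"
proof -
  let ?b = "S (D0 h)" and ?c = "S \<beta>"
  have c: "?c \<in> \<XX>" using \<beta> by simp
  have b: "?b \<in> \<XX>" using h by simp
  have "?c h = - \<beta> [?b]"
    using sharp_skew[OF \<beta> D0_form[OF h]] unfolding D0_eval[OF c] .
  then have 1: "Z (?c h) = - Z (\<beta> [?b])"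
    by (simp only: vf_uminus[OF Z form_C'[OF \<beta>]])
  have 2: "D0 h [lie_bracket ?c Z] = ?c (Z h) - Z (?c h)"
    unfolding D0_eval[OF lie_bracket_vf[OF c Z]] unfolding lie_bracket_def ..
  show ?thesis
    unfolding B_form1_form1[OF D0_form[OF h] \<beta>] bracket1_eval[OF D0_form[OF h] \<beta> Z] 2 1 D0_eval[OF Z] by simp
qed

text \<open>Again a Lie derivative along \<open>S (D0 h)\<close>. Both sides obey the same Leibniz
  rule on multiples, \<open>smul\<close> and \<open>L_smul\<close>, whose derivative term vanishes
  at p for the localizing functions; on wedges of exact forms the product rule reduces the claim to
  1-forms.\<close>

lemma B_exact_form2:
  assumes h: "h \<in> C" and \<eta>: "\<eta> \<in> \<FF> 2" and X: "X \<in> \<XX>" and Y: "Y \<in> \<XX>"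
  shows "B (D0 h) \<eta> [X, Y] =
    S (D0 h) (\<eta> [X, Y]) - \<eta> [lie_bracket (S (D0 h)) X, Y] - \<eta> [X, lie_bracket (S (D0 h)) Y]"
proof
  fix p
  let ?b = "S (D0 h)"
  let ?L = "\<lambda>\<eta>. ?b (\<eta> [X, Y]) - \<eta> [lie_bracket ?b X, Y] - \<eta> [X, lie_bracket ?b Y]"
  have b: "?b \<in> \<XX>" using h by simp
  note dh = D0_form[OF h]
  have smul: "B (D0 h) (smul u \<zeta>) = smul (?b u) \<zeta> + smul u (B (D0 h) \<zeta>)" if "u \<in> C" "\<zeta> \<in> \<FF> 2" for u \<zeta>
    using B_smul[OF dh that] unfolding B_form1_form0[OF dh that(1)] D0_eval[OF b] wedge_form0 .
  have L_smul: "?L (smul u \<zeta>) = ?b u * \<zeta> [X, Y] + u * ?L \<zeta>" if "u \<in> C" "\<zeta> \<in> \<FF> 2" for u \<zeta>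
    using that form_C'[OF that(2)] by (simp add: smul_def[of u \<zeta>] vf_rules[OF b] algebra_simps)
  show "B (D0 h) \<eta> [X, Y] p = ?L \<eta> p"
  proof (rule form2_local_principle[where \<Phi> = "\<lambda>\<eta>. B (D0 h) \<eta> [X, Y] p" and \<Psi> = "\<lambda>\<eta>. ?L \<eta> p", OF _ _ _ _ _ \<eta>])
    show "B (D0 h) (\<eta>1 + \<eta>2) [X, Y] p = B (D0 h) \<eta>1 [X, Y] p + B (D0 h) \<eta>2 [X, Y] p"
      if "\<eta>1 \<in> \<FF> 2" "\<eta>2 \<in> \<FF> 2" for \<eta>1 \<eta>2
      unfolding B_add[OF dh that] by simp
    show "?L (\<eta>1 + \<eta>2) p = ?L \<eta>1 p + ?L \<eta>2 p"
      if "\<eta>1 \<in> \<FF> 2" "\<eta>2 \<in> \<FF> 2" for \<eta>1 \<eta>2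
      using form_C'[OF that(1)] form_C'[OF that(2)] by (simp add: vf_add[OF b])
    show "B (D0 h) (smul u \<zeta>) [X, Y] p = B (D0 h) \<zeta> [X, Y] p"
      if "u \<in> C" "u p = 1" "\<forall>X\<in>\<XX>. X u p = 0" "\<zeta> \<in> \<FF> 2" for u \<zeta>
      unfolding smul[OF that(1,4)] using that(2,3) b by (simp add: smul_def)
    show "?L (smul u \<zeta>) p = ?L \<zeta> p"
      if "u \<in> C" "u p = 1" "\<forall>X\<in>\<XX>. X u p = 0" "\<zeta> \<in> \<FF> 2" for u \<zeta>
      unfolding L_smul[OF that(1,4)] using that(2,3) b by simp
    fix f g k assume f: "f \<in> C" and g: "g \<in> C" and k: "k \<in> C"
    let ?\<zeta> = "wedge (D0 g) (D0 k)"
    note dg = D0_form[OF g] and dk = D0_form[OF k]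
    have \<zeta>: "?\<zeta> \<in> \<FF> 2" using wedge_form2[OF dg dk] .
    have Bdg: "B (D0 h) (D0 g) \<in> \<FF> 1" using B_form[OF dh dg] by (simp add: One_nat_def)
    have eval: "B (D0 h) ?\<zeta> [X, Y] = B (D0 h) (D0 g) [X] * D0 k [Y] - B (D0 h) (D0 g) [Y] * D0 k [X]
        + (D0 g [X] * B (D0 h) (D0 k) [Y] - D0 g [Y] * B (D0 h) (D0 k) [X])"
      unfolding B_wedge[OF dh dg dk] by (simp add: smul_def wedge_eval_2[OF Bdg] wedge_eval_2[OF dg] fun_eq_iff)
    have "B (D0 h) ?\<zeta> [X, Y] = ?L ?\<zeta>"
      unfolding eval B_exact_form1[OF h dg X] B_exact_form1[OF h dg Y] B_exact_form1[OF h dk X] B_exact_form1[OF h dk Y]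
        wedge_eval_2[OF dg]
      using form_C'[OF dg] form_C'[OF dk] by (simp add: vf_rules[OF b] algebra_simps)
    then show "B (D0 h) (smul f ?\<zeta>) [X, Y] p = ?L (smul f ?\<zeta>) p"
      unfolding smul[OF f \<zeta>] L_smul[OF f \<zeta>] by (simp add: smul_def)
  qed
qed

end

section \<open>Comparison of the bracket with \<Omega> and the differential d_P\<close>

locale twist_bracket = twist + extended_bracket
begin

lemma P_tensor: "P \<in> tensor11 M"
  unfolding tensor11_def Let_def
proof (intro CollectI conjI ballI)
  show "P (X + Y) = P X + P Y" if "X \<in> \<XX>" "Y \<in> \<XX>" for X Y
    unfolding P_def flat_add[OF that] by (rule sharp_add) (simp_all add: that)
  show "P (smul f X) = smul f (P X)" if "f \<in> C" "X \<in> \<XX>" for f X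
    unfolding P_def flat_smul[OF that] by (rule sharp_smul) (simp_all add: that)
qed simp

text \<open>The right side is d_P f at \<open>Z\<close>. In degrees 2 and 0 the bracket is
  symmetric, so the contraction formula for \<open>B (form0 f)\<close> applies directly.\<close>

lemma B_\<Omega>_form0:
  assumes f: "f \<in> C" and Z: "Z \<in> \<XX>" shows "B \<Omega> (form0 f) [Z] = P Z f"
proof -
  have "B \<Omega> (form0 f) = B (form0 f) \<Omega>"
    using B_skew[OF \<Omega> form0_form[OF f]] by (simp add: rsmul_one)
  then have "B \<Omega> (form0 f) [Z] = \<Omega> [S (D0 f), Z]" using B_form0_form2[OF f \<Omega>] by simp
  also have "\<dots> = D0 f [P Z]"
    unfolding P_eval[OF Z D0_form[OF f]] by (rule form2_skew[OF \<Omega>])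
  also have "\<dots> = P Z f" by (rule D0_eval[OF P_vf[OF Z]])
  finally show ?thesis .
qed

text \<open>The right side is d_P applied to dh. In degrees 2 and 1 the bracket is skew, so the left
  side is minus the Lie derivative of \<Omega> along b = S dh; closedness of \<Omega> and
  \<Omega>(b, Z) = P Z h convert it.\<close>

lemma B_\<Omega>_exact:
  assumes h: "h \<in> C" and X: "X \<in> \<XX>" and Y: "Y \<in> \<XX>"
  shows "B \<Omega> (D0 h) [X, Y] = P X (Y h) - P Y (X h) - bracket_tensor P X Y h"
proof -
  let ?b = "S (D0 h)"
  have b: "?b \<in> \<XX>" using h by simp
  have "B \<Omega> (D0 h) = - B (D0 h) \<Omega>"
    using B_skew[OF \<Omega> D0_form[OF h]] by (simp add: rsmul_minus_one)
  then have "B \<Omega> (D0 h) [X, Y] = - B (D0 h) \<Omega> [X, Y]" by (metis uminus_apply)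
  then have 1: "B \<Omega> (D0 h) [X, Y] =
      - (?b (\<Omega> [X, Y]) - \<Omega> [lie_bracket ?b X, Y] - \<Omega> [X, lie_bracket ?b Y])"
    unfolding B_exact_form2[OF h \<Omega> X Y] .
  have \<Omega>b: "\<Omega> [?b, Z] = P Z h" "\<Omega> [Z, ?b] = - P Z h" if Z: "Z \<in> \<XX>" for Z
    using P_eval[OF Z D0_form[OF h]] form2_skew[OF \<Omega>, of ?b Z] unfolding D0_eval[OF P_vf[OF Z]]
    by simp_all
  \<comment> \<open>This is d\<Omega>(b, X, Y) = 0 with every \<Omega>(b, Z) replaced by
    \<open>P Z h\<close>.\<close>
  have 2: "?b (\<Omega> [X, Y]) - X (P Y h) + Y (P X h)
    - \<Omega> [lie_bracket ?b X, Y] + \<Omega> [lie_bracket ?b Y, X] + P (lie_bracket X Y) h = 0"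
    using closed_eval[OF b X Y] unfolding \<Omega>b(1)[OF X] \<Omega>b(1)[OF Y] \<Omega>b(2)[OF lie_bracket_vf[OF X Y]] by simp
  have 3: "bracket_tensor P X Y h = (P X (Y h) - Y (P X h)) + (X (P Y h) - P Y (X h)) - P (lie_bracket X Y) h"
    unfolding bracket_tensor_def by (simp add: lie_bracket_def[of "P X"] lie_bracket_def[of X "P Y"])
  show ?thesis
  proof
    fix p
    show "B \<Omega> (D0 h) [X, Y] p = (P X (Y h) - P Y (X h) - bracket_tensor P X Y h) p"
      using fun_cong[OF 2, of p] unfolding 1 3 form2_skew[OF \<Omega>, of X "lie_bracket ?b Y"] by simp
  qed
qed

text \<open>Here \<open>?D\<close> is d_P written out. Both sides have the same Leibniz rule on
  multiples, \<open>smul\<close> and \<open>D_smul\<close>, and on dg \<and> dh both reduce to the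
  values on exact 1-forms, so the localization principle for 2-forms applies.\<close>

lemma B_closed:
  assumes \<eta>: "\<eta> \<in> \<FF> 2" and X: "X \<in> \<XX>" and Y: "Y \<in> \<XX>" and Z: "Z \<in> \<XX>"
  shows "B \<Omega> \<eta> [X, Y, Z] = d_tensor M P \<eta> [X, Y, Z]"
proof
  fix p
  let ?K = "bracket_tensor P"
  let ?D = "\<lambda>\<eta>. P X (\<eta> [Y, Z]) - P Y (\<eta> [X, Z]) + P Z (\<eta> [X, Y])
    - \<eta> [?K X Y, Z] + \<eta> [?K X Z, Y] - \<eta> [?K Y Z, X]"
  note PX = P_vf[OF X] and PY = P_vf[OF Y] and PZ = P_vf[OF Z]
  note rules = vf_rules[OF PX] vf_rules[OF PY] vf_rules[OF PZ]
  have smul: "B \<Omega> (smul u \<zeta>) [X, Y, Z] =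
      P X u * \<zeta> [Y, Z] - P Y u * \<zeta> [X, Z] + P Z u * \<zeta> [X, Y] + u * B \<Omega> \<zeta> [X, Y, Z]"
    if u: "u \<in> C" and "\<zeta> \<in> \<FF> 2" for u \<zeta>
  proof -
    have 1: "B \<Omega> (form0 u) \<in> \<FF> 1" using B_form[OF \<Omega> form0_form[OF u]] by (simp add: One_nat_def)
    show ?thesis unfolding B_smul[OF \<Omega> that] plus_fun_apply wedge_eval_12[OF 1]
      B_\<Omega>_form0[OF u X] B_\<Omega>_form0[OF u Y] B_\<Omega>_form0[OF u Z] by (simp add: smul_def fun_eq_iff)
  qed
  have D_smul: "?D (smul u \<zeta>) =
      P X u * \<zeta> [Y, Z] - P Y u * \<zeta> [X, Z] + P Z u * \<zeta> [X, Y] + u * ?D \<zeta>"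
    if "u \<in> C" "\<zeta> \<in> \<FF> 2" for u \<zeta>
    using that form_C'[OF that(2)] by (simp add: smul_def[of u \<zeta>] rules algebra_simps)
  have "B \<Omega> \<eta> [X, Y, Z] p = ?D \<eta> p"
  proof (rule form2_local_principle[where \<Phi> = "\<lambda>\<eta>. B \<Omega> \<eta> [X, Y, Z] p" and \<Psi> = "\<lambda>\<eta>. ?D \<eta> p", OF _ _ _ _ _ \<eta>])
    show "B \<Omega> (\<eta>1 + \<eta>2) [X, Y, Z] p = B \<Omega> \<eta>1 [X, Y, Z] p + B \<Omega> \<eta>2 [X, Y, Z] p"
      if "\<eta>1 \<in> \<FF> 2" "\<eta>2 \<in> \<FF> 2" for \<eta>1 \<eta>2
      unfolding B_add[OF \<Omega> that] by simp
    show "?D (\<eta>1 + \<eta>2) p = ?D \<eta>1 p + ?D \<eta>2 p"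
      if "\<eta>1 \<in> \<FF> 2" "\<eta>2 \<in> \<FF> 2" for \<eta>1 \<eta>2
      using form_C'[OF that(1)] form_C'[OF that(2)] by (simp add: rules)
    show "B \<Omega> (smul u \<zeta>) [X, Y, Z] p = B \<Omega> \<zeta> [X, Y, Z] p"
      if "u \<in> C" "u p = 1" "\<forall>X\<in>\<XX>. X u p = 0" "\<zeta> \<in> \<FF> 2" for u \<zeta>
      unfolding smul[OF that(1,4)] using that(2) bspec[OF that(3) PX] bspec[OF that(3) PY] bspec[OF that(3) PZ] by simp
    show "?D (smul u \<zeta>) p = ?D \<zeta> p"
      if "u \<in> C" "u p = 1" "\<forall>X\<in>\<XX>. X u p = 0" "\<zeta> \<in> \<FF> 2" for u \<zeta>
      unfolding D_smul[OF that(1,4)] using that(2) bspec[OF that(3) PX] bspec[OF that(3) PY] bspec[OF that(3) PZ] by simp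
    fix f g h assume f: "f \<in> C" and g: "g \<in> C" and h: "h \<in> C"
    let ?\<zeta> = "wedge (D0 g) (D0 h)"
    note dg = D0_form[OF g] and dh = D0_form[OF h]
    have \<zeta>: "?\<zeta> \<in> \<FF> 2" using wedge_form2[OF dg dh] .
    note K = bracket_tensor_vf[OF P_tensor]
    have gh: "A g \<in> C" "A h \<in> C" if "A \<in> \<XX>" for A using vf_C[OF that] g h by auto
    \<comment> \<open>The Leibniz sign is -1: the bracket with a 2-form has odd degree and passes
      the 1-form dg.\<close>
    have eval: "B \<Omega> ?\<zeta> [X, Y, Z] =
        (B \<Omega> (D0 g) [Y, Z] * D0 h [X] - B \<Omega> (D0 g) [X, Z] * D0 h [Y] + B \<Omega> (D0 g) [X, Y] * D0 h [Z])
        - (D0 g [X] * B \<Omega> (D0 h) [Y, Z] - D0 g [Y] * B \<Omega> (D0 h) [X, Z] + D0 g [Z] * B \<Omega> (D0 h) [X, Y])"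
      unfolding B_wedge[OF \<Omega> dg dh] plus_fun_apply wedge_eval_21[OF dh] smul_def wedge_eval_12[OF dg]
      by (simp add: fun_eq_iff)
    have "B \<Omega> ?\<zeta> [X, Y, Z] = ?D ?\<zeta>"
      unfolding eval B_\<Omega>_exact[OF g X Y] B_\<Omega>_exact[OF g X Z] B_\<Omega>_exact[OF g Y Z]
        B_\<Omega>_exact[OF h X Y] B_\<Omega>_exact[OF h X Z] B_\<Omega>_exact[OF h Y Z] wedge_eval_2[OF dg]
        D0_eval[OF X] D0_eval[OF Y] D0_eval[OF Z] D0_eval[OF K[OF X Y]] D0_eval[OF K[OF X Z]] D0_eval[OF K[OF Y Z]]
      using gh[OF X] gh[OF Y] gh[OF Z] by (simp add: rules algebra_simps)
    then show "B \<Omega> (smul f ?\<zeta>) [X, Y, Z] p = ?D (smul f ?\<zeta>) p"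
      unfolding smul[OF f \<zeta>] D_smul[OF f \<zeta>] by simp
  qed
  then show "B \<Omega> \<eta> [X, Y, Z] p = d_tensor M P \<eta> [X, Y, Z] p"
    unfolding d_tensor_eq[OF P_tensor \<eta>] algebroid_d_3[OF X Y Z] .
qed

text \<open>The parenthesis on the right is what \<open>phi_L_eval\<close> leaves besides \<phi> and
  d_N \<Omega>, so the factor 2 is cancelled by the 1/2 in front of the bracket of \<Omega> with
  itself. The identity is a combination of three instances of d\<Omega> = 0.\<close>

lemma d_P_\<Omega>:
  assumes X: "X \<in> \<XX>" and Y: "Y \<in> \<XX>" and Z: "Z \<in> \<XX>"
  shows "d_tensor M P \<Omega> [X, Y, Z] = 2 * (bracket1 M \<pi> (flat X) (flat Y) [Z]
       + \<Omega> [Z, lie_bracket (P X) Y + lie_bracket X (P Y) - P (lie_bracket X Y)])"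
proof -
  note PX = P_vf[OF X] and PY = P_vf[OF Y] and PZ = P_vf[OF Z]
  \<comment> \<open>Both sides are values of \<pi> on \<open>flat A\<close> and
    \<open>flat E\<close>: the skewness of \<pi> and that of \<Omega> compensate each other.\<close>
  have \<Omega>P: "\<Omega> [A, P E] = \<Omega> [P A, E]" if A: "A \<in> \<XX>" and E: "E \<in> \<XX>" for A E
  proof -
    have "\<Omega> [A, P E] = flat A [S (flat E)]" by (simp add: P_def)
    also have "\<dots> = - flat E [S (flat A)]" by (rule sharp_skew) (simp_all add: A E)
    also have "\<dots> = \<Omega> [P A, E]" unfolding form2_skew[OF \<Omega>, of "P A" E] by (simp add: P_def)
    finally show ?thesis .
  qed
  have skew: "\<Omega> [P A, E] = - \<Omega> [P E, A]" if "A \<in> \<XX>" "E \<in> \<XX>" for A E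
    using \<Omega>P[OF that] form2_skew[OF \<Omega>, of A "P E"] by simp
  have vskew: "V (\<Omega> [P A, E]) = - V (\<Omega> [P E, A])" if "V \<in> \<XX>" "A \<in> \<XX>" "E \<in> \<XX>" for V A E
    unfolding skew[OF that(2,3)] by (rule vf_uminus[OF that(1) \<Omega>_C])
  have br: "\<Omega> [lie_bracket A (P E), F] = - \<Omega> [lie_bracket (P E) A, F]" if "A \<in> \<XX>" "E \<in> \<XX>" for A E F
    unfolding lie_bracket_skew[of A "P E"] by (rule form_uminus0[OF \<Omega>]) (simp add: that)
  \<comment> \<open>\<open>E1\<close>, \<open>E2\<close> and \<open>E3\<close> are d\<Omega> = 0
    with \<open>P\<close> applied to \<open>X\<close>, \<open>Y\<close> and \<open>Z\<close>
    respectively. Symmetry of \<open>P\<close> under \<Omega> brings all terms into the shapes that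
    occur in \<open>D\<close>, \<open>W'\<close> and \<open>b\<close>.\<close>
  have E1: "P X (\<Omega> [Y, Z]) - Y (\<Omega> [P X, Z]) + Z (\<Omega> [P X, Y]) - \<Omega> [lie_bracket (P X) Y, Z]
      + \<Omega> [lie_bracket (P X) Z, Y] - \<Omega> [P (lie_bracket Y Z), X] = 0"
    using closed_eval[OF PX Y Z] unfolding \<Omega>P[OF lie_bracket_vf[OF Y Z] X] .
  have E2: "P Y (\<Omega> [X, Z]) - X (\<Omega> [P Y, Z]) - Z (\<Omega> [P X, Y]) - \<Omega> [lie_bracket (P Y) X, Z]
      + \<Omega> [lie_bracket (P Y) Z, X] - \<Omega> [P (lie_bracket X Z), Y] = 0"
    using closed_eval[OF PY X Z] unfolding \<Omega>P[OF lie_bracket_vf[OF X Z] Y] vskew[OF Z Y X] by simp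
  have E3: "P Z (\<Omega> [X, Y]) + X (\<Omega> [P Y, Z]) - Y (\<Omega> [P X, Z]) - \<Omega> [lie_bracket (P Z) X, Y]
      + \<Omega> [lie_bracket (P Z) Y, X] - \<Omega> [P (lie_bracket X Y), Z] = 0"
    using closed_eval[OF PZ X Y] unfolding \<Omega>P[OF lie_bracket_vf[OF X Y] Z] vskew[OF X Z Y] vskew[OF Y Z X]
    by simp
  have K: "\<Omega> [bracket_tensor P A E, F] = \<Omega> [lie_bracket (P A) E, F] - \<Omega> [lie_bracket (P E) A, F]
      - \<Omega> [P (lie_bracket A E), F]" if A: "A \<in> \<XX>" and E: "E \<in> \<XX>" for A E F
    unfolding bracket_tensor_def using A E
    by (simp add: form_diff0[OF \<Omega>] form_add0[OF \<Omega>] br)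
  have D: "d_tensor M P \<Omega> [X, Y, Z] = P X (\<Omega> [Y, Z]) - P Y (\<Omega> [X, Z]) + P Z (\<Omega> [X, Y])
      - (\<Omega> [lie_bracket (P X) Y, Z] - \<Omega> [lie_bracket (P Y) X, Z] - \<Omega> [P (lie_bracket X Y), Z])
      + (\<Omega> [lie_bracket (P X) Z, Y] - \<Omega> [lie_bracket (P Z) X, Y] - \<Omega> [P (lie_bracket X Z), Y])
      - (\<Omega> [lie_bracket (P Y) Z, X] - \<Omega> [lie_bracket (P Z) Y, X] - \<Omega> [P (lie_bracket Y Z), X])"
    unfolding d_tensor_eq[OF P_tensor \<Omega>] algebroid_d_3[OF X Y Z] K[OF X Y] K[OF X Z] K[OF Y Z] ..
  have W': "\<Omega> [Z, lie_bracket (P X) Y + lie_bracket X (P Y) - P (lie_bracket X Y)] =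
      - (\<Omega> [lie_bracket (P X) Y, Z] - \<Omega> [lie_bracket (P Y) X, Z] - \<Omega> [P (lie_bracket X Y), Z])"
    unfolding form2_skew[OF \<Omega>, of Z] bracket_tensor_def[symmetric] K[OF X Y] ..
  have b: "bracket1 M \<pi> (flat X) (flat Y) [Z] = P X (\<Omega> [Y, Z]) + \<Omega> [lie_bracket (P X) Z, Y]
      - P Y (\<Omega> [X, Z]) - \<Omega> [lie_bracket (P Y) Z, X] + Z (\<Omega> [P X, Y])"
    unfolding bracket1_eval[OF flat_form[OF X] flat_form[OF Y] Z] P_def[symmetric] flat_eval
      \<Omega>P[OF Y X] vskew[OF Z Y X] form2_skew[OF \<Omega>, of Y "lie_bracket (P X) Z"]
      form2_skew[OF \<Omega>, of X "lie_bracket (P Y) Z"] by simp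
  \<comment> \<open>The left side minus the right side is \<open>E2\<close> + \<open>E3\<close> -
    \<open>E1\<close>.\<close>
  show ?thesis unfolding D W' b
  proof
    fix p
    show "(P X (\<Omega> [Y, Z]) - P Y (\<Omega> [X, Z]) + P Z (\<Omega> [X, Y])
      - (\<Omega> [lie_bracket (P X) Y, Z] - \<Omega> [lie_bracket (P Y) X, Z] - \<Omega> [P (lie_bracket X Y), Z])
      + (\<Omega> [lie_bracket (P X) Z, Y] - \<Omega> [lie_bracket (P Z) X, Y] - \<Omega> [P (lie_bracket X Z), Y])
      - (\<Omega> [lie_bracket (P Y) Z, X] - \<Omega> [lie_bracket (P Z) Y, X] - \<Omega> [P (lie_bracket Y Z), X])) p =
      (2 * (P X (\<Omega> [Y, Z]) + \<Omega> [lie_bracket (P X) Z, Y]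
      - P Y (\<Omega> [X, Z]) - \<Omega> [lie_bracket (P Y) Z, X] + Z (\<Omega> [P X, Y])
      + - (\<Omega> [lie_bracket (P X) Y, Z] - \<Omega> [lie_bracket (P Y) X, Z] - \<Omega> [P (lie_bracket X Y), Z]))) p"
      using fun_cong[OF E1, of p] fun_cong[OF E2, of p] fun_cong[OF E3, of p] by simp
  qed
qed

lemma phi_L_eq: "phi_L M \<pi> N \<phi> L = \<phi> + d_tensor M N \<Omega> + rsmul (1 / 2) (B \<Omega> \<Omega>)"
proof
  fix Xs
  show "phi_L M \<pi> N \<phi> L Xs = (\<phi> + d_tensor M N \<Omega> + rsmul (1 / 2) (B \<Omega> \<Omega>)) Xs"
  proof (cases "length Xs = 3 \<and> set Xs \<subseteq> \<XX>")
    case True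
    then obtain X Y Z where Xs: "Xs = [X, Y, Z]" and X: "X \<in> \<XX>" and Y: "Y \<in> \<XX>" and Z: "Z \<in> \<XX>"
      by (auto simp: numeral_3_eq_3 length_Suc_conv)
    show ?thesis
      unfolding Xs phi_L_eval[OF X Y Z] plus_fun_apply smul_def B_closed[OF \<Omega> X Y Z] d_P_\<Omega>[OF X Y Z]
      by (simp add: fun_eq_iff)
  next
    case False
    have "B \<Omega> \<Omega> \<in> \<FF> 3" using B_form[OF \<Omega> \<Omega>] by simp
    then have "B \<Omega> \<Omega> Xs = 0" using form_outside False by blast
    moreover have "d_tensor M N \<Omega> Xs = 0" unfolding d_tensor_eq[OF N \<Omega>]
      by (rule algebroid_d_outside[OF \<Omega>]) (use False in auto)
    ultimately show ?thesis
      unfolding phi_L_outside[OF False] plus_fun_apply form_outside[OF \<phi> False] smul_def by (simp add: fun_eq_iff)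
  qed
qed

end

theorem theorem12:
  fixes M :: "('a::{t2_space,second_countable_topology}, 'e::euclidean_space) manifold"
    and \<pi> :: "'a bivector"
    and N :: "'a vfield \<Rightarrow> 'a vfield"
    and \<phi> \<Omega> :: "'a form"
    and B :: "'a form \<Rightarrow> 'a form \<Rightarrow> 'a form"
  assumes "pqn_manifold M \<pi> N \<phi>"
    and "\<Omega> \<in> forms M 2"
    and "extends_bracket M \<pi> B"
    and "ext_d M \<Omega> = 0"
  shows "(\<forall>k. \<forall>\<psi>\<in>forms M k.
            d_L M \<pi> N \<phi> (graph_sections M \<Omega>) \<psi> = d_tensor M (\<lambda>X. N X + sharp M \<pi> (iprod X \<Omega>)) \<psi>)
       \<and> phi_L M \<pi> N \<phi> (graph_sections M \<Omega>) = \<phi> + d_tensor M N \<Omega> + rsmul (1/2) (B \<Omega> \<Omega>)"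
proof -
  interpret twist_bracket M \<pi> N \<phi> \<Omega> B
    using assms by unfold_locales (auto simp: pqn_manifold_def poisson_def)
  show ?thesis using d_L_eq phi_L_eq by blast
qed

end
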